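(* For every $2\le p<\infty$ there is a constant $C_p>0$, depending only on $p$, such that for every $n\ge1$, every $k\in[n]$ and every $f\in L_p(\mathbb{T}^n)$ with $\widehat f(0)=0$, $$\frac1{\binom nk}\sum_{\substack{\mathsf S\subseteq[n]\\ |\mathsf S|=k}}\Big\|\sum_{g\in\mathbb{Z}^{\mathsf S}}\widehat f(g)e^{2\pi i\langle\cdot,g\rangle}\Big\|_{L_p(\mathbb{T}^n)}^p\ \le\ C_p\bigg(\frac kn\sum_{j=1}^n\|\partial_jf\|_{L_p(\mathbb{T}^n)}^p+\Big(\frac kn\Big)^{p/2}\|f\|_{L_p(\mathbb{T}^n)}^p\bigg),$$ where $\partial_jf=\sum_{g\in\mathbb{Z}^n,\ g_j\neq0}\widehat f(g)e^{2\pi i\langle\cdot,g\rangle}$.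
   Context: $[n]=\{1,\dots,n\}$; $\mathbb{T}^n=\mathbb{R}^n/\mathbb{Z}^n$ carries its normalized Haar measure and $f$ is complex-valued with Fourier series $f(x)=\sum_{g\in\mathbb{Z}^n}\widehat f(g)e^{2\pi i\langle x,g\rangle}$. For $\mathsf S\subset[n]$, $\mathbb{Z}^{\mathsf S}$ is the subgroup of those $g=(g_1,\dots,g_n)\in\mathbb{Z}^n$ with $g_j=0$ for all $j\notin\mathsf S$. *)

theory Defs
  imports "HOL-Probability.Probability"
begin

text \<open>
  The torus \<open>\<real>\<^sup>n / \<int>\<^sup>n\<close> with normalized Haar measure, realised on the fundamental domain
  \<open>[0,1)\<^sup>n\<close>: points are functions on \<open>{1..n}\<close> (extended by \<open>undefined\<close>), so that
  \<open>n\<close> is an ordinary variable and constants can be chosen before it.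
\<close>
definition torus :: "nat \<Rightarrow> (nat \<Rightarrow> real) measure" where
  "torus n = Pi\<^sub>M {1..n} (\<lambda>_. restrict_space lborel {0..<1})"

lemma prob_space_torus: "prob_space (torus n)"
  unfolding torus_def
  by (intro prob_space_PiM prob_spaceI) (simp add: emeasure_restrict_space space_restrict_space)

text \<open>\<open>\<int>\<^sup>S\<close>; in particular \<open>\<int>\<^sup>n\<close> is \<open>int_lattice {1..n}\<close>.\<close>
definition int_lattice :: "nat set \<Rightarrow> (nat \<Rightarrow> int) set" where
  "int_lattice S = {g. \<forall>j. j \<notin> S \<longrightarrow> g j = 0}"

definition character :: "nat \<Rightarrow> (nat \<Rightarrow> int) \<Rightarrow> (nat \<Rightarrow> real) \<Rightarrow> complex" where
  "character n g x = exp (2 * complex_of_real pi * \<i> * complex_of_real (\<Sum>j=1..n. x j * real_of_int (g j)))"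

definition fourier_coeff :: "nat \<Rightarrow> ((nat \<Rightarrow> real) \<Rightarrow> complex) \<Rightarrow> (nat \<Rightarrow> int) \<Rightarrow> complex" where
  "fourier_coeff n f g = (\<integral>x. f x * cnj (character n g x) \<partial>torus n)"

text \<open>The \<open>p\<close>-th power of the \<open>L\<^sub>p\<close> norm, with value \<open>\<infinity>\<close> outside \<open>L\<^sub>p\<close>.\<close>
definition Lp_norm_pow :: "nat \<Rightarrow> real \<Rightarrow> ((nat \<Rightarrow> real) \<Rightarrow> complex) \<Rightarrow> ennreal" where
  "Lp_norm_pow n p f = (\<integral>\<^sup>+x. ennreal (norm (f x) powr p) \<partial>torus n)"

definition Lp :: "nat \<Rightarrow> real \<Rightarrow> ((nat \<Rightarrow> real) \<Rightarrow> complex) set" where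
  "Lp n p = {f \<in> borel_measurable (torus n). Lp_norm_pow n p f < \<infinity>}"

text \<open>
  \<open>h\<close> is the sum of the series \<open>\<Sum>g\<in>A. fourier_coeff n f g * character n g\<close>, converging
  unconditionally in \<open>L\<^sub>2\<close>. For \<open>f\<close> in \<open>L\<^sub>p\<close> with \<open>p \<ge> 2\<close> such an \<open>h\<close> exists, and it is
  unique up to null sets.
\<close>
definition is_fourier_sum ::
  "nat \<Rightarrow> ((nat \<Rightarrow> real) \<Rightarrow> complex) \<Rightarrow> (nat \<Rightarrow> int) set \<Rightarrow> ((nat \<Rightarrow> real) \<Rightarrow> complex) \<Rightarrow> bool" where
  "is_fourier_sum n f A h \<longleftrightarrow>
     h \<in> borel_measurable (torus n) \<and>
     ((\<lambda>F. Lp_norm_pow n 2 (\<lambda>x. h x - (\<Sum>g\<in>F. fourier_coeff n f g * character n g x)))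
        \<longlongrightarrow> 0) (finite_subsets_at_top A)"

definition fourier_sum ::
  "nat \<Rightarrow> ((nat \<Rightarrow> real) \<Rightarrow> complex) \<Rightarrow> (nat \<Rightarrow> int) set \<Rightarrow> (nat \<Rightarrow> real) \<Rightarrow> complex" where
  "fourier_sum n f A = (SOME h. is_fourier_sum n f A h)"

text \<open>This \<open>\<partial>\<^sub>j\<close> is a Fourier projection, not a derivative.\<close>
definition partial_part ::
  "nat \<Rightarrow> nat \<Rightarrow> ((nat \<Rightarrow> real) \<Rightarrow> complex) \<Rightarrow> (nat \<Rightarrow> real) \<Rightarrow> complex" where
  "partial_part n j f = fourier_sum n f {g \<in> int_lattice {1..n}. g j \<noteq> 0}"

end

theory Submission
  imports Defs
begin

text \<open>
  The Fourier sum of \<open>f\<close> over \<open>\<int>\<^sup>S\<close> is the average \<open>E\<^sub>S f\<close> over the coordinates outside \<open>S\<close>, and \<open>\<partial>\<^sub>j f = f - E\<^bsub>[n]-j\<^esub> f\<close>. Reveal the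
  coordinates in a uniformly random order; then \<open>E\<^sub>S f\<close> with \<open>|S| = m\<close> runs through a martingale with
  increments \<open>d = E\<^bsub>S+j\<^esub> f - E\<^sub>S f = E\<^bsub>S+j\<^esub> \<partial>\<^sub>j f\<close>. The expansion
  \<open>|a + b|\<^sup>p \<le> |a|\<^sup>p + p|a|\<^bsup>p-2\<^esup> Re (cnj a b) + C (|a|\<^bsup>p-2\<^esup> |b|\<^sup>2 + |b|\<^sup>p)\<close> with \<open>a = E\<^sub>S f\<close>, \<open>b = d\<close> has
  vanishing linear term. The term \<open>|d|\<^sup>p\<close> is controlled by \<open>\<partial>\<^sub>j f\<close>. The increments for
  different \<open>j\<close> are orthogonal even with the \<open>S\<close>-measurable weight \<open>|E\<^sub>S f|\<^bsup>p-2\<^esup>\<close>, so by Bessel's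
  inequality the quadratic terms sum over \<open>j\<close> to at most \<open>\<integral> |E\<^sub>S f|\<^bsup>p-2\<^esup> |f|\<^sup>2\<close>, and Young's inequality
  turns this into \<open>\<epsilon> |E\<^sub>S f|\<^sup>p + C\<^sub>\<epsilon> (k/n)\<^bsup>p/2\<^esup> |f|\<^sup>p\<close> up to a factor \<open>n/k\<close>. For \<open>k \<le> n/2\<close> each step has
  weight \<open>O(1/n)\<close>, and \<open>k\<close> steps give the theorem; for \<open>k > n/2\<close> the contractivity of \<open>E\<^sub>S\<close> suffices.
\<close>


subsection \<open>Scalar inequalities\<close>

text \<open>Three obstacles shape the proof. First, averages of unbounded functions compose and
  subtract only almost everywhere, so the martingale argument runs on bounded functions and a
  truncation transfers the bound. Truncation destroys the vanishing mean, hence the bounded version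
  carries the extra term \<open>norm (\<integral>x. f x \<partial>P) powr p\<close>, the value of
  the martingale before any coordinate is revealed. Second, each step puts a multiple of the current
  layer average back on the right. Young's parameter is \<open>1 / (4 * C)\<close>, so that all
  \<open>k\<close> steps together return at most half of the largest layer average; this half is
  absorbed, and the constant stays independent of \<open>k\<close> and \<open>n\<close>. Third, a
  Fourier sum is an unconditional L2 limit picked by choice. Identifying it with an average means
  comparing Fourier coefficients, which decides the matter only if the characters are complete.
  Completeness is obtained from Stone-Weierstrass on the circle, products over the coordinates, and
  a pi-lambda argument from boxes to all measurable sets.\<close>

lemma powr_tangent:
  fixes q :: real
  assumes "1 \<le> q" "0 \<le> c" "0 \<le> s"
  shows "c powr q + q * c powr (q - 1) * (s - c) \<le> s powr q"
\<comment> \<open>Young's exponent \<open>q / (q - 1)\<close> requires \<open>q > 1\<close>. At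
  \<open>c = 0\<close> the slope term vanishes because \<open>0 powr _ = 0\<close>, also for
  exponent 0.\<close>
proof (cases "q = 1 \<or> c = 0")
  case True
  then show ?thesis using assms by (auto simp: algebra_simps)
next
  case False
  with assms have q: "q > 1" and c: "c > 0" by auto
  have "c powr (q - 1) * s \<le> (c powr (q - 1)) powr (q / (q - 1)) / (q / (q - 1)) + s powr q / q"
    using q assms by (intro Youngs_inequality) (auto simp: field_simps)
  also have "(c powr (q - 1)) powr (q / (q - 1)) = c powr q"
    using q by (simp add: powr_powr)
  finally have *: "q * (c powr (q - 1) * s) \<le> (q - 1) * c powr q + s powr q"
    using q by (simp add: field_simps)
  have "c powr q = c powr (q - 1) * c" using c by (simp add: powr_diff)
  with * show ?thesis by (simp add: algebra_simps)
qed

text \<open>Mean value theorem. On [1/4, 4] one has |ln t| \<le> ln 4, which bounds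
  \<open>t powr (r - 1)\<close> by \<open>4 powr \<bar>r - 1\<bar>\<close> for either sign of
  \<open>r - 1\<close>. The interval is the range of (|a + b| / |a|)^2 when |b| \<le> |a| /
  2.\<close>

lemma powr_lipschitz_near_one:
  fixes r s :: real
  assumes "0 \<le> r" "1 / 4 \<le> s" "s \<le> 4"
  shows "\<bar>s powr r - 1\<bar> \<le> r * 4 powr \<bar>r - 1\<bar> * \<bar>s - 1\<bar>"
proof -
  have der: "((\<lambda>t. t powr r) has_real_derivative r * t powr (r - 1)) (at t within {1/4..4})"
    if "t \<in> {1/4..4}" for t :: real
    by (rule has_field_derivative_at_within, rule has_real_derivative_powr) (use that in auto)
  have bd: "norm (r * t powr (r - 1)) \<le> r * 4 powr \<bar>r - 1\<bar>" if "t \<in> {1/4..4}" for t :: real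
  proof -
    have "\<bar>ln t\<bar> \<le> ln 4"
    proof -
      have "ln t \<le> ln 4" using that by auto
      moreover have "ln (1/4) \<le> ln t" using that by (subst ln_le_cancel_iff) auto
      ultimately show ?thesis by (simp add: ln_div)
    qed
    then have "\<bar>r - 1\<bar> * \<bar>ln t\<bar> \<le> \<bar>r - 1\<bar> * ln 4" by (intro mult_left_mono) auto
    moreover have "(r - 1) * ln t \<le> \<bar>r - 1\<bar> * \<bar>ln t\<bar>"
      unfolding abs_mult[symmetric] by (rule abs_ge_self)
    ultimately have "(r - 1) * ln t \<le> \<bar>r - 1\<bar> * ln 4" by linarith
    then have "t powr (r - 1) \<le> 4 powr \<bar>r - 1\<bar>" using that by (simp add: powr_def)
    then show ?thesis using assms by (simp add: abs_mult mult_left_mono)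
  qed
  have "norm (s powr r - 1 powr r) \<le> r * 4 powr \<bar>r - 1\<bar> * norm (s - 1)"
    by (rule field_differentiable_bound[OF _ der bd]) (use assms in auto)
  then show ?thesis by simp
qed

text \<open>If |a| \<le> 2|b|, everything is dominated by |b|^p. Otherwise put s = (|a + b| / |a|)^2
  and q = p/2, so that the left side is |a|^p s^q. The square makes s - 1 a polynomial expression in
  a and b, and convexity together with the Lipschitz bound for the derivative replaces a
  second-order Taylor expansion of s^q at 1.\<close>

lemma norm_add_powr_expansion:
  fixes p :: real
  assumes p: "2 \<le> p"
  obtains C :: real where "1 \<le> C"
    "\<And>a b :: complex. norm (a + b) powr p \<le> norm a powr p + p * (norm a powr (p - 2) * Re (cnj a * b))
        + C * (norm a powr (p - 2) * (norm b)\<^sup>2 + norm b powr p)"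
proof -
  define q where "q = p / 2"
  have q: "1 \<le> q" "p = 2 * q" using p by (auto simp: q_def)
  define L where "L = (q - 1) * 4 powr \<bar>q - 1 - 1\<bar>"
  have L: "0 \<le> L" using q by (simp add: L_def)
  \<comment> \<open>The first two summands serve the regime |a| \<le> 2|b|. In the last one,
    \<open>q\<close> comes from the |b|^2 inside s - 1, and \<open>9 * q * L\<close> from the
    quadratic remainder with |s - 1| \<le> 3|b| / |a|.\<close>
  define C where "C = 3 powr p + p * 2 powr (p - 1) + (q + 9 * q * L)"
  have C1: "3 powr p + p * 2 powr (p - 1) \<le> C" "q + 9 * q * L \<le> C"
    using L p q by (auto simp: C_def)
  have "0 \<le> q * L" using L q by simp
  then have C: "1 \<le> C" using C1(2) q(1) by linarith
  have bound: "norm (a + b) powr p \<le> norm a powr p + p * (norm a powr (p - 2) * Re (cnj a * b))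
        + C * (norm a powr (p - 2) * (norm b)\<^sup>2 + norm b powr p)" for a b :: complex
  proof -
    have re: "\<bar>Re (cnj a * b)\<bar> \<le> norm a * norm b"
      using abs_Re_le_cmod[of "cnj a * b"] by (simp add: norm_mult)
    show ?thesis
    proof (cases "norm a \<le> 2 * norm b")
      case True
      have "norm (a + b) powr p \<le> (3 * norm b) powr p"
        by (rule powr_mono2) (use p True norm_triangle_ineq[of a b] in auto)
      then have 1: "norm (a + b) powr p \<le> 3 powr p * norm b powr p" by (simp add: powr_mult)
      have "norm a powr (p - 2) * norm a = norm a powr (p - 1)"
        by (cases "a = 0") (simp_all add: powr_diff power2_eq_square)
      moreover have "norm a powr (p - 1) \<le> (2 * norm b) powr (p - 1)"
        by (rule powr_mono2) (use p True in auto)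
      moreover have "norm b powr (p - 1) * norm b = norm b powr p"
        by (cases "b = 0") (simp_all add: powr_diff)
      ultimately have "norm a powr (p - 2) * norm a * norm b \<le> 2 powr (p - 1) * norm b powr p"
        by (metis powr_mult mult_right_mono norm_ge_zero mult.assoc)
      moreover have "- Re (cnj a * b) \<le> norm a * norm b" using re by linarith
      then have "norm a powr (p - 2) * - Re (cnj a * b) \<le> norm a powr (p - 2) * (norm a * norm b)"
        by (intro mult_left_mono) auto
      ultimately have "norm a powr (p - 2) * - Re (cnj a * b) \<le> 2 powr (p - 1) * norm b powr p"
        by (simp add: mult.assoc)
      then have "p * (norm a powr (p - 2) * - Re (cnj a * b)) \<le> p * (2 powr (p - 1) * norm b powr p)"
        by (rule mult_left_mono) (use p in auto)
      moreover have "(3 powr p + p * 2 powr (p - 1)) * norm b powr p \<le> C * norm b powr p"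
        by (rule mult_right_mono) (use C1 in auto)
      moreover have "0 \<le> C * (norm a powr (p - 2) * (norm b)\<^sup>2)"
        using C by (intro mult_nonneg_nonneg) auto
      moreover have "0 \<le> norm a powr p" by simp
      ultimately show ?thesis using 1 unfolding ring_distribs mult_minus_right mult.assoc by linarith
    next
      case False
      then have a: "norm a > 0" and ba: "norm b \<le> norm a / 2"
        using norm_ge_zero[of b] by linarith+
      define s where "s = (norm (a + b) / norm a)\<^sup>2"
      have "norm (a + b) \<le> 2 * norm a" "norm a / 2 \<le> norm (a + b)"
        using ba norm_triangle_ineq[of a b] norm_diff_ineq[of a b] norm_ge_zero[of a] by linarith+
      then have "norm (a + b) / norm a \<le> 2" "1 / 2 \<le> norm (a + b) / norm a"
        using a by (auto simp: field_simps)
      then have s: "1 / 4 \<le> s" "s \<le> 4"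
        using power_mono[of "1/2" "norm (a + b) / norm a" 2] power_mono[of "norm (a + b) / norm a" 2 2]
        by (auto simp: s_def power2_eq_square)
      have sq: "(norm (a + b))\<^sup>2 = (norm a)\<^sup>2 + 2 * Re (cnj a * b) + (norm b)\<^sup>2"
        unfolding cmod_power2 by (simp add: power2_eq_square algebra_simps)
      have s1: "s - 1 = (2 * Re (cnj a * b) + (norm b)\<^sup>2) / (norm a)\<^sup>2"
        using a sq by (simp add: s_def power_divide field_simps)
      have "\<bar>2 * Re (cnj a * b) + (norm b)\<^sup>2\<bar> \<le> 3 * norm a * norm b"
      proof -
        have "(norm b)\<^sup>2 \<le> norm a * norm b"
          unfolding power2_eq_square by (rule mult_right_mono) (use ba a in linarith, simp)
        then show ?thesis using re zero_le_power2[of "norm b"] unfolding abs_le_iff mult.assoc by linarith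
      qed
      then have "\<bar>s - 1\<bar> \<le> 3 * norm b / norm a"
        using a by (simp add: s1 abs_divide field_simps power2_eq_square)
      then have sb: "(s - 1)\<^sup>2 \<le> 9 * (norm b)\<^sup>2 / (norm a)\<^sup>2"
        using power_mono[of "\<bar>s - 1\<bar>" "3 * norm b / norm a" 2]
        by (simp add: power_divide power_mult_distrib)
      \<comment> \<open>The tangent is taken at s and evaluated at 1; this direction bounds s^q from
        above.\<close>
      have "s powr q + q * s powr (q - 1) * (1 - s) \<le> 1"
        using powr_tangent[of q s 1] q s by simp
      then have "s powr q - 1 - q * (s - 1) \<le> q * ((s powr (q - 1) - 1) * (s - 1))"
        by (simp add: algebra_simps)
      also have "(s powr (q - 1) - 1) * (s - 1) \<le> \<bar>s powr (q - 1) - 1\<bar> * \<bar>s - 1\<bar>"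
        by (metis abs_ge_self abs_mult)
      also have "\<bar>s powr (q - 1) - 1\<bar> * \<bar>s - 1\<bar> \<le> L * \<bar>s - 1\<bar> * \<bar>s - 1\<bar>"
        using powr_lipschitz_near_one[of "q - 1" s] q s by (intro mult_right_mono) (auto simp: L_def)
      also have "\<dots> = L * (s - 1)\<^sup>2" by (simp add: power2_eq_square)
      also have "\<dots> \<le> L * (9 * (norm b)\<^sup>2 / (norm a)\<^sup>2)"
        using sb L by (rule mult_left_mono)
      finally have "s powr q \<le> 1 + q * (s - 1) + q * (L * (9 * (norm b)\<^sup>2 / (norm a)\<^sup>2))"
        using q by simp
      then have "norm a powr p * s powr q \<le>
          norm a powr p * (1 + q * (s - 1) + q * (L * (9 * (norm b)\<^sup>2 / (norm a)\<^sup>2)))"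
        by (rule mult_left_mono) simp
      moreover have "norm a powr p * s powr q = norm (a + b) powr p"
      proof -
        have "s powr q = (norm (a + b) / norm a) powr p"
          unfolding s_def q(2) by (metis powr_powr powr_numeral divide_nonneg_nonneg norm_ge_zero)
        then show ?thesis using a by (simp add: powr_divide)
      qed
      moreover have "norm a powr p = norm a powr (p - 2) * (norm a)\<^sup>2"
        using a by (simp add: powr_diff power2_eq_square)
      then have "norm a powr p * (1 + q * (s - 1) + q * (L * (9 * (norm b)\<^sup>2 / (norm a)\<^sup>2))) =
          norm a powr p + p * (norm a powr (p - 2) * Re (cnj a * b))
          + (q + 9 * q * L) * (norm a powr (p - 2) * (norm b)\<^sup>2)"
        using a by (simp add: s1 q(2) field_simps)
      moreover have "(q + 9 * q * L) * (norm a powr (p - 2) * (norm b)\<^sup>2)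
          \<le> C * (norm a powr (p - 2) * (norm b)\<^sup>2 + norm b powr p)"
        using C C1 by (intro mult_mono) auto
      ultimately show ?thesis by linarith
    qed
  qed
  then show ?thesis using C bound that by blast
qed

text \<open>Young's inequality with an explicit constant. According to whether v^2 \<le> e u^2, one
  of the two terms alone suffices; in the other case u \<le> v / sqrt e, whence the factor
  \<open>(1 / e) powr ((p - 2) / 2)\<close>.\<close>

lemma powr_minus_two_mult_sq_le:
  fixes p :: real
  assumes "2 \<le> p" "0 < e" "0 \<le> u" "0 \<le> v"
  shows "u powr (p - 2) * v\<^sup>2 \<le> e * u powr p + (1 / e) powr ((p - 2) / 2) * v powr p"
proof (cases "v\<^sup>2 \<le> e * u\<^sup>2")
  case True
  have "u powr (p - 2) * v\<^sup>2 \<le> u powr (p - 2) * (e * u\<^sup>2)"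
    using True by (intro mult_left_mono) auto
  also have "\<dots> = e * u powr p"
    using assms by (cases "u = 0") (simp_all add: powr_diff power2_eq_square)
  also have "\<dots> \<le> e * u powr p + (1 / e) powr ((p - 2) / 2) * v powr p" by simp
  finally show ?thesis .
next
  case False
  have sq: "(t\<^sup>2) powr ((p - 2) / 2) = t powr (p - 2)" if "0 \<le> t" for t :: real
  proof -
    have "(t powr 2) powr ((p - 2) / 2) = t powr (2 * ((p - 2) / 2))" by (simp only: powr_powr)
    also have "2 * ((p - 2) / 2) = p - 2" by simp
    finally have "(t powr 2) powr ((p - 2) / 2) = t powr (p - 2)" .
    then show ?thesis using that by simp
  qed
  from False have v: "0 < v" using assms by (cases "v = 0") (auto simp: mult_nonneg_nonneg)
  have "u\<^sup>2 \<le> (1 / e) * v\<^sup>2" using False assms by (simp add: field_simps)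
  then have "(u\<^sup>2) powr ((p - 2) / 2) \<le> ((1 / e) * v\<^sup>2) powr ((p - 2) / 2)"
    using assms by (intro powr_mono2) auto
  also have "\<dots> = (1 / e) powr ((p - 2) / 2) * v powr (p - 2)"
    using assms v by (subst powr_mult) (auto simp: sq)
  also have "(u\<^sup>2) powr ((p - 2) / 2) = u powr (p - 2)"
    using assms by (simp add: sq)
  finally have "u powr (p - 2) * v\<^sup>2 \<le> (1 / e) powr ((p - 2) / 2) * v powr (p - 2) * v\<^sup>2"
    by (rule mult_right_mono) simp
  also have "\<dots> = (1 / e) powr ((p - 2) / 2) * v powr p"
    using v by (simp add: powr_diff power2_eq_square)
  also have "\<dots> \<le> e * u powr p + (1 / e) powr ((p - 2) / 2) * v powr p"
    using assms by simp
  finally show ?thesis .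
qed

lemma add_powr_le:
  fixes p :: real
  assumes "1 \<le> p" "0 \<le> a" "0 \<le> b"
  shows "(a + b) powr p \<le> 2 powr p * (a powr p + b powr p)"
proof -
  have "(a + b) powr p \<le> (2 * max a b) powr p"
    using assms by (intro powr_mono2) auto
  also have "\<dots> = 2 powr p * max (a powr p) (b powr p)"
    using assms by (auto simp: powr_mult max_def powr_mono2 intro: antisym powr_mono2)
  also have "\<dots> \<le> 2 powr p * (a powr p + b powr p)"
    by (intro mult_left_mono) auto
  finally show ?thesis .
qed


subsection \<open>Averaging over coordinates in a product of probability spaces\<close>

context finite_product_prob_space
begin

abbreviation (input) P where "P \<equiv> Pi\<^sub>M I M"

definition mix :: "'a set \<Rightarrow> ('a \<Rightarrow> 'b) \<Rightarrow> ('a \<Rightarrow> 'b) \<Rightarrow> 'a \<Rightarrow> 'b" where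
  "mix S x y = (\<lambda>i\<in>I. if i \<in> S then x i else y i)"

text \<open>The conditional expectation given the coordinates in \<open>S\<close>, as a genuine
  function rather than a class. The integral runs over a second copy of all coordinates, those in
  \<open>S\<close> contributing only total mass 1, so that every average lives on the same space for
  all \<open>S\<close>.\<close>

definition cond_avg :: "'a set \<Rightarrow> (('a \<Rightarrow> 'b) \<Rightarrow> complex) \<Rightarrow> ('a \<Rightarrow> 'b) \<Rightarrow> complex" where
  "cond_avg S f x = (\<integral>y. f (mix S x y) \<partial>P)"

lemma measurable_mix [measurable]:
  assumes [measurable]: "f \<in> N \<rightarrow>\<^sub>M P" "g \<in> N \<rightarrow>\<^sub>M P"
  shows "(\<lambda>z. mix S (f z) (g z)) \<in> N \<rightarrow>\<^sub>M P"
  unfolding mix_def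
proof (rule measurable_restrict)
  fix i assume [measurable]: "i \<in> I"
  show "(\<lambda>z. if i \<in> S then f z i else g z i) \<in> N \<rightarrow>\<^sub>M M i"
    by (cases "i \<in> S") simp_all
qed

lemma mix_space [simp]: "x \<in> space P \<Longrightarrow> y \<in> space P \<Longrightarrow> mix S x y \<in> space P"
  by (auto simp: mix_def space_PiM PiE_iff)

lemma mix_mix: "mix U (mix T x y) z = mix (T \<inter> U) x (mix U y z)"
  by (auto simp: mix_def)

lemma mix_absorb: "S \<subseteq> T \<Longrightarrow> mix S (mix T x y) z = mix S x z"
  by (auto simp: mix_def restrict_def fun_eq_iff)

lemma mix_full: "x \<in> space P \<Longrightarrow> mix I x y = x"
  by (auto simp: mix_def space_PiM PiE_iff extensional_def)

lemma mix_empty: "y \<in> space P \<Longrightarrow> mix {} x y = y"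
  by (auto simp: mix_def space_PiM PiE_iff extensional_def)

lemma pair_prob_space_P: "pair_prob_space P P"
  by (simp add: pair_prob_space_def pair_sigma_finite_def sigma_finite_measure_axioms prob_space_axioms)

text \<open>On a rectangle the constraints split into one rectangle for each copy, and each
  coordinate contributes its own measure times a factor 1. Hence mixing two independent points gives
  a point with the same law, which is how Fubini enters all later identities.\<close>

lemma distr_mix: "distr (P \<Otimes>\<^sub>M P) P (\<lambda>z. mix S (fst z) (snd z)) = P"
proof (rule PiM_eqI)
  fix A assume A: "\<And>i. i \<in> I \<Longrightarrow> A i \<in> sets (M i)"
  let ?A1 = "\<lambda>i. if i \<in> S then A i else space (M i)"
  let ?A2 = "\<lambda>i. if i \<in> S then space (M i) else A i"
  have [measurable]: "Pi\<^sub>E I A \<in> sets P" "Pi\<^sub>E I ?A1 \<in> sets P" "Pi\<^sub>E I ?A2 \<in> sets P"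
    using A by (auto intro!: sets_PiM_I_finite finite_index)
  have As: "\<And>i. i \<in> I \<Longrightarrow> A i \<subseteq> space (M i)"
    using A sets.sets_into_space by blast
  have vim: "(\<lambda>z. mix S (fst z) (snd z)) -` Pi\<^sub>E I A \<inter> space (P \<Otimes>\<^sub>M P) = Pi\<^sub>E I ?A1 \<times> Pi\<^sub>E I ?A2"
  proof (intro set_eqI)
    fix z
    show "z \<in> (\<lambda>z. mix S (fst z) (snd z)) -` Pi\<^sub>E I A \<inter> space (P \<Otimes>\<^sub>M P) \<longleftrightarrow> z \<in> Pi\<^sub>E I ?A1 \<times> Pi\<^sub>E I ?A2"
      using As by (cases z) (force simp: space_pair_measure space_PiM mix_def PiE_iff split: if_splits)
  qed
  have "emeasure (distr (P \<Otimes>\<^sub>M P) P (\<lambda>z. mix S (fst z) (snd z))) (Pi\<^sub>E I A)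
      = emeasure (P \<Otimes>\<^sub>M P) (Pi\<^sub>E I ?A1 \<times> Pi\<^sub>E I ?A2)"
    by (subst emeasure_distr) (simp_all add: vim)
  also have "\<dots> = emeasure P (Pi\<^sub>E I ?A1) * emeasure P (Pi\<^sub>E I ?A2)"
    by (rule emeasure_pair_measure_Times) simp_all
  also have "\<dots> = (\<Prod>i\<in>I. emeasure (M i) (?A1 i)) * (\<Prod>i\<in>I. emeasure (M i) (?A2 i))"
    using A by (subst (1 2) measure_times) auto
  also have "\<dots> = (\<Prod>i\<in>I. emeasure (M i) (?A1 i) * emeasure (M i) (?A2 i))"
    by (simp add: prod.distrib)
  also have "\<dots> = (\<Prod>i\<in>I. emeasure (M i) (A i))"
    by (rule prod.cong) (auto simp: M.emeasure_space_1)
  finally show "emeasure (distr (P \<Otimes>\<^sub>M P) P (\<lambda>z. mix S (fst z) (snd z))) (Pi\<^sub>E I A)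
      = (\<Prod>i\<in>I. emeasure (M i) (A i))" .
qed (simp_all add: finite_index)

lemma nn_integral_mix:
  assumes [measurable]: "g \<in> borel_measurable P"
  shows "(\<integral>\<^sup>+x. \<integral>\<^sup>+y. g (mix S x y) \<partial>P \<partial>P) = (\<integral>\<^sup>+x. g x \<partial>P)"
proof -
  have "(\<integral>\<^sup>+x. g x \<partial>P) = (\<integral>\<^sup>+z. g (mix S (fst z) (snd z)) \<partial>(P \<Otimes>\<^sub>M P))"
    by (subst distr_mix[of S, symmetric], subst nn_integral_distr) simp_all
  also have "\<dots> = (\<integral>\<^sup>+x. \<integral>\<^sup>+y. g (mix S x y) \<partial>P \<partial>P)"
    by (subst nn_integral_fst[symmetric]) simp_all
  finally show ?thesis ..
qed

lemma integrable_mix: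
  fixes f :: "_ \<Rightarrow> complex"
  assumes [measurable]: "integrable P f"
  shows "integrable (P \<Otimes>\<^sub>M P) (\<lambda>z. f (mix S (fst z) (snd z)))"
proof -
  have "integrable (distr (P \<Otimes>\<^sub>M P) P (\<lambda>z. mix S (fst z) (snd z))) f"
    by (simp add: distr_mix assms)
  then show ?thesis by (subst (asm) integrable_distr_eq) simp_all
qed

lemma cond_avg_measurable [measurable]:
  assumes [measurable]: "f \<in> borel_measurable P"
  shows "cond_avg S f \<in> borel_measurable P"
  unfolding cond_avg_def by measurable

lemma
  assumes f: "integrable P f"
  shows integral_cond_avg: "(\<integral>x. cond_avg S f x \<partial>P) = (\<integral>x. f x \<partial>P)"
    and AE_integrable_mix: "AE x in P. integrable P (\<lambda>y. f (mix S x y))"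
proof -
  interpret PP: pair_prob_space P P by (rule pair_prob_space_P)
  note i = integrable_mix[OF f, of S]
  show "AE x in P. integrable P (\<lambda>y. f (mix S x y))" using PP.AE_integrable_fst'[OF i] by simp
  have "(\<integral>x. f x \<partial>P) = (\<integral>z. f (mix S (fst z) (snd z)) \<partial>(P \<Otimes>\<^sub>M P))"
    using f by (subst distr_mix[of S, symmetric], subst integral_distr) simp_all
  also have "\<dots> = (\<integral>x. cond_avg S f x \<partial>P)"
    using PP.integral_fst'[OF i] by (simp add: cond_avg_def)
  finally show "(\<integral>x. cond_avg S f x \<partial>P) = (\<integral>x. f x \<partial>P)" ..
qed

lemma cond_avg_full: "x \<in> space P \<Longrightarrow> cond_avg I f x = f x"
  by (simp add: cond_avg_def mix_full P.prob_space)

lemma cond_avg_empty: "cond_avg {} f x = (\<integral>y. f y \<partial>P)"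
  unfolding cond_avg_def by (rule Bochner_Integration.integral_cong) (simp_all add: mix_empty)

lemma cond_avg_mix: "S \<subseteq> T \<Longrightarrow> cond_avg S f (mix T x y) = cond_avg S f x"
  by (simp add: cond_avg_def mix_absorb)

lemma cond_avg_cnj: "cond_avg S (\<lambda>x. cnj (f x)) x = cnj (cond_avg S f x)"
  by (simp add: cond_avg_def)

lemma cond_avg_mult:
  assumes "\<And>y. y \<in> space P \<Longrightarrow> w (mix S x y) = w x"
  shows "cond_avg S (\<lambda>x. w x * f x) x = w x * cond_avg S f x"
proof -
  have "(\<integral>y. w (mix S x y) * f (mix S x y) \<partial>P) = (\<integral>y. w x * f (mix S x y) \<partial>P)"
    by (rule Bochner_Integration.integral_cong) (simp_all add: assms)
  then show ?thesis by (simp add: cond_avg_def)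
qed

lemma AE_cond_avg_diff:
  assumes "integrable P f" "integrable P g"
  shows "AE x in P. cond_avg S (\<lambda>x. f x - g x) x = cond_avg S f x - cond_avg S g x"
  using AE_integrable_mix[OF assms(1), of S] AE_integrable_mix[OF assms(2), of S]
  by eventually_elim (simp add: cond_avg_def)

text \<open>For bounded functions all integrals exist, so that the identities between
  averages hold everywhere and not only almost everywhere.\<close>

definition bdd_meas :: "(('a \<Rightarrow> 'b) \<Rightarrow> 'c :: real_normed_vector) \<Rightarrow> bool" where
  "bdd_meas f \<longleftrightarrow> f \<in> borel_measurable P \<and> (\<exists>B. \<forall>x\<in>space P. norm (f x) \<le> B)"

lemma bdd_measI: "f \<in> borel_measurable P \<Longrightarrow> (\<And>x. x \<in> space P \<Longrightarrow> norm (f x) \<le> B) \<Longrightarrow> bdd_meas f"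
  by (auto simp: bdd_meas_def)

lemma bdd_meas_measurable [measurable_dest]: "bdd_meas f \<Longrightarrow> f \<in> borel_measurable P"
  by (simp add: bdd_meas_def)

lemma bdd_meas_integrable:
  fixes f :: "_ \<Rightarrow> 'c :: {banach, second_countable_topology}"
  shows "bdd_meas f \<Longrightarrow> integrable P f"
  by (auto simp: bdd_meas_def intro: integrable_const_bound)

lemma bdd_meas_add:
  fixes f g :: "_ \<Rightarrow> 'c :: {real_normed_vector, second_countable_topology}"
  assumes "bdd_meas f" "bdd_meas g"
  shows "bdd_meas (\<lambda>x. f x + g x)"
proof -
  from assms obtain A B where "\<forall>x\<in>space P. norm (f x) \<le> A" "\<forall>x\<in>space P. norm (g x) \<le> B"
    by (auto simp: bdd_meas_def)
  with assms show ?thesis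
    by (intro bdd_measI[where B = "A + B"]) (auto intro!: norm_triangle_mono borel_measurable_add bdd_meas_measurable)
qed

lemma bdd_meas_mult:
  fixes f g :: "_ \<Rightarrow> 'c :: {real_normed_algebra, second_countable_topology}"
  assumes "bdd_meas f" "bdd_meas g"
  shows "bdd_meas (\<lambda>x. f x * g x)"
proof -
  from assms obtain A B where AB: "\<forall>x\<in>space P. norm (f x) \<le> A" "\<forall>x\<in>space P. norm (g x) \<le> B"
    by (auto simp: bdd_meas_def)
  have "norm (f x * g x) \<le> A * B" if x: "x \<in> space P" for x
  proof -
    have "norm (f x * g x) \<le> norm (f x) * norm (g x)" by (rule norm_mult_ineq)
    also have "\<dots> \<le> A * B"
      using AB x by (intro mult_mono) (auto intro: order_trans[OF norm_ge_zero])
    finally show ?thesis .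
  qed
  with assms show ?thesis
    by (intro bdd_measI[where B = "A * B"]) (auto intro!: borel_measurable_times bdd_meas_measurable)
qed

lemma bdd_meas_comp:
  fixes f :: "_ \<Rightarrow> 'c :: real_normed_vector" and h :: "'c \<Rightarrow> 'd :: real_normed_vector"
  assumes f: "bdd_meas f" and h: "h \<in> borel_measurable borel"
    and mono: "\<And>B. \<exists>B'. \<forall>z. norm z \<le> B \<longrightarrow> norm (h z) \<le> B'"
  shows "bdd_meas (\<lambda>x. h (f x))"
proof -
  from f obtain B where B: "\<forall>x\<in>space P. norm (f x) \<le> B" by (auto simp: bdd_meas_def)
  from mono obtain B' where "\<forall>z. norm z \<le> B \<longrightarrow> norm (h z) \<le> B'" by blast
  with B show ?thesis
    using measurable_compose[OF bdd_meas_measurable[OF f] h] by (intro bdd_measI) auto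
qed

lemma bdd_meas_minus: 
  fixes f :: "_ \<Rightarrow> 'c :: real_normed_vector"
  shows "bdd_meas f \<Longrightarrow> bdd_meas (\<lambda>x. - f x)"
  by (erule bdd_meas_comp) (auto intro!: borel_measurable_continuous_onI continuous_intros)

lemma bdd_meas_diff:
  fixes f g :: "_ \<Rightarrow> 'c :: {real_normed_vector, second_countable_topology}"
  shows "bdd_meas f \<Longrightarrow> bdd_meas g \<Longrightarrow> bdd_meas (\<lambda>x. f x - g x)"
  using bdd_meas_add[of f "\<lambda>x. - g x"] bdd_meas_minus[of g] by simp

lemma bdd_meas_cnj: "bdd_meas f \<Longrightarrow> bdd_meas (\<lambda>x. cnj (f x))"
  by (erule bdd_meas_comp) (auto intro!: borel_measurable_continuous_onI continuous_intros)

lemma bdd_meas_Re: "bdd_meas f \<Longrightarrow> bdd_meas (\<lambda>x. Re (f x))"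
  by (erule bdd_meas_comp) (auto intro: order_trans[OF abs_Re_le_cmod])

lemma bdd_meas_of_real: "bdd_meas f \<Longrightarrow> bdd_meas (\<lambda>x. complex_of_real (f x))"
  by (erule bdd_meas_comp) auto

lemma bdd_meas_norm_powr:
  fixes f :: "_ \<Rightarrow> 'c :: real_normed_vector"
  shows "bdd_meas f \<Longrightarrow> 0 \<le> r \<Longrightarrow> bdd_meas (\<lambda>x. norm (f x) powr r)"
  by (erule bdd_meas_comp) (auto intro!: exI[of _ "_ powr r"] powr_mono2)

lemma bdd_meas_norm_square:
  fixes f :: "_ \<Rightarrow> 'c :: real_normed_vector"
  shows "bdd_meas f \<Longrightarrow> bdd_meas (\<lambda>x. (norm (f x))\<^sup>2)"
  by (erule bdd_meas_comp) (auto intro!: exI[of _ "_\<^sup>2"] power_mono)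

lemma bdd_meas_inner:
  fixes f g :: "_ \<Rightarrow> complex"
  assumes "bdd_meas f" "bdd_meas g"
  shows "bdd_meas (\<lambda>x. f x \<bullet> g x)"
proof -
  have "bdd_meas (\<lambda>x. Re (f x * cnj (g x)))"
    by (intro bdd_meas_Re bdd_meas_mult bdd_meas_cnj assms)
  then show ?thesis by (simp add: inner_complex_def)
qed

lemma bdd_meas_sum:
  fixes f :: "_ \<Rightarrow> _ \<Rightarrow> 'c :: {real_normed_vector, second_countable_topology}"
  shows "(\<And>j. j \<in> J \<Longrightarrow> bdd_meas (f j)) \<Longrightarrow> bdd_meas (\<lambda>x. \<Sum>j\<in>J. f j x)"
proof (induction J rule: infinite_finite_induct)
  case (insert j J)
  then show ?case by (simp add: bdd_meas_add)
qed (auto intro!: bdd_measI[where B = 0])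

lemma bdd_meas_cond_avg:
  assumes f: "bdd_meas f"
  shows "bdd_meas (cond_avg S f)"
proof -
  note [measurable] = bdd_meas_measurable[OF f]
  from f obtain B where B: "\<forall>x\<in>space P. norm (f x) \<le> B" by (auto simp: bdd_meas_def)
  have "norm (cond_avg S f x) \<le> B" if x: "x \<in> space P" for x
  proof -
    have [measurable]: "(\<lambda>y. f (mix S x y)) \<in> borel_measurable P" using x by measurable
    have i: "integrable P (\<lambda>y. f (mix S x y))"
      by (rule bdd_meas_integrable, rule bdd_measI[where B = B]) (use B x in auto)
    have "norm (cond_avg S f x) \<le> (\<integral>y. norm (f (mix S x y)) \<partial>P)"
      unfolding cond_avg_def by (rule integral_norm_bound)
    also have "\<dots> \<le> (\<integral>y. B \<partial>P)"
      using i B x by (intro integral_mono) auto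
    finally show ?thesis by (simp add: P.prob_space)
  qed
  then show ?thesis by (intro bdd_measI) auto
qed

text \<open>By \<open>mix_mix\<close> the nested integrand keeps from \<open>x\<close> only the
  coordinates in \<open>T \<inter> U\<close>. The double integral is then the integral of
  \<open>cond_avg U ?g\<close> for the slice \<open>?g\<close> at fixed \<open>x\<close>, and
  averaging preserves integrals. Boundedness makes every slice integrable, so the identity holds at
  every point.\<close>

lemma cond_avg_cond_avg:
  assumes f: "bdd_meas f" and x: "x \<in> space P"
  shows "cond_avg T (cond_avg U f) x = cond_avg (T \<inter> U) f x"
proof -
  note [measurable] = bdd_meas_measurable[OF f]
  let ?g = "\<lambda>w. f (mix (T \<inter> U) x w)"
  from f obtain B where "\<forall>x\<in>space P. norm (f x) \<le> B" by (auto simp: bdd_meas_def)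
  then have "integrable P ?g"
    by (intro bdd_meas_integrable bdd_measI[where B = B]) (use x in auto)
  from integral_cond_avg[OF this, of U] show ?thesis
    by (simp add: cond_avg_def mix_mix)
qed

section \<open>Weighted orthogonality of the averages\<close>

lemma integral_mult_cond_avg:
  assumes "integrable P (\<lambda>x. g x * f x)"
    and inv: "\<And>x y. x \<in> space P \<Longrightarrow> y \<in> space P \<Longrightarrow> g (mix S x y) = g x"
  shows "(\<integral>x. g x * f x \<partial>P) = (\<integral>x. g x * cond_avg S f x \<partial>P)"
proof -
  have "(\<integral>x. g x * f x \<partial>P) = (\<integral>x. cond_avg S (\<lambda>x. g x * f x) x \<partial>P)"
    by (rule integral_cond_avg[symmetric]) fact
  also have "\<dots> = (\<integral>x. g x * cond_avg S f x \<partial>P)"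
    by (rule Bochner_Integration.integral_cong) (simp_all add: cond_avg_mult inv)
  finally show ?thesis .
qed

text \<open>The weight depends only on coordinates in \<open>S\<close>, which lie in both
  \<open>T\<close> and \<open>U\<close>, so it commutes with both averages. Averaging the second
  factor over the complement of \<open>T\<close> turns it into the average for
  \<open>T \<inter> U\<close>; a second use of the same self-adjointness turns the first factor into
  that average too.\<close>

lemma integral_weight_inner_cond_avg:
  fixes w :: "('a \<Rightarrow> 'b) \<Rightarrow> real"
  assumes f: "bdd_meas f" and w: "bdd_meas w"
    and inv: "\<And>T x y. S \<subseteq> T \<Longrightarrow> x \<in> space P \<Longrightarrow> y \<in> space P \<Longrightarrow> w (mix T x y) = w x"
    and "S \<subseteq> T" "S \<subseteq> U"
  shows "(\<integral>x. w x * (cond_avg T f x \<bullet> cond_avg U f x) \<partial>P)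
    = (\<integral>x. w x * (norm (cond_avg (T \<inter> U) f x))\<^sup>2 \<partial>P)"
proof -
  define V where "V = T \<inter> U"
  have V: "S \<subseteq> V" using assms by (auto simp: V_def)
  note bdd = f w bdd_meas_cond_avg bdd_meas_mult bdd_meas_of_real bdd_meas_cnj
  \<comment> \<open>Averages are complex linear, so the pairing is computed as a complex integral,
    and its real part gives the inner product at the end.\<close>
  have 1: "(\<integral>x. (complex_of_real (w x) * cond_avg T f x) * cnj (cond_avg U f x) \<partial>P)
      = (\<integral>x. (complex_of_real (w x) * cond_avg T f x) * cond_avg T (\<lambda>x. cnj (cond_avg U f x)) x \<partial>P)"
    using assms by (intro integral_mult_cond_avg bdd_meas_integrable bdd) (simp add: cond_avg_mix)
  also have "\<dots> = (\<integral>x. (complex_of_real (w x) * cnj (cond_avg V f x)) * cond_avg T f x \<partial>P)"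
    by (rule Bochner_Integration.integral_cong) (simp_all add: cond_avg_cnj cond_avg_cond_avg f V_def)
  also have "\<dots> = (\<integral>x. (complex_of_real (w x) * cnj (cond_avg V f x)) * cond_avg V (cond_avg T f) x \<partial>P)"
    using V by (intro integral_mult_cond_avg bdd_meas_integrable bdd) (simp add: cond_avg_mix inv)
  also have "\<dots> = (\<integral>x. complex_of_real (w x * (norm (cond_avg V f x))\<^sup>2) \<partial>P)"
    by (rule Bochner_Integration.integral_cong)
      (simp_all add: cond_avg_cond_avg f V_def complex_norm_square mult_ac Int_absorb1 Int_ac del: of_real_power)
  finally have "Re (\<integral>x. (complex_of_real (w x) * cond_avg T f x) * cnj (cond_avg U f x) \<partial>P)
      = (\<integral>x. w x * (norm (cond_avg V f x))\<^sup>2 \<partial>P)"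
    by (simp only: integral_complex_of_real Re_complex_of_real)
  moreover have "integrable P (\<lambda>x. (complex_of_real (w x) * cond_avg T f x) * cnj (cond_avg U f x))"
    by (intro bdd_meas_integrable bdd)
  then have "Re (\<integral>x. (complex_of_real (w x) * cond_avg T f x) * cnj (cond_avg U f x) \<partial>P)
      = (\<integral>x. Re ((complex_of_real (w x) * cond_avg T f x) * cnj (cond_avg U f x)) \<partial>P)"
    by (rule integral_Re[symmetric])
  moreover have "Re ((complex_of_real (w x) * cond_avg T f x) * cnj (cond_avg U f x))
      = w x * (cond_avg T f x \<bullet> cond_avg U f x)" for x
    by (simp add: inner_complex_def algebra_simps)
  ultimately show ?thesis by (simp add: V_def)
qed

text \<open>All pairings reduce to the numbers \<open>q T\<close>. Increments for distinct i, j are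
  orthogonal because \<open>insert i S \<inter> insert j S = S\<close>, and the pairing of
  \<open>f\<close> with an increment equals the weighted square norm of that increment. Subtracting
  the increments one at a time is therefore an exact Pythagoras, and the remainder is
  nonnegative.\<close>

lemma weighted_bessel:
  fixes w :: "('a \<Rightarrow> 'b) \<Rightarrow> real"
  assumes f: "bdd_meas f" and w: "bdd_meas w" "\<And>x. 0 \<le> w x"
    and inv: "\<And>T x y. S \<subseteq> T \<Longrightarrow> x \<in> space P \<Longrightarrow> y \<in> space P \<Longrightarrow> w (mix T x y) = w x"
    and S: "S \<subseteq> I"
  shows "(\<Sum>j\<in>I - S. \<integral>x. w x * (norm (cond_avg (insert j S) f x - cond_avg S f x))\<^sup>2 \<partial>P)
    \<le> (\<integral>x. w x * (norm (f x))\<^sup>2 \<partial>P)"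
proof -
  define u where "u j x = cond_avg (insert j S) f x - cond_avg S f x" for j x
  define q where "q T = (\<integral>x. w x * (norm (cond_avg T f x))\<^sup>2 \<partial>P)" for T
  note bdd = f w(1) bdd_meas_cond_avg bdd_meas_mult bdd_meas_inner bdd_meas_norm_square bdd_meas_diff bdd_meas_sum
  have u: "bdd_meas (u j)" for j unfolding u_def by (intro bdd)
  note int = bdd_meas_integrable
  have B: "(\<integral>x. w x * (cond_avg T f x \<bullet> cond_avg U f x) \<partial>P) = q (T \<inter> U)" if "S \<subseteq> T" "S \<subseteq> U" for T U
    unfolding q_def using f w(1) inv that by (rule integral_weight_inner_cond_avg)
  have Bu: "(\<integral>x. w x * (cond_avg T f x \<bullet> u j x) \<partial>P) = q (T \<inter> insert j S) - q S"
    if "S \<subseteq> T" for T j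
  proof -
    have "(\<integral>x. w x * (cond_avg T f x \<bullet> u j x) \<partial>P)
      = (\<integral>x. w x * (cond_avg T f x \<bullet> cond_avg (insert j S) f x) - w x * (cond_avg T f x \<bullet> cond_avg S f x) \<partial>P)"
      by (simp add: u_def inner_diff_right right_diff_distrib)
    also have "\<dots> = q (T \<inter> insert j S) - q (T \<inter> S)"
      using that by (subst Bochner_Integration.integral_diff) (auto intro!: int bdd simp: B[OF _ subset_insertI] B)
    finally show ?thesis using that by (simp add: Int_absorb1)
  qed
  have uu: "(\<integral>x. w x * (u i x \<bullet> u j x) \<partial>P) = (if i = j then q (insert j S) - q S else 0)"
    if "i \<notin> S" "j \<notin> S" for i j
  proof -
    have "(\<integral>x. w x * (u i x \<bullet> u j x) \<partial>P)
      = (\<integral>x. w x * (cond_avg (insert i S) f x \<bullet> u j x) - w x * (cond_avg S f x \<bullet> u j x) \<partial>P)"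
      by (subst (1) u_def) (simp add: inner_diff_left right_diff_distrib)
    also have "\<dots> = (q (insert i S \<inter> insert j S) - q S) - (q (S \<inter> insert j S) - q S)"
      by (subst Bochner_Integration.integral_diff) (auto intro!: int bdd u simp: Bu[OF subset_insertI] Bu)
    finally show ?thesis using that by (auto simp: Int_absorb2 subset_insertI)
  qed
  \<comment> \<open>Writing \<open>f\<close> as \<open>cond_avg I f\<close> makes this an instance
    of \<open>Bu\<close>.\<close>
  have fu: "(\<integral>x. w x * (f x \<bullet> u j x) \<partial>P) = q (insert j S) - q S" if "j \<in> I" for j
  proof -
    have "(\<integral>x. w x * (f x \<bullet> u j x) \<partial>P) = (\<integral>x. w x * (cond_avg I f x \<bullet> u j x) \<partial>P)"
      by (rule Bochner_Integration.integral_cong) (simp_all add: cond_avg_full)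
    with that S show ?thesis by (simp add: Bu Int_absorb1)
  qed
  have "(\<integral>x. w x * (norm (f x - (\<Sum>j\<in>J. u j x)))\<^sup>2 \<partial>P)
      = (\<integral>x. w x * (norm (f x))\<^sup>2 \<partial>P) - (\<Sum>j\<in>J. \<integral>x. w x * (norm (u j x))\<^sup>2 \<partial>P)"
    if "finite J" "J \<subseteq> I - S" for J
    using that
  proof (induction J rule: finite_induct)
    case (insert k J)
    let ?g = "\<lambda>x. f x - (\<Sum>j\<in>J. u j x)"
    have g: "bdd_meas ?g" by (intro bdd u)
    have k: "k \<in> I" "k \<notin> S" using insert.prems by auto
    have "(\<integral>x. w x * (?g x \<bullet> u k x) \<partial>P)
        = (\<integral>x. w x * (f x \<bullet> u k x) - (\<Sum>j\<in>J. w x * (u j x \<bullet> u k x)) \<partial>P)"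
      by (simp add: inner_diff_left right_diff_distrib inner_sum_left sum_distrib_left)
    also have "\<dots> = (\<integral>x. w x * (f x \<bullet> u k x) \<partial>P) - (\<Sum>j\<in>J. \<integral>x. w x * (u j x \<bullet> u k x) \<partial>P)"
      by (subst Bochner_Integration.integral_diff, (intro int bdd u)+)
        (subst Bochner_Integration.integral_sum, (intro int bdd u)+, rule refl)
    also have "(\<Sum>j\<in>J. \<integral>x. w x * (u j x \<bullet> u k x) \<partial>P) = 0"
      using insert k by (intro sum.neutral) (auto simp: uu)
    finally have gk: "(\<integral>x. w x * (?g x \<bullet> u k x) \<partial>P) = (\<integral>x. w x * (norm (u k x))\<^sup>2 \<partial>P)"
      using k uu[of k k] fu[of k] by (simp add: power2_norm_eq_inner)
    have "(\<integral>x. w x * (norm (f x - (\<Sum>j\<in>insert k J. u j x)))\<^sup>2 \<partial>P)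
        = (\<integral>x. (w x * (norm (?g x))\<^sup>2 - 2 * (w x * (?g x \<bullet> u k x))) + w x * (norm (u k x))\<^sup>2 \<partial>P)"
    proof (rule Bochner_Integration.integral_cong[OF refl])
      fix x
      have "f x - (\<Sum>j\<in>insert k J. u j x) = ?g x - u k x" using insert by simp
      then have "(norm (f x - (\<Sum>j\<in>insert k J. u j x)))\<^sup>2
          = (norm (?g x))\<^sup>2 - 2 * (?g x \<bullet> u k x) + (norm (u k x))\<^sup>2"
        by (simp only: power2_norm_eq_inner inner_diff_left inner_diff_right inner_commute) simp
      then show "w x * (norm (f x - (\<Sum>j\<in>insert k J. u j x)))\<^sup>2
          = (w x * (norm (?g x))\<^sup>2 - 2 * (w x * (?g x \<bullet> u k x))) + w x * (norm (u k x))\<^sup>2"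
        by (simp only: distrib_left right_diff_distrib mult.left_commute)
    qed
    also have "\<dots> = ((\<integral>x. w x * (norm (?g x))\<^sup>2 \<partial>P) - 2 * (\<integral>x. w x * (?g x \<bullet> u k x) \<partial>P))
        + (\<integral>x. w x * (norm (u k x))\<^sup>2 \<partial>P)"
      by (subst Bochner_Integration.integral_add Bochner_Integration.integral_diff,
          (intro int bdd u g Bochner_Integration.integrable_diff integrable_mult_right)+)+ simp
    finally show ?case using insert gk by simp
  qed simp
  from this[of "I - S"] finite_index
  have "(\<integral>x. w x * (norm (f x))\<^sup>2 \<partial>P) - (\<Sum>j\<in>I - S. \<integral>x. w x * (norm (u j x))\<^sup>2 \<partial>P)
      = (\<integral>x. w x * (norm (f x - (\<Sum>j\<in>I - S. u j x)))\<^sup>2 \<partial>P)" by simp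
  also have "\<dots> \<ge> 0" using w by (intro integral_nonneg_AE) auto
  finally show ?thesis by (simp add: u_def)
qed

end


subsection \<open>Moments and averages over the subsets of given size\<close>

text \<open>Jensen's inequality: integrate the tangent at the mean \<open>c\<close> of the norm,
  whose linear part has integral 0. The right side is an \<open>ennreal\<close> because the lemma is
  applied to every slice of a function, and a slice with infinite moment must be covered
  too.\<close>

lemma norm_integral_powr_le:
  fixes g :: "_ \<Rightarrow> 'c :: {banach, second_countable_topology}"
  assumes "prob_space N" "1 \<le> p" and [measurable]: "g \<in> borel_measurable N"
  shows "ennreal (norm (\<integral>x. g x \<partial>N) powr p) \<le> (\<integral>\<^sup>+x. ennreal (norm (g x) powr p) \<partial>N)"
proof (cases "integrable N (\<lambda>x. norm (g x) powr p)")
  case True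
  interpret prob_space N by fact
  have "integrable N (\<lambda>x. norm (g x))"
  proof (rule Bochner_Integration.integrable_bound)
    show "integrable N (\<lambda>x. 1 + norm (g x) powr p)" using True by simp
    have "norm (g x) \<le> 1 + norm (g x) powr p" for x
      using powr_mono[of 1 p "norm (g x)"] assms by (cases "norm (g x) \<le> 1") (auto intro: add_increasing2)
    then show "AE x in N. norm (norm (g x)) \<le> norm (1 + norm (g x) powr p)" by simp
  qed simp
  then have g: "integrable N (\<lambda>x. norm (g x))" .
  define c where "c = (\<integral>x. norm (g x) \<partial>N)"
  have c: "0 \<le> c" by (simp add: c_def)
  have "norm (\<integral>x. g x \<partial>N) powr p \<le> c powr p"
    unfolding c_def using assms by (intro powr_mono2 integral_norm_bound) auto
  also have "\<dots> = (\<integral>x. c powr p + p * c powr (p - 1) * (norm (g x) - c) \<partial>N)"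
    using g by (simp add: prob_space c_def)
  also have "\<dots> \<le> (\<integral>x. norm (g x) powr p \<partial>N)"
    using g True c assms by (intro integral_mono powr_tangent) auto
  finally show ?thesis
    using True by (subst nn_integral_eq_integral) auto
next
  case False
  have "integrable N (\<lambda>x. norm (g x) powr p)" if "(\<integral>\<^sup>+x. ennreal (norm (g x) powr p) \<partial>N) < \<infinity>"
    by (rule integrableI_bounded) (use that in simp_all)
  with False have "\<infinity> \<le> (\<integral>\<^sup>+x. ennreal (norm (g x) powr p) \<partial>N)"
    by (metis not_less)
  then show ?thesis by (rule order_trans[rotated]) simp
qed

section \<open>Double counting and the absorption argument\<close>

text \<open>The pairs of a set \<open>S\<close> and a new point \<open>j\<close> correspond to the
  pairs of a larger set \<open>T\<close> and a member \<open>j\<close>; each \<open>T\<close> arises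
  from \<open>Suc m\<close> of them.\<close>

lemma sum_subsets_insert:
  fixes h :: "'a set \<Rightarrow> real"
  assumes "finite I"
  shows "(\<Sum>S | S \<subseteq> I \<and> card S = m. \<Sum>j\<in>I - S. h (insert j S))
    = real (Suc m) * (\<Sum>T | T \<subseteq> I \<and> card T = Suc m. h T)"
proof -
  have fin: "finite {S. S \<subseteq> I \<and> card S = l}" for l using assms by auto
  have finI: "finite (I - S)" for S using assms by auto
  have finT: "finite T" if "T \<subseteq> I" for T using assms that finite_subset by blast
  have "(\<Sum>S | S \<subseteq> I \<and> card S = m. \<Sum>j\<in>I - S. h (insert j S))
    = (\<Sum>(S, j)\<in>Sigma {S. S \<subseteq> I \<and> card S = m} (\<lambda>S. I - S). h (insert j S))"
    using fin finI by (subst sum.Sigma) auto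
  also have "\<dots> = (\<Sum>(T, j)\<in>Sigma {T. T \<subseteq> I \<and> card T = Suc m} (\<lambda>T. T). h T)"
    by (rule sum.reindex_bij_witness[where i = "\<lambda>(T, j). (T - {j}, j)" and j = "\<lambda>(S, j). (insert j S, j)"])
      (auto simp: insert_absorb finT card_Diff_singleton_if card_insert_if)
  also have "\<dots> = (\<Sum>T | T \<subseteq> I \<and> card T = Suc m. \<Sum>j\<in>T. h T)"
    using fin finT by (subst sum.Sigma) auto
  also have "\<dots> = real (Suc m) * (\<Sum>T | T \<subseteq> I \<and> card T = Suc m. h T)"
    by (simp add: sum_distrib_left)
  finally show ?thesis .
qed

text \<open>After exchanging the sums, \<open>j\<close> is counted once for each
  \<open>m\<close>-subset of \<open>I - {j}\<close>.\<close>

lemma sum_subsets_complement: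
  fixes h :: "'a \<Rightarrow> real"
  assumes "finite I"
  shows "(\<Sum>S | S \<subseteq> I \<and> card S = m. \<Sum>j\<in>I - S. h j) = real ((card I - 1) choose m) * (\<Sum>j\<in>I. h j)"
proof -
  have fin: "finite {S. S \<subseteq> I \<and> card S = l}" for l using assms by auto
  have "(\<Sum>S | S \<subseteq> I \<and> card S = m. \<Sum>j\<in>I - S. h j)
      = (\<Sum>S | S \<subseteq> I \<and> card S = m. \<Sum>j | j \<in> I \<and> j \<notin> S. h j)"
    by (intro sum.cong) auto
  also have "\<dots> = (\<Sum>j\<in>I. \<Sum>S | S \<in> {S. S \<subseteq> I \<and> card S = m} \<and> j \<notin> S. h j)"
    by (rule sum.swap_restrict[OF fin assms])
  also have "\<dots> = (\<Sum>j\<in>I. real ((card I - 1) choose m) * h j)"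
  proof (rule sum.cong[OF refl])
    fix j assume j: "j \<in> I"
    have "{S. S \<in> {S. S \<subseteq> I \<and> card S = m} \<and> j \<notin> S} = {S. S \<subseteq> I - {j} \<and> card S = m}" by auto
    with j show "(\<Sum>S | S \<in> {S. S \<subseteq> I \<and> card S = m} \<and> j \<notin> S. h j) = real ((card I - 1) choose m) * h j"
      using n_subsets[of "I - {j}" m] assms by simp
  qed
  finally show ?thesis by (simp add: sum_distrib_left)
qed

text \<open>Let \<open>A\<close> be the maximum of \<open>a\<close> on {0..k}. Every step adds at
  most (A/2 + R)/k, so at most k steps give A \<le> |a 0| + |A/2 + R|, and the factor 1/2 lets
  \<open>A\<close> be absorbed. Iterating the recursion is avoided altogether.\<close>

lemma linear_growth_max_bound:
  fixes a :: "nat \<Rightarrow> real"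
  assumes k: "0 < k" and step: "\<And>m. m < k \<Longrightarrow> a (Suc m) \<le> a m + (a m / 2 + R) / real k"
  shows "a k \<le> 2 * \<bar>a 0\<bar> + 2 * \<bar>R\<bar>"
proof -
  define A where "A = Max (a ` {..k})"
  have A: "a m \<le> A" if "m \<le> k" for m using that by (simp add: A_def)
  obtain m0 where m0: "m0 \<le> k" "A = a m0"
  proof -
    have "A \<in> a ` {..k}" unfolding A_def by (rule Max_in) auto
    then show ?thesis using that by blast
  qed
  have "a m \<le> a 0 + real m / real k * (A / 2 + R)" if "m \<le> k" for m
    using that
  proof (induction m)
    case (Suc m)
    have "a (Suc m) \<le> a m + (a m / 2 + R) / real k" using Suc step by simp
    also have "(a m / 2 + R) / real k \<le> (A / 2 + R) / real k"
      using A[of m] Suc k by (intro divide_right_mono) auto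
    finally have "a (Suc m) \<le> a 0 + real m / real k * (A / 2 + R) + (A / 2 + R) / real k"
      using Suc by simp
    also have "\<dots> = a 0 + real (Suc m) / real k * (A / 2 + R)"
      using k by (simp add: field_simps)
    finally show ?case .
  qed simp
  from this[of m0] m0 have "A \<le> a 0 + real m0 / real k * (A / 2 + R)" by simp
  also have "\<dots> \<le> \<bar>a 0\<bar> + real m0 / real k * \<bar>A / 2 + R\<bar>"
    by (intro add_mono mult_left_mono) auto
  also have "\<dots> \<le> \<bar>a 0\<bar> + 1 * \<bar>A / 2 + R\<bar>"
    using m0 k by (intro add_mono mult_right_mono) auto
  finally have "A \<le> \<bar>a 0\<bar> + \<bar>A / 2 + R\<bar>" by simp
  with A[of k] show ?thesis by linarith
qed

context finite_product_prob_space
begin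

section \<open>Moments, and contractivity of averages\<close>

definition in_Lp :: "real \<Rightarrow> (('a \<Rightarrow> 'b) \<Rightarrow> complex) \<Rightarrow> bool" where
  "in_Lp p f \<longleftrightarrow> f \<in> borel_measurable P \<and> integrable P (\<lambda>x. norm (f x) powr p)"

definition pmoment :: "real \<Rightarrow> (('a \<Rightarrow> 'b) \<Rightarrow> complex) \<Rightarrow> real" where
  "pmoment p f = (\<integral>x. norm (f x) powr p \<partial>P)"

lemma in_LpD: "in_Lp p f \<Longrightarrow> f \<in> borel_measurable P" "in_Lp p f \<Longrightarrow> integrable P (\<lambda>x. norm (f x) powr p)"
  by (auto simp: in_Lp_def)

lemma pmoment_nonneg [simp]: "0 \<le> pmoment p f"
  by (simp add: pmoment_def)

lemma nn_integral_norm_powr: "in_Lp p f \<Longrightarrow> (\<integral>\<^sup>+x. ennreal (norm (f x) powr p) \<partial>P) = ennreal (pmoment p f)"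
  unfolding in_Lp_def pmoment_def by (simp add: nn_integral_eq_integral)

lemma in_Lp_bounded_nn_integral:
  assumes [measurable]: "f \<in> borel_measurable P" and "(\<integral>\<^sup>+x. ennreal (norm (f x) powr p) \<partial>P) \<le> ennreal c" "0 \<le> c"
  shows "in_Lp p f" "pmoment p f \<le> c"
proof -
  show f: "in_Lp p f"
    unfolding in_Lp_def
  proof (intro conjI integrableI_bounded)
    show "(\<integral>\<^sup>+x. ennreal (norm (norm (f x) powr p)) \<partial>P) < \<infinity>"
      using order.strict_trans1[OF assms(2) ennreal_less_top] by simp
  qed measurable
  show "pmoment p f \<le> c" using assms nn_integral_norm_powr[OF f] by simp
qed

lemma in_Lp_bdd_meas: "bdd_meas f \<Longrightarrow> 0 \<le> p \<Longrightarrow> in_Lp p f"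
  unfolding in_Lp_def by (intro conjI bdd_meas_measurable bdd_meas_integrable[OF bdd_meas_norm_powr])

lemma nn_integral_cond_avg_le:
  assumes [measurable]: "f \<in> borel_measurable P" and p: "1 \<le> p"
  shows "(\<integral>\<^sup>+x. ennreal (norm (cond_avg S f x) powr p) \<partial>P) \<le> (\<integral>\<^sup>+x. ennreal (norm (f x) powr p) \<partial>P)"
proof -
  have "(\<integral>\<^sup>+x. ennreal (norm (cond_avg S f x) powr p) \<partial>P)
      \<le> (\<integral>\<^sup>+x. \<integral>\<^sup>+y. ennreal (norm (f (mix S x y)) powr p) \<partial>P \<partial>P)"
  proof (rule nn_integral_mono)
    fix x assume [measurable]: "x \<in> space P"
    show "ennreal (norm (cond_avg S f x) powr p) \<le> (\<integral>\<^sup>+y. ennreal (norm (f (mix S x y)) powr p) \<partial>P)"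
      unfolding cond_avg_def by (rule norm_integral_powr_le[OF prob_space_axioms p]) measurable
  qed
  also have "\<dots> = (\<integral>\<^sup>+x. ennreal (norm (f x) powr p) \<partial>P)"
    by (rule nn_integral_mix[where g = "\<lambda>x. ennreal (norm (f x) powr p)"]) measurable
  finally show ?thesis .
qed

lemma
  assumes f: "in_Lp p f" and p: "1 \<le> p"
  shows in_Lp_cond_avg: "in_Lp p (cond_avg S f)" and pmoment_cond_avg_le: "pmoment p (cond_avg S f) \<le> pmoment p f"
proof -
  have "(\<integral>\<^sup>+x. ennreal (norm (cond_avg S f x) powr p) \<partial>P) \<le> ennreal (pmoment p f)"
    using nn_integral_cond_avg_le[OF in_LpD(1)[OF f] p] by (simp only: nn_integral_norm_powr[OF f])
  from in_Lp_bounded_nn_integral[OF cond_avg_measurable[OF in_LpD(1)[OF f]] this]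
  show "in_Lp p (cond_avg S f)" "pmoment p (cond_avg S f) \<le> pmoment p f" by simp_all
qed

lemma
  assumes p: "1 \<le> p" and f: "in_Lp p f" and g: "in_Lp p g" and h: "h \<in> borel_measurable P"
    and le: "AE x in P. norm (h x) \<le> norm (f x) + norm (g x)"
  shows in_Lp_triangle: "in_Lp p h" and pmoment_triangle: "pmoment p h \<le> 2 powr p * (pmoment p f + pmoment p g)"
proof -
  note [measurable] = in_LpD(1)[OF f] in_LpD(1)[OF g] h
  have i: "integrable P (\<lambda>x. 2 powr p * (norm (f x) powr p + norm (g x) powr p))"
    using f g by (auto simp: in_Lp_def)
  have ae: "AE x in P. norm (h x) powr p \<le> 2 powr p * (norm (f x) powr p + norm (g x) powr p)"
    using le
  proof eventually_elim
    case (elim x)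
    have "norm (h x) powr p \<le> (norm (f x) + norm (g x)) powr p"
      using elim p by (intro powr_mono2) auto
    also have "\<dots> \<le> 2 powr p * (norm (f x) powr p + norm (g x) powr p)"
      using p by (intro add_powr_le) auto
    finally show ?case .
  qed
  show hL: "in_Lp p h"
    unfolding in_Lp_def
    by (intro conjI h, rule Bochner_Integration.integrable_bound[OF i]) (use ae in auto)
  have "pmoment p h \<le> (\<integral>x. 2 powr p * (norm (f x) powr p + norm (g x) powr p) \<partial>P)"
    unfolding pmoment_def using in_LpD(2)[OF hL] i ae by (rule integral_mono_AE)
  also have "\<dots> = 2 powr p * (pmoment p f + pmoment p g)"
    using f g by (simp add: pmoment_def in_LpD)
  finally show "pmoment p h \<le> 2 powr p * (pmoment p f + pmoment p g)" .
qed

lemma in_Lp_integrable: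
  assumes "1 \<le> p" "in_Lp p f"
  shows "integrable P f"
proof (rule Bochner_Integration.integrable_bound)
  show "integrable P (\<lambda>x. 1 + norm (f x) powr p)" using assms by (simp add: in_LpD)
  have "norm (f x) \<le> 1 + norm (f x) powr p" for x
    using powr_mono[of 1 p "norm (f x)"] assms by (cases "norm (f x) \<le> 1") (auto intro: add_increasing2)
  then show "AE x in P. norm (f x) \<le> norm (1 + norm (f x) powr p)" by simp
qed (rule in_LpD(1)[OF assms(2)])

text \<open>The expected p-th moment of the random-order martingale after \<open>m\<close>
  coordinates; for \<open>m = k\<close> it is the left side of the theorem.\<close>

definition layer_avg :: "real \<Rightarrow> (('a \<Rightarrow> 'b) \<Rightarrow> complex) \<Rightarrow> nat \<Rightarrow> real" where
  "layer_avg p f m = (\<Sum>S | S \<subseteq> I \<and> card S = m. pmoment p (cond_avg S f)) / real (card I choose m)"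

section \<open>Growth of the layer averages for bounded functions\<close>

context
  fixes p C :: real and f :: "('a \<Rightarrow> 'b) \<Rightarrow> complex"
  assumes p: "2 \<le> p" and C1: "1 \<le> C"
    and C: "\<And>a b :: complex. norm (a + b) powr p \<le> norm a powr p + p * (norm a powr (p - 2) * Re (cnj a * b))
        + C * (norm a powr (p - 2) * (norm b)\<^sup>2 + norm b powr p)"
    and f: "bdd_meas f"
begin

lemma pmoment_cond_avg_insert_le:
  assumes S: "S \<subseteq> I" and j: "j \<in> I - S"
  defines "w \<equiv> \<lambda>x. norm (cond_avg S f x) powr (p - 2)"
  shows "pmoment p (cond_avg (insert j S) f) \<le> pmoment p (cond_avg S f)
    + C * ((\<integral>x. w x * (norm (cond_avg (insert j S) f x - cond_avg S f x))\<^sup>2 \<partial>P)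
           + pmoment p (\<lambda>x. f x - cond_avg (I - {j}) f x))"
proof -
  note bdd = f bdd_meas_cond_avg bdd_meas_mult bdd_meas_inner bdd_meas_norm_square bdd_meas_diff bdd_meas_norm_powr
  define u where "u x = cond_avg (insert j S) f x - cond_avg S f x" for x
  have u: "bdd_meas u" unfolding u_def by (intro bdd)
  have w: "bdd_meas w" unfolding w_def by (intro bdd) (use p in auto)
  have inv: "w (mix T x y) = w x" if "S \<subseteq> T" for T x y
    using that by (simp add: w_def cond_avg_mix)
  note int = bdd_meas_integrable
  have p0: "0 \<le> p" using p by simp
  \<comment> \<open>The weight is a function of the coordinates in \<open>S\<close>, so the pairings
    of \<open>cond_avg S f\<close> with both halves of \<open>u\<close> evaluate to the same
    weighted square of \<open>cond_avg S f\<close>.\<close>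
  have orth: "(\<integral>x. w x * (cond_avg S f x \<bullet> u x) \<partial>P) = 0"
  proof -
    have "(\<integral>x. w x * (cond_avg S f x \<bullet> u x) \<partial>P)
      = (\<integral>x. w x * (cond_avg S f x \<bullet> cond_avg (insert j S) f x) - w x * (cond_avg S f x \<bullet> cond_avg S f x) \<partial>P)"
      by (simp add: u_def inner_diff_right right_diff_distrib)
    also have "\<dots> = (\<integral>x. w x * (cond_avg S f x \<bullet> cond_avg (insert j S) f x) \<partial>P)
        - (\<integral>x. w x * (cond_avg S f x \<bullet> cond_avg S f x) \<partial>P)"
      by (rule Bochner_Integration.integral_diff) (intro int bdd w)+
    also have "\<dots> = 0"
      using integral_weight_inner_cond_avg[of f w S S "insert j S"]
        integral_weight_inner_cond_avg[of f w S S S] f w inv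
      by (simp add: Int_absorb2 subset_insertI)
    finally show ?thesis .
  qed
  have "pmoment p u \<le> pmoment p (\<lambda>x. f x - cond_avg (I - {j}) f x)"
  proof -
    let ?h = "\<lambda>x. f x - cond_avg (I - {j}) f x"
    have h: "bdd_meas ?h" by (intro bdd)
    \<comment> \<open>This rests on \<open>insert j S \<inter> (I - {j}) = S\<close>; contractivity
      then removes the dependence on \<open>S\<close> from the bound for the p-th power of the
      increment.\<close>
    have "u x = cond_avg (insert j S) ?h x" if x: "x \<in> space P" for x
    proof -
      have i: "integrable P (\<lambda>y. g (mix (insert j S) x y))" if "bdd_meas g" for g :: "_ \<Rightarrow> complex"
      proof -
        note [measurable] = bdd_meas_measurable[OF that] x
        from that obtain B where "\<forall>x\<in>space P. norm (g x) \<le> B" by (auto simp: bdd_meas_def)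
        then show ?thesis by (intro int bdd_measI[where B = B]) (use x in auto)
      qed
      have "cond_avg (insert j S) ?h x = cond_avg (insert j S) f x - cond_avg (insert j S) (cond_avg (I - {j}) f) x"
        unfolding cond_avg_def[of "insert j S"]
        by (rule Bochner_Integration.integral_diff) (intro i bdd)+
      also have "insert j S \<inter> (I - {j}) = S" using S j by auto
      then have "cond_avg (insert j S) (cond_avg (I - {j}) f) x = cond_avg S f x"
        using cond_avg_cond_avg[OF f x] by simp
      finally show ?thesis by (simp add: u_def)
    qed
    then have "pmoment p u = pmoment p (cond_avg (insert j S) ?h)"
      unfolding pmoment_def by (intro Bochner_Integration.integral_cong) auto
    also have "\<dots> \<le> pmoment p ?h"
      using p by (intro pmoment_cond_avg_le in_Lp_bdd_meas h) auto
    finally show ?thesis .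
  qed
  then have ud: "C * pmoment p u \<le> C * pmoment p (\<lambda>x. f x - cond_avg (I - {j}) f x)"
    using C1 by (intro mult_left_mono) auto
  have "pmoment p (cond_avg (insert j S) f) \<le> (\<integral>x. norm (cond_avg S f x) powr p
      + p * (w x * (cond_avg S f x \<bullet> u x)) + C * (w x * (norm (u x))\<^sup>2 + norm (u x) powr p) \<partial>P)"
    unfolding pmoment_def
  proof (rule integral_mono)
    fix x
    have re: "Re (cnj a * b) = a \<bullet> b" for a b :: complex by (simp add: inner_complex_def)
    show "norm (cond_avg (insert j S) f x) powr p \<le> norm (cond_avg S f x) powr p
      + p * (w x * (cond_avg S f x \<bullet> u x)) + C * (w x * (norm (u x))\<^sup>2 + norm (u x) powr p)"
      using C[of "cond_avg S f x" "u x"] unfolding re by (simp add: u_def w_def)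
  qed (intro Bochner_Integration.integrable_add integrable_mult_right int bdd u w p0)+
  also have "\<dots> = pmoment p (cond_avg S f) + p * (\<integral>x. w x * (cond_avg S f x \<bullet> u x) \<partial>P)
      + C * ((\<integral>x. w x * (norm (u x))\<^sup>2 \<partial>P) + pmoment p u)"
    unfolding pmoment_def
    by (subst Bochner_Integration.integral_add Bochner_Integration.integral_mult_right,
        (intro Bochner_Integration.integrable_add integrable_mult_right int bdd u w p0)+)+ simp
  finally have "pmoment p (cond_avg (insert j S) f) \<le> pmoment p (cond_avg S f)
    + C * ((\<integral>x. w x * (norm (u x))\<^sup>2 \<partial>P) + pmoment p (\<lambda>x. f x - cond_avg (I - {j}) f x))"
    using ud by (simp add: orth ring_distribs)
  then show ?thesis by (simp only: u_def)
qed

text \<open>The parameter \<open>d\<close> will be \<open>k / n\<close>. Young's inequality is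
  applied to |E_S f| and sqrt d * |f|: this yields the factor \<open>d powr (p / 2)\<close> of the
  theorem in front of the moment of \<open>f\<close>, at the price of the factor
  \<open>1 / d\<close> outside.\<close>

lemma sum_pmoment_cond_avg_insert_le:
  assumes S: "S \<subseteq> I" and d: "0 < d" and e: "0 < e"
  shows "(\<Sum>j\<in>I - S. pmoment p (cond_avg (insert j S) f))
    \<le> real (card (I - S)) * pmoment p (cond_avg S f)
      + C / d * (e * pmoment p (cond_avg S f) + (1 / e) powr ((p - 2) / 2) * (d powr (p / 2) * pmoment p f))
      + C * (\<Sum>j\<in>I - S. pmoment p (\<lambda>x. f x - cond_avg (I - {j}) f x))"
proof -
  define w where "w x = norm (cond_avg S f x) powr (p - 2)" for x
  define Y where "Y = (1 / e) powr ((p - 2) / 2)"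
  note bdd = f bdd_meas_cond_avg bdd_meas_mult bdd_meas_norm_square bdd_meas_norm_powr
  have w: "bdd_meas w" unfolding w_def by (intro bdd) (use p in auto)
  have inv: "w (mix T x y) = w x" if "S \<subseteq> T" for T x y
    using that by (simp add: w_def cond_avg_mix)
  have p0: "0 \<le> p" using p by simp
  let ?D = "\<lambda>j. pmoment p (\<lambda>x. f x - cond_avg (I - {j}) f x)"
  let ?u = "\<lambda>j. \<integral>x. w x * (norm (cond_avg (insert j S) f x - cond_avg S f x))\<^sup>2 \<partial>P"
  have bessel: "(\<Sum>j\<in>I - S. ?u j) \<le> (\<integral>x. w x * (norm (f x))\<^sup>2 \<partial>P)"
    by (rule weighted_bessel[OF f w]) (use S inv in \<open>auto simp: w_def\<close>)
  have "d * (\<integral>x. w x * (norm (f x))\<^sup>2 \<partial>P) = (\<integral>x. d * (w x * (norm (f x))\<^sup>2) \<partial>P)" by simp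
  also have "\<dots> \<le> (\<integral>x. e * norm (cond_avg S f x) powr p + Y * (d powr (p / 2) * norm (f x) powr p) \<partial>P)"
  proof (rule integral_mono)
    fix x
    have "w x * (sqrt d * norm (f x))\<^sup>2 \<le> e * norm (cond_avg S f x) powr p + Y * (sqrt d * norm (f x)) powr p"
      unfolding w_def Y_def using p d e by (intro powr_minus_two_mult_sq_le) auto
    also have "(sqrt d * norm (f x)) powr p = d powr (p / 2) * norm (f x) powr p"
      using d by (simp add: powr_mult powr_half_sqrt[symmetric] powr_powr)
    finally show "d * (w x * (norm (f x))\<^sup>2) \<le> e * norm (cond_avg S f x) powr p + Y * (d powr (p / 2) * norm (f x) powr p)"
      using d by (simp add: power_mult_distrib mult_ac)
  qed (intro Bochner_Integration.integrable_add integrable_mult_right bdd_meas_integrable bdd w p0)+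
  also have "\<dots> = e * pmoment p (cond_avg S f) + Y * (d powr (p / 2) * pmoment p f)"
    unfolding pmoment_def
    by (subst Bochner_Integration.integral_add,
        (intro Bochner_Integration.integrable_add integrable_mult_right bdd_meas_integrable bdd w p0)+) simp
  finally have "(\<integral>x. w x * (norm (f x))\<^sup>2 \<partial>P) \<le> (e * pmoment p (cond_avg S f) + Y * (d powr (p / 2) * pmoment p f)) / d"
    using d by (simp add: field_simps)
  with bessel have bound: "C * (\<Sum>j\<in>I - S. ?u j) \<le> C * ((e * pmoment p (cond_avg S f) + Y * (d powr (p / 2) * pmoment p f)) / d)"
    using C1 by (intro mult_left_mono) auto
  have "(\<Sum>j\<in>I - S. pmoment p (cond_avg (insert j S) f))
      \<le> (\<Sum>j\<in>I - S. pmoment p (cond_avg S f) + C * (?u j + ?D j))"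
    unfolding w_def by (intro sum_mono pmoment_cond_avg_insert_le S)
  also have "\<dots> = real (card (I - S)) * pmoment p (cond_avg S f) + C * (\<Sum>j\<in>I - S. ?u j) + C * (\<Sum>j\<in>I - S. ?D j)"
    by (simp add: sum.distrib sum_distrib_left[symmetric] ring_distribs)
  finally show ?thesis using bound by (simp add: Y_def)
qed

text \<open>Sum the previous estimate over all \<open>S\<close> of size \<open>m\<close> and divide
  by (n - m) * binomial(n, m). Since m < k \<le> n/2, one has n - m \<ge> n/2, so the prefactor C /
  (d (n - m)) is at most 2 C / k.\<close>

lemma layer_avg_step:
  assumes k: "0 < k" "2 * k \<le> card I" and m: "m < k"
  defines "d \<equiv> real k / real (card I)"
  defines "R \<equiv> 2 * C * (4 * C) powr ((p - 2) / 2) * (d powr (p / 2) * pmoment p f)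
     + C * (d * (\<Sum>j\<in>I. pmoment p (\<lambda>x. f x - cond_avg (I - {j}) f x)))"
  shows "layer_avg p f (Suc m) \<le> layer_avg p f m + (layer_avg p f m / 2 + R) / real k"
proof -
  define n where "n = card I"
  define D where "D j = pmoment p (\<lambda>x. f x - cond_avg (I - {j}) f x)" for j
  \<comment> \<open>Chosen so that 2 * C * e = 1/2, the coefficient required by
    \<open>linear_growth_max_bound\<close>.\<close>
  define e where "e = 1 / (4 * C)"
  define Q where "Q = (4 * C) powr ((p - 2) / 2) * (d powr (p / 2) * pmoment p f)"
  define b where "b = real (n choose m)"
  let ?L = "\<lambda>m. {S. S \<subseteq> I \<and> card S = m}"
  have n: "0 < n" "m < n" "2 * k \<le> n" using k m by (auto simp: n_def)
  have b: "0 < b" using n by (simp add: b_def)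
  have d: "0 < d" using k n by (simp add: d_def n_def)
  have e: "0 < e" using C1 by (simp add: e_def)
  have Q: "0 \<le> Q" by (simp add: Q_def)
  have cI: "card (I - S) = n - m" if "S \<in> ?L m" for S
  proof -
    have "finite S" "S \<subseteq> I" "card S = m" using that finite_index finite_subset by auto
    then show ?thesis by (simp add: card_Diff_subset n_def)
  qed
  have sumL: "(\<Sum>S\<in>?L m. pmoment p (cond_avg S f)) = b * layer_avg p f m"
    using b by (simp add: layer_avg_def b_def n_def)
  have cardL: "real (card (?L m)) = b"
    using n_subsets[OF finite_index, of m] by (simp add: b_def n_def)
  \<comment> \<open>The first identity makes the double count return exactly the next layer average.
    The second gives each \<open>D j\<close> the weight 1/n after division.\<close>
  have binom: "real (Suc m) * real (n choose Suc m) = real (n - m) * b"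
    and binom': "real (n - m) * b = real n * real ((n - 1) choose m)"
    unfolding b_def of_nat_mult[symmetric] by (simp_all only: binomial_absorption binomial_absorb_comp)
  have "real (n - m) * b * layer_avg p f (Suc m) = real (Suc m) * (\<Sum>T\<in>?L (Suc m). pmoment p (cond_avg T f))"
    using n unfolding binom[symmetric] by (simp add: layer_avg_def n_def)
  also have "\<dots> = (\<Sum>S\<in>?L m. \<Sum>j\<in>I - S. pmoment p (cond_avg (insert j S) f))"
    by (rule sum_subsets_insert[OF finite_index, symmetric])
  also have "\<dots> \<le> (\<Sum>S\<in>?L m. real (n - m) * pmoment p (cond_avg S f)
      + C / d * (e * pmoment p (cond_avg S f) + Q) + C * (\<Sum>j\<in>I - S. D j))"
  proof (rule sum_mono)
    fix S assume "S \<in> ?L m"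
    then show "(\<Sum>j\<in>I - S. pmoment p (cond_avg (insert j S) f)) \<le> real (n - m) * pmoment p (cond_avg S f)
      + C / d * (e * pmoment p (cond_avg S f) + Q) + C * (\<Sum>j\<in>I - S. D j)"
      using sum_pmoment_cond_avg_insert_le[of S d e] d e cI[of S] by (simp add: D_def Q_def e_def)
  qed
  also have "\<dots> = real (n - m) * (b * layer_avg p f m) + C / d * (e * (b * layer_avg p f m) + b * Q)
      + C * (real ((n - 1) choose m) * sum D I)"
    unfolding sum.distrib sum_distrib_left[symmetric] sumL sum_constant cardL
      sum_subsets_complement[OF finite_index] n_def[symmetric] ..
  also have "real ((n - 1) choose m) = real (n - m) * b / real n"
    using binom' n by (simp add: field_simps)
  also have "real (n - m) * (b * layer_avg p f m) + C / d * (e * (b * layer_avg p f m) + b * Q)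
      + C * (real (n - m) * b / real n * sum D I) = real (n - m) * b *
      (layer_avg p f m + C / d * (e * layer_avg p f m + Q) / real (n - m) + C * sum D I / real n)"
  proof -
    have alg: "N * (b * x) + Z * (e * (b * x) + b * Q) + C * (N * b / n' * s)
        = N * b * (x + Z * (e * x + Q) / N + C * s / n')" if "N \<noteq> 0" "n' \<noteq> 0" for N Z x n' s :: real
      using that by (simp add: field_simps)
    show ?thesis by (rule alg) (use n in auto)
  qed
  finally have "real (n - m) * b * layer_avg p f (Suc m) \<le> real (n - m) * b *
      (layer_avg p f m + C / d * (e * layer_avg p f m + Q) / real (n - m) + C * sum D I / real n)" .
  then have "layer_avg p f (Suc m) \<le> layer_avg p f m + C / d * (e * layer_avg p f m + Q) / real (n - m) + C * sum D I / real n"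
    using b n by (subst (asm) mult_le_cancel_left_pos) auto
  \<comment> \<open>Here \<open>2 * k \<le> card I\<close> enters: the number of unrevealed
    coordinates never falls below n/2.\<close>
  also have "C / d * (e * layer_avg p f m + Q) / real (n - m) \<le> C / d * (e * layer_avg p f m + Q) / (real n / 2)"
  proof (rule divide_left_mono)
    show "real n / 2 \<le> real (n - m)" using n m by (simp add: of_nat_diff)
    show "0 \<le> C / d * (e * layer_avg p f m + Q)"
      using C1 d e Q by (intro mult_nonneg_nonneg add_nonneg_nonneg) (auto simp: layer_avg_def intro!: sum_nonneg divide_nonneg_nonneg)
  qed (use n in auto)
  also have "C / d * (e * layer_avg p f m + Q) / (real n / 2) = (layer_avg p f m / 2 + 2 * C * Q) / real k"
    using C1 n k by (simp add: d_def n_def[symmetric] e_def field_simps)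
  also have "C * sum D I / real n = C * (d * sum D I) / real k"
    using k n by (simp add: d_def n_def[symmetric])
  finally show ?thesis
    by (simp add: R_def Q_def D_def[symmetric] add_divide_distrib mult.assoc)
qed

text \<open>The mean is kept on the right because the bounded approximants of a mean-zero function
  need not have mean zero. The constants \<open>?c1\<close> and \<open>?c2\<close> are those of 2 R;
  \<open>?c3\<close> covers k > n/2, where 1 \<le> (2 d)^(p/2) and contractivity alone bounds the
  layer by the moment of \<open>f\<close>.\<close>

lemma layer_avg_bound_bdd:
  assumes k: "0 < k" "k \<le> card I"
  defines "d \<equiv> real k / real (card I)"
  shows "layer_avg p f k \<le> 2 * norm (\<integral>x. f x \<partial>P) powr p
    + (4 * C * (4 * C) powr ((p - 2) / 2) + 2 * C + 2 powr (p / 2))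
      * (d * (\<Sum>j\<in>I. pmoment p (\<lambda>x. f x - cond_avg (I - {j}) f x)) + d powr (p / 2) * pmoment p f)"
    (is "_ \<le> 2 * ?m + (?c1 + ?c2 + ?c3) * (d * ?D + ?F)")
proof -
  have d: "0 < d" using k by (simp add: d_def)
  have nn: "0 \<le> ?c1" "0 \<le> ?c2" "0 \<le> ?c3" "0 \<le> d * ?D" "0 \<le> ?F" "0 \<le> ?m"
    using C1 d by (auto intro!: mult_nonneg_nonneg sum_nonneg)
  have expand: "(?c1 + ?c2 + ?c3) * (d * ?D + ?F) = ?c1 * ?F + ?c2 * (d * ?D)
      + (?c1 * (d * ?D) + ?c2 * ?F + ?c3 * (d * ?D) + ?c3 * ?F)" by (simp only: ring_distribs)
  note nn2 = mult_nonneg_nonneg[OF nn(1) nn(4)] mult_nonneg_nonneg[OF nn(1) nn(5)]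
    mult_nonneg_nonneg[OF nn(2) nn(4)] mult_nonneg_nonneg[OF nn(2) nn(5)]
    mult_nonneg_nonneg[OF nn(3) nn(4)] mult_nonneg_nonneg[OF nn(3) nn(5)]
  show ?thesis
  proof (cases "2 * k \<le> card I")
    case True
    define R where "R = 2 * C * (4 * C) powr ((p - 2) / 2) * ?F + C * (d * ?D)"
    \<comment> \<open>Layer 0 consists of the empty set only, and its average is the constant
      mean.\<close>
    have "{S. S \<subseteq> I \<and> card S = 0} = {{}}"
      using finite_index by (auto dest: finite_subset)
    then have a0: "layer_avg p f 0 = ?m"
      by (simp add: layer_avg_def pmoment_def cond_avg_empty P.prob_space)
    have R: "0 \<le> R"
      unfolding R_def
      by (intro add_nonneg_nonneg mult_nonneg_nonneg[OF _ nn(4)] mult_nonneg_nonneg[OF _ nn(5)])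
        (use C1 in auto)
    have "layer_avg p f k \<le> 2 * \<bar>layer_avg p f 0\<bar> + 2 * \<bar>R\<bar>"
      by (rule linear_growth_max_bound[OF k(1)]) (unfold R_def d_def, rule layer_avg_step[OF k(1) True])
    then have "layer_avg p f k \<le> 2 * ?m + ?c1 * ?F + ?c2 * (d * ?D)"
      using R nn by (simp add: a0 R_def)
    then show ?thesis using expand nn2 by linarith
  next
    case False
    then have "1 \<le> 2 * d" using k by (simp add: d_def field_simps)
    then have "1 powr (p / 2) \<le> (2 * d) powr (p / 2)" using p by (intro powr_mono2) auto
    then have one: "1 \<le> ?c3 * d powr (p / 2)" using d by (simp add: powr_mult)
    have "(\<Sum>S | S \<subseteq> I \<and> card S = k. pmoment p (cond_avg S f)) \<le> (\<Sum>S | S \<subseteq> I \<and> card S = k. pmoment p f)"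
      using p by (intro sum_mono pmoment_cond_avg_le in_Lp_bdd_meas f) auto
    also have "\<dots> = real (card I choose k) * pmoment p f"
      by (simp add: n_subsets finite_index)
    finally have "layer_avg p f k \<le> pmoment p f"
      using k unfolding layer_avg_def by (simp add: divide_le_eq mult.commute)
    also have "pmoment p f \<le> ?c3 * d powr (p / 2) * pmoment p f"
      using mult_right_mono[OF one pmoment_nonneg] by simp
    finally have "layer_avg p f k \<le> ?c3 * ?F" by (simp only: mult.assoc)
    then show ?thesis using expand nn nn2 by linarith
  qed
qed

end

end


context finite_product_prob_space
begin

section \<open>From bounded functions to all functions with finite p-th moment\<close>

lemma bounded_approximation:
  assumes f: "in_Lp p f" and p: "1 \<le> p" and e: "0 < e"
  obtains g where "bdd_meas g" "in_Lp p (\<lambda>x. f x - g x)" "pmoment p (\<lambda>x. f x - g x) \<le> e"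
proof -
  note [measurable] = in_LpD(1)[OF f]
  define g where "g m x = (if norm (f x) \<le> real m then f x else 0)" for m x
  have [measurable]: "g m \<in> borel_measurable P" for m unfolding g_def by measurable
  have le: "norm (f x - g m x) powr p \<le> norm (f x) powr p" for m x by (simp add: g_def)
  have lim: "(\<lambda>m. norm (f x - g m x) powr p) \<longlonglongrightarrow> 0" for x
  proof (rule tendsto_eventually, rule eventually_sequentiallyI)
    fix m assume "nat \<lceil>norm (f x)\<rceil> \<le> m"
    then show "norm (f x - g m x) powr p = 0" by (simp add: g_def nat_le_iff ceiling_le_iff)
  qed
  have "(\<lambda>m. pmoment p (\<lambda>x. f x - g m x)) \<longlonglongrightarrow> (\<integral>x. 0 \<partial>P)"
    unfolding pmoment_def
    by (rule integral_dominated_convergence[where w = "\<lambda>x. norm (f x) powr p"])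
      (use in_LpD(2)[OF f] lim le in simp_all)
  then have "eventually (\<lambda>m. pmoment p (\<lambda>x. f x - g m x) < e) sequentially"
    using e by (intro order_tendstoD(2)) auto
  then obtain m where m: "pmoment p (\<lambda>x. f x - g m x) < e"
    using eventually_happens by fastforce
  have "bdd_meas (g m)" by (rule bdd_measI[where B = "real m"]) (simp_all add: g_def)
  moreover have "in_Lp p (\<lambda>x. f x - g m x)"
    unfolding in_Lp_def
    by (intro conjI, measurable, rule Bochner_Integration.integrable_bound[OF in_LpD(2)[OF f]])
      (use le in simp_all)
  ultimately show ?thesis using m that by (meson less_imp_le)
qed

text \<open>Write f = g + r with \<open>g\<close> bounded and the moment of \<open>r\<close> at most
  \<open>h\<close>. Moments are compared by the inequality with factor 2^p: once on the left, from
  \<open>f\<close> to \<open>g\<close>, and once back on the right, hence the two factors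
  \<open>2 powr p\<close>. Everything else is a multiple of \<open>h\<close> and disappears as
  \<open>h\<close> tends to 0.\<close>

lemma layer_avg_bound:
  assumes p: "2 \<le> p" and C1: "1 \<le> C"
    and C: "\<And>a b :: complex. norm (a + b) powr p \<le> norm a powr p + p * (norm a powr (p - 2) * Re (cnj a * b))
        + C * (norm a powr (p - 2) * (norm b)\<^sup>2 + norm b powr p)"
    and f: "in_Lp p f" and mean: "(\<integral>x. f x \<partial>P) = 0"
    and k: "0 < k" "k \<le> card I"
  defines "d \<equiv> real k / real (card I)"
  defines "K \<equiv> 4 * C * (4 * C) powr ((p - 2) / 2) + 2 * C + 2 powr (p / 2)"
  shows "layer_avg p f k \<le> 2 powr p * 2 powr p * K
    * (d * (\<Sum>j\<in>I. pmoment p (\<lambda>x. f x - cond_avg (I - {j}) f x)) + d powr (p / 2) * pmoment p f)"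
proof (rule field_le_epsilon)
  fix e :: real assume e: "0 < e"
  define a where "a = (2::real) powr p"
  define D where "D j = pmoment p (\<lambda>x. f x - cond_avg (I - {j}) f x)" for j
  have a: "0 \<le> a" and d: "0 \<le> d" and K: "0 \<le> K"
    using C1 by (auto simp: a_def d_def K_def intro!: add_nonneg_nonneg mult_nonneg_nonneg)
  \<comment> \<open>The total coefficient of \<open>h\<close> among the errors: 3 is 2 for the mean
    of \<open>g\<close> plus 1 for the left side, and the rest comes from the sum over
    \<open>j\<close> and from the moment of \<open>g\<close>. \<open>L\<close> may depend on
    \<open>n\<close>, since \<open>h\<close> is chosen after it.\<close>
  define L where "L = a * (3 + K * (d * (real (card I) * (a * (a * 2))) + d powr (p / 2) * a))"
  have L: "0 \<le> L" unfolding L_def using a d K by simp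
  define h where "h = e / (L + 1)"
  have h: "0 < h" "h * L \<le> e" using e L by (auto simp: h_def field_simps)
  have p1: "1 \<le> p" using p by simp
  obtain g where g: "bdd_meas g" and rL: "in_Lp p (\<lambda>x. f x - g x)" and r: "pmoment p (\<lambda>x. f x - g x) \<le> h"
    using bounded_approximation[OF f p1 h(1)] by blast
  let ?r = "\<lambda>x. f x - g x"
  have gL: "in_Lp p g" using p by (intro in_Lp_bdd_meas g) auto
  note [measurable] = in_LpD(1)[OF f] in_LpD(1)[OF gL]
  note ints = in_Lp_integrable[OF p1 f] in_Lp_integrable[OF p1 gL]
  have avg: "pmoment p (cond_avg S f) \<le> a * (pmoment p (cond_avg S g) + h)" for S
  proof -
    have "pmoment p (cond_avg S f) \<le> a * (pmoment p (cond_avg S g) + pmoment p (cond_avg S ?r))"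
      unfolding a_def
    proof (rule pmoment_triangle[OF p1 in_Lp_cond_avg[OF gL p1] in_Lp_cond_avg[OF rL p1]])
      show "AE x in P. norm (cond_avg S f x) \<le> norm (cond_avg S g x) + norm (cond_avg S ?r x)"
        using AE_cond_avg_diff[OF ints, of S]
        by eventually_elim (metis norm_triangle_sub)
    qed measurable
    also have "\<dots> \<le> a * (pmoment p (cond_avg S g) + h)"
      using pmoment_cond_avg_le[OF rL p1, of S] r a by (intro mult_left_mono add_left_mono) auto
    finally show ?thesis .
  qed
  have "layer_avg p f k \<le> a * (layer_avg p g k + h)"
  proof -
    let ?L = "{S. S \<subseteq> I \<and> card S = k}"
    have b: "0 < real (card I choose k)" using k by simp
    have "(\<Sum>S\<in>?L. pmoment p (cond_avg S f)) \<le> (\<Sum>S\<in>?L. a * (pmoment p (cond_avg S g) + h))"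
      by (rule sum_mono) (rule avg)
    also have "\<dots> = a * ((\<Sum>S\<in>?L. pmoment p (cond_avg S g)) + real (card I choose k) * h)"
      by (simp add: sum_distrib_left[symmetric] sum.distrib n_subsets finite_index)
    finally show ?thesis using b by (simp add: layer_avg_def field_simps)
  qed
  also have "layer_avg p g k \<le> 2 * h + K * (d * (\<Sum>j\<in>I. a * (D j + a * (2 * h))) + d powr (p / 2) * (a * (pmoment p f + h)))"
  proof -
    have "norm (\<integral>x. g x \<partial>P) powr p \<le> h"
    proof -
      \<comment> \<open>The mean of \<open>f\<close> vanishes, so the means of \<open>g\<close> and
        \<open>?r\<close> differ only in sign; the latter is controlled because averaging over all
        coordinates is contractive.\<close>
      have "norm (\<integral>x. g x \<partial>P) = norm (\<integral>x. ?r x \<partial>P)"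
        using ints mean by simp
      then have "norm (\<integral>x. g x \<partial>P) powr p = pmoment p (cond_avg {} ?r)"
        by (simp add: pmoment_def cond_avg_empty P.prob_space)
      also have "\<dots> \<le> h" using pmoment_cond_avg_le[OF rL p1, of "{}"] r by simp
      finally show ?thesis .
    qed
    moreover have "pmoment p g \<le> a * (pmoment p f + h)"
    proof -
      have "pmoment p g \<le> a * (pmoment p f + pmoment p ?r)"
        unfolding a_def
        by (rule pmoment_triangle[OF p1 f rL], measurable, rule AE_I2)
          (metis norm_triangle_sub norm_minus_commute)
      also have "\<dots> \<le> a * (pmoment p f + h)" using r a by (intro mult_left_mono) auto
      finally show ?thesis .
    qed
    moreover have "pmoment p (\<lambda>x. g x - cond_avg (I - {j}) g x) \<le> a * (D j + a * (2 * h))" for j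
    proof -
      let ?T = "I - {j}"
      let ?f' = "\<lambda>x. f x - cond_avg ?T f x" and ?r' = "\<lambda>x. ?r x - cond_avg ?T ?r x"
      have r': "in_Lp p ?r'" "pmoment p ?r' \<le> a * (pmoment p ?r + pmoment p (cond_avg ?T ?r))"
        unfolding a_def
        by (rule in_Lp_triangle[OF p1 rL in_Lp_cond_avg[OF rL p1, of ?T]]
            pmoment_triangle[OF p1 rL in_Lp_cond_avg[OF rL p1, of ?T]],
            measurable, rule AE_I2, rule norm_triangle_ineq4)+
      have f': "in_Lp p ?f'"
        by (rule in_Lp_triangle[OF p1 f in_Lp_cond_avg[OF f p1, of ?T]],
            measurable, rule AE_I2, rule norm_triangle_ineq4)
      have "pmoment p (\<lambda>x. g x - cond_avg ?T g x) \<le> a * (pmoment p ?f' + pmoment p ?r')"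
        unfolding a_def
      proof (rule pmoment_triangle[OF p1 f' r'(1)])
        show "AE x in P. norm (g x - cond_avg ?T g x) \<le> norm (?f' x) + norm (?r' x)"
          using AE_cond_avg_diff[OF ints, of ?T]
        proof eventually_elim
          case (elim x)
          have "g x - cond_avg ?T g x = ?f' x - ?r' x" using elim by (simp add: algebra_simps)
          then show ?case by (metis norm_triangle_ineq4)
        qed
      qed measurable
      also have "\<dots> \<le> a * (D j + a * (2 * h))"
      proof -
        have "a * (pmoment p ?r + pmoment p (cond_avg ?T ?r)) \<le> a * (2 * h)"
          using pmoment_cond_avg_le[OF rL p1, of ?T] r a by (intro mult_left_mono) auto
        with r'(2) show ?thesis unfolding D_def using a by (intro mult_left_mono add_left_mono) auto
      qed
      finally show ?thesis .
    qed
    ultimately have "2 * norm (\<integral>x. g x \<partial>P) powr p + K * (d * (\<Sum>j\<in>I. pmoment p (\<lambda>x. g x - cond_avg (I - {j}) g x))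
        + d powr (p / 2) * pmoment p g)
      \<le> 2 * h + K * (d * (\<Sum>j\<in>I. a * (D j + a * (2 * h))) + d powr (p / 2) * (a * (pmoment p f + h)))"
      using K d by (intro add_mono mult_left_mono sum_mono) auto
    with layer_avg_bound_bdd[OF p C1 C g k] show ?thesis unfolding K_def d_def by linarith
  qed
  also have "a * (2 * h + K * (d * (\<Sum>j\<in>I. a * (D j + a * (2 * h))) + d powr (p / 2) * (a * (pmoment p f + h))) + h)
      = a * a * K * (d * (\<Sum>j\<in>I. D j) + d powr (p / 2) * pmoment p f) + h * L"
    by (simp add: L_def sum_distrib_left[symmetric] sum.distrib algebra_simps)
  finally show "layer_avg p f k \<le> 2 powr p * 2 powr p * K
    * (d * (\<Sum>j\<in>I. pmoment p (\<lambda>x. f x - cond_avg (I - {j}) f x)) + d powr (p / 2) * pmoment p f) + e"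
    using h(2) a by (simp add: a_def D_def)
qed

end


subsection \<open>Trigonometric polynomials on the torus\<close>

abbreviation "unit_interval \<equiv> restrict_space lborel {0..<1::real}"

lemma finite_product_prob_space_unit_interval: "finite I \<Longrightarrow> finite_product_prob_space (\<lambda>_. unit_interval) I"
proof -
  assume I: "finite I"
  have "prob_space unit_interval"
    by (intro prob_spaceI) (simp add: emeasure_restrict_space space_restrict_space)
  with I show ?thesis
    by (simp add: finite_product_prob_space_def finite_product_sigma_finite_def
        finite_product_sigma_finite_axioms_def product_prob_spaceI product_prob_space.axioms(1))
qed

lemma torus_locale: "finite_product_prob_space (\<lambda>_. unit_interval) {1..n::nat}"
  by (simp add: finite_product_prob_space_unit_interval)

abbreviation "torus_avg n \<equiv> finite_product_prob_space.cond_avg (\<lambda>_. unit_interval) {1..n::nat}"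
abbreviation "torus_mix n \<equiv> finite_product_prob_space.mix {1..n::nat} :: _ \<Rightarrow> (_ \<Rightarrow> real) \<Rightarrow> _"
abbreviation "torus_bdd_meas n \<equiv> finite_product_prob_space.bdd_meas (\<lambda>_. unit_interval) {1..n::nat}"
abbreviation "torus_in_Lp n \<equiv> finite_product_prob_space.in_Lp (\<lambda>_. unit_interval) {1..n::nat}"
abbreviation "torus_pmoment n \<equiv> finite_product_prob_space.pmoment (\<lambda>_. unit_interval) {1..n::nat}"

lemmas torus_bdd_meas_def = finite_product_prob_space.bdd_meas_def[OF torus_locale, folded torus_def]
lemmas torus_bdd_measI = finite_product_prob_space.bdd_measI[OF torus_locale, folded torus_def]
lemmas torus_bdd_meas_mult = finite_product_prob_space.bdd_meas_mult[OF torus_locale]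
lemmas torus_bdd_meas_add = finite_product_prob_space.bdd_meas_add[OF torus_locale]

section \<open>Characters and the algebra they span\<close>

lemma space_torusD: "x \<in> space (torus n) \<Longrightarrow> j \<in> {1..n} \<Longrightarrow> 0 \<le> x j \<and> x j < 1"
  by (force simp: torus_def space_PiM space_restrict_space PiE_iff)

lemma measurable_torus_component:
  assumes "j \<in> {1..n}"
  shows "(\<lambda>x. x j) \<in> borel_measurable (torus n)"
proof -
  have "(\<lambda>x. x j) \<in> torus n \<rightarrow>\<^sub>M unit_interval"
    unfolding torus_def by (rule measurable_component_singleton[OF assms])
  then show ?thesis
    by (rule measurable_compose) (rule measurable_restrict_space1, simp)
qed

lemma character_eq_cis: "character n g x = cis (2 * pi * (\<Sum>j=1..n. x j * real_of_int (g j)))"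
  by (simp add: character_def cis_conv_exp mult_ac)

lemma norm_character [simp]: "norm (character n g x) = 1"
  by (simp add: character_eq_cis)

lemma character_measurable [measurable]: "character n g \<in> borel_measurable (torus n)"
proof -
  have [measurable]: "(\<lambda>x. \<Sum>j=1..n. x j * real_of_int (g j)) \<in> borel_measurable (torus n)"
    by (intro borel_measurable_sum borel_measurable_times measurable_torus_component) auto
  have "(\<lambda>x. character n g x) \<in> borel_measurable (torus n)"
    unfolding character_def by measurable
  then show ?thesis .
qed

lemma character_add: "character n (\<lambda>j. g j + h j) x = character n g x * character n h x"
  by (simp add: character_eq_cis cis_mult distrib_left sum.distrib)

lemma cnj_character: "cnj (character n g x) = character n (\<lambda>j. - g j) x"
  by (simp add: character_eq_cis cis_cnj sum_negf)

lemma character_zero [simp]: "character n (\<lambda>_. 0) x = 1"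
  by (simp add: character_eq_cis)

lemma character_mult_cnj: "character n g x * cnj (character n h x) = character n (\<lambda>j. g j - h j) x"
  using character_add[of n g "\<lambda>j. - h j" x] by (simp add: cnj_character)

lemma character_single:
  assumes "j \<in> {1..n}"
  shows "character n (\<lambda>i. if i = j then m else 0) x = cis (2 * pi * (real_of_int m * x j))"
proof -
  have "(\<Sum>i=1..n. x i * real_of_int (if i = j then m else 0)) = (\<Sum>i=1..n. if i = j then real_of_int m * x j else 0)"
    by (rule sum.cong) auto
  then show ?thesis using assms by (simp add: character_eq_cis)
qed

lemma bdd_meas_character: "torus_bdd_meas n (character n g)"
  by (rule torus_bdd_measI[where B = 1]) simp_all

text \<open>Generated inductively so that closure under products is a double induction; explicit
  finite sums are recovered in \<open>trig_poly_expansion\<close>.\<close>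

inductive trig_poly :: "nat \<Rightarrow> ((nat \<Rightarrow> real) \<Rightarrow> complex) \<Rightarrow> bool" for n where
  character: "g \<in> int_lattice {1..n} \<Longrightarrow> trig_poly n (character n g)"
| scale: "trig_poly n P \<Longrightarrow> trig_poly n (\<lambda>x. c * P x)"
| add: "trig_poly n P \<Longrightarrow> trig_poly n Q \<Longrightarrow> trig_poly n (\<lambda>x. P x + Q x)"

lemma trig_poly_const: "trig_poly n (\<lambda>_. c)"
  using trig_poly.scale[OF trig_poly.character[of "\<lambda>_. 0" n], of c] by (simp add: int_lattice_def)

lemma trig_poly_mult:
  assumes "trig_poly n P" "trig_poly n Q"
  shows "trig_poly n (\<lambda>x. P x * Q x)"
  using assms
proof (induction P)
  case (character g)
  from this(2) show ?case
  proof (induction Q)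
    case (character h)
    then have "(\<lambda>j. g j + h j) \<in> int_lattice {1..n}"
      using \<open>g \<in> int_lattice {1..n}\<close> by (auto simp: int_lattice_def)
    then have "trig_poly n (character n (\<lambda>j. g j + h j))" by (rule trig_poly.character)
    then show ?case by (simp add: character_add[abs_def])
  next
    case (scale Q c)
    then show ?case using trig_poly.scale[of n "\<lambda>x. character n g x * Q x" c] by (simp add: mult_ac)
  next
    case (add Q1 Q2)
    then show ?case using trig_poly.add[of n "\<lambda>x. character n g x * Q1 x" "\<lambda>x. character n g x * Q2 x"]
      by (simp add: distrib_left)
  qed
next
  case (scale P c)
  then show ?case using trig_poly.scale[of n "\<lambda>x. P x * Q x" c] by (simp add: mult_ac)
next
  case (add P1 P2)
  then show ?case using trig_poly.add[of n "\<lambda>x. P1 x * Q x" "\<lambda>x. P2 x * Q x"] by (simp add: distrib_right)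
qed

lemma trig_poly_expansion:
  assumes "trig_poly n P"
  obtains F c where "finite F" "F \<subseteq> int_lattice {1..n}" "\<And>x. P x = (\<Sum>g\<in>F. c g * character n g x)"
proof -
  have "\<exists>F c. finite F \<and> F \<subseteq> int_lattice {1..n} \<and> (\<forall>x. P x = (\<Sum>g\<in>F. c g * character n g x))"
    using assms
  proof induction
    case (character g)
    then show ?case by (intro exI[of _ "{g}"] exI[of _ "\<lambda>_. 1"]) simp
  next
    case (scale P c)
    then obtain F d where "finite F" "F \<subseteq> int_lattice {1..n}" "\<forall>x. P x = (\<Sum>g\<in>F. d g * character n g x)"
      by blast
    then show ?case
      by (intro exI[of _ F] exI[of _ "\<lambda>g. c * d g"]) (simp add: sum_distrib_left mult_ac)
  next
    case (add P Q)
    then obtain F c G d where *: "finite F" "F \<subseteq> int_lattice {1..n}" "\<forall>x. P x = (\<Sum>g\<in>F. c g * character n g x)"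
      "finite G" "G \<subseteq> int_lattice {1..n}" "\<forall>x. Q x = (\<Sum>g\<in>G. d g * character n g x)"
      by blast
    let ?e = "\<lambda>g. (if g \<in> F then c g else 0) + (if g \<in> G then d g else 0)"
    have "P x + Q x = (\<Sum>g\<in>F \<union> G. ?e g * character n g x)" for x
    proof -
      have "(\<Sum>g\<in>F. c g * character n g x) = (\<Sum>g\<in>F \<union> G. (if g \<in> F then c g else 0) * character n g x)"
        using * by (intro sum.mono_neutral_cong_left) auto
      moreover have "(\<Sum>g\<in>G. d g * character n g x) = (\<Sum>g\<in>F \<union> G. (if g \<in> G then d g else 0) * character n g x)"
        using * by (intro sum.mono_neutral_cong_left) auto
      ultimately show ?thesis using * by (simp add: sum.distrib distrib_right)
    qed
    with * show ?case by (intro exI[of _ "F \<union> G"] exI[of _ ?e]) auto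
  qed
  then show ?thesis using that by blast
qed

lemma bdd_meas_trig_poly: "trig_poly n P \<Longrightarrow> torus_bdd_meas n P"
proof (induction rule: trig_poly.induct)
  case (scale P c)
  have "torus_bdd_meas n (\<lambda>_. c)" by (rule torus_bdd_measI[where B = "norm c"]) simp_all
  with scale show ?case by (intro torus_bdd_meas_mult)
qed (intro bdd_meas_character torus_bdd_meas_add; assumption)+

lemma trig_poly_real_polynomial_cis:
  assumes "real_polynomial_function q" "j \<in> {1..n}"
  shows "trig_poly n (\<lambda>x. complex_of_real (q (cis (2 * pi * x j))))"
  using assms(1)
proof induction
  case (linear f)
  interpret bounded_linear f by fact
  \<comment> \<open>A real-linear \<open>f\<close> satisfies f(cis t) = cos t * f 1 + sin t * f i.
    Expressing cos and sin through cis t and cis (-t) gives the coefficients \<open>?a\<close> and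
    \<open>?b\<close>.\<close>
  let ?a = "(f 1 - \<i> * f \<i>) / 2" and ?b = "(f 1 + \<i> * f \<i>) / 2"
  have "complex_of_real (f (cis t)) = ?a * cis t + ?b * cis (- t)" for t
  proof -
    have "cis t = cos t *\<^sub>R 1 + sin t *\<^sub>R \<i>" by (simp add: complex_eq_iff)
    then have "f (cis t) = cos t * f 1 + sin t * f \<i>" by (metis add scaleR real_scaleR_def)
    then show ?thesis by (simp add: complex_eq_iff field_simps)
  qed
  moreover have "trig_poly n (\<lambda>x. ?a * character n (\<lambda>i. if i = j then 1 else 0) x
      + ?b * character n (\<lambda>i. if i = j then - 1 else 0) x)"
    using assms(2) by (intro trig_poly.add trig_poly.scale trig_poly.character) (auto simp: int_lattice_def)
  ultimately show ?case using assms(2) by (simp add: character_single)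
next
  case (const c)
  show ?case by (rule trig_poly_const)
next
  case (add f g)
  then show ?case using trig_poly.add by fastforce
next
  case (mult f g)
  then show ?case using trig_poly_mult by fastforce
qed

section \<open>Uniform limits of trigonometric polynomials\<close>

definition uniform_trig_limit :: "nat \<Rightarrow> ((nat \<Rightarrow> real) \<Rightarrow> complex) \<Rightarrow> bool" where
  "uniform_trig_limit n h \<longleftrightarrow>
     (\<forall>e>0. \<exists>P. trig_poly n P \<and> (\<forall>x\<in>space (torus n). norm (h x - P x) < e))"

lemma uniform_trig_limit_bounded:
  assumes "uniform_trig_limit n h"
  obtains B where "0 < B" "\<And>x. x \<in> space (torus n) \<Longrightarrow> norm (h x) \<le> B"
proof -
  from assms obtain P where P: "trig_poly n P" "\<forall>x\<in>space (torus n). norm (h x - P x) < 1"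
    unfolding uniform_trig_limit_def using zero_less_one by blast
  from bdd_meas_trig_poly[OF P(1)] obtain A where A: "\<forall>x\<in>space (torus n). norm (P x) \<le> A"
    unfolding torus_bdd_meas_def by blast
  have "norm (h x) \<le> \<bar>A\<bar> + 1" if "x \<in> space (torus n)" for x
    using P(2) A that norm_triangle_sub[of "h x" "P x"] by fastforce
  then show ?thesis by (intro that[of "\<bar>A\<bar> + 1"]) auto
qed

lemma uniform_trig_limit_trig_poly: "trig_poly n P \<Longrightarrow> uniform_trig_limit n P"
  unfolding uniform_trig_limit_def by (metis diff_self norm_zero)

lemma uniform_trig_limit_mult:
  assumes h: "uniform_trig_limit n h" and k: "uniform_trig_limit n k"
  shows "uniform_trig_limit n (\<lambda>x. h x * k x)"
  unfolding uniform_trig_limit_def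
proof (intro allI impI)
  fix e :: real assume e: "0 < e"
  obtain A where A: "0 < A" "\<And>x. x \<in> space (torus n) \<Longrightarrow> norm (h x) \<le> A"
    using uniform_trig_limit_bounded[OF h] by blast
  obtain Q where Q: "trig_poly n Q" "\<forall>x\<in>space (torus n). norm (k x - Q x) < e / (2 * A)"
    using k e A(1) unfolding uniform_trig_limit_def by (metis divide_pos_pos mult_pos_pos zero_less_numeral)
  obtain B where B: "0 < B" "\<And>x. x \<in> space (torus n) \<Longrightarrow> norm (Q x) \<le> B"
    using uniform_trig_limit_bounded[OF uniform_trig_limit_trig_poly[OF Q(1)]] by blast
  obtain P where P: "trig_poly n P" "\<forall>x\<in>space (torus n). norm (h x - P x) < e / (2 * B)"
    using h e B(1) unfolding uniform_trig_limit_def by (metis divide_pos_pos mult_pos_pos zero_less_numeral)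
  have "norm (h x * k x - P x * Q x) < e" if x: "x \<in> space (torus n)" for x
  proof -
    have "h x * k x - P x * Q x = h x * (k x - Q x) + (h x - P x) * Q x" by (simp add: algebra_simps)
    then have "norm (h x * k x - P x * Q x) \<le> norm (h x) * norm (k x - Q x) + norm (h x - P x) * norm (Q x)"
      by (metis norm_mult norm_triangle_ineq)
    also have "norm (h x) * norm (k x - Q x) \<le> A * norm (k x - Q x)"
      using A x by (intro mult_right_mono) auto
    also have "norm (h x - P x) * norm (Q x) \<le> norm (h x - P x) * B"
      using B x by (intro mult_left_mono) auto
    also have "A * norm (k x - Q x) < A * (e / (2 * A))"
      using A Q x by (intro mult_strict_left_mono) auto
    also have "norm (h x - P x) * B < e / (2 * B) * B"
      using B P x by (intro mult_strict_right_mono) auto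
    finally show ?thesis using A(1) B(1) by simp
  qed
  with trig_poly_mult[OF P(1) Q(1)] show "\<exists>P. trig_poly n P \<and> (\<forall>x\<in>space (torus n). norm (h x * k x - P x) < e)"
    by blast
qed

lemma uniform_trig_limit_prod:
  "(\<And>j. j \<in> J \<Longrightarrow> uniform_trig_limit n (h j)) \<Longrightarrow> uniform_trig_limit n (\<lambda>x. \<Prod>j\<in>J. h j x)"
proof (induction J rule: infinite_finite_induct)
  case (insert j J)
  then show ?case using uniform_trig_limit_mult[of n "h j"] by simp
qed (simp_all add: uniform_trig_limit_trig_poly trig_poly_const)

text \<open>Stone-Weierstrass is applied on the unit circle and not on the interval: there
  continuity includes periodicity, and real polynomials in the point
  \<open>cis (2 * pi * x j)\<close> are trigonometric polynomials in \<open>x j\<close>.\<close>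

lemma uniform_trig_limit_circle:
  fixes \<phi> :: "complex \<Rightarrow> real"
  assumes \<phi>: "continuous_on UNIV \<phi>" and j: "j \<in> {1..n}"
  shows "uniform_trig_limit n (\<lambda>x. complex_of_real (\<phi> (cis (2 * pi * x j))))"
  unfolding uniform_trig_limit_def
proof (intro allI impI)
  fix e :: real assume "0 < e"
  then obtain q where q: "real_polynomial_function q" "\<And>z. z \<in> sphere 0 1 \<Longrightarrow> \<bar>\<phi> z - q z\<bar> < e"
    using Stone_Weierstrass_real_polynomial_function[of "sphere 0 1" \<phi> e] continuous_on_subset[OF \<phi>]
    by (metis compact_sphere subset_UNIV)
  have "norm (complex_of_real (\<phi> (cis t)) - complex_of_real (q (cis t))) < e" for t
    using q(2)[of "cis t"] unfolding of_real_diff[symmetric] norm_of_real by simp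
  with trig_poly_real_polynomial_cis[OF q(1) j]
  show "\<exists>P. trig_poly n P \<and> (\<forall>x\<in>space (torus n). norm (complex_of_real (\<phi> (cis (2 * pi * x j))) - P x) < e)"
    by blast
qed

text \<open>Open intervals correspond to open arcs avoiding the point 1 of the circle, and
  indicators of open sets are limits of continuous functions. The full interval is added because
  open intervals miss the endpoint 0; its indicator is the constant 1.\<close>

definition interval_generator :: "real set set" where
  "interval_generator = insert {0..<1} {{a<..<b} | a b. 0 \<le> a \<and> b \<le> 1}"

lemma interval_generatorI: "0 \<le> a \<Longrightarrow> b \<le> 1 \<Longrightarrow> {a<..<b} \<in> interval_generator"
  unfolding interval_generator_def by blast

lemma cis_eq_cis_iff: "cis a = cis b \<longleftrightarrow> (\<exists>k::int. a = b + 2 * pi * k)"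
proof -
  have "cis a = cis b \<longleftrightarrow> sin a = sin b \<and> cos a = cos b" by (auto simp: complex_eq_iff)
  also have "\<dots> \<longleftrightarrow> (\<exists>k::int. a = b + 2 * pi * k)"
    unfolding sin_cos_eq_iff by (metis mult.commute mult.left_commute)
  finally show ?thesis .
qed

text \<open>Truncated multiples of the distance to a compact arc approximate the indicator
  of the complementary open arc.\<close>

lemma interval_generator_circle_limit:
  assumes "A \<in> interval_generator"
  obtains \<phi> :: "nat \<Rightarrow> complex \<Rightarrow> real"
  where "\<And>m. continuous_on UNIV (\<phi> m)" "\<And>m z. 0 \<le> \<phi> m z \<and> \<phi> m z \<le> 1"
    "\<And>t. 0 \<le> t \<Longrightarrow> t < 1 \<Longrightarrow> (\<lambda>m. \<phi> m (cis (2 * pi * t))) \<longlonglongrightarrow> indicator A t"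
proof (cases "A = {0..<1}")
  case True
  then show ?thesis by (intro that[of "\<lambda>_ _. 1"]) auto
next
  case False
  with assms obtain a b where A: "A = {a<..<b}" and ab: "0 \<le> a" "b \<le> 1"
    by (auto simp: interval_generator_def)
  define K where "K = (\<lambda>t. cis (2 * pi * t)) ` ({0..1} - {a<..<b})"
  have "compact ({0..1} - {a<..<b})" by (intro compact_diff) auto
  then have K: "closed K" unfolding K_def
    by (intro compact_imp_closed compact_continuous_image) (auto intro!: continuous_intros)
  have "cis (2 * pi * 0) \<in> K" using ab unfolding K_def by (intro imageI) auto
  then have K0: "K \<noteq> {}" by blast
  have inK: "cis (2 * pi * t) \<in> K \<longleftrightarrow> t \<notin> A" if t: "0 \<le> t" "t < 1" for t
  proof
    assume "cis (2 * pi * t) \<in> K"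
    then obtain s where s: "0 \<le> s" "s \<le> 1" "s \<notin> A" "cis (2 * pi * t) = cis (2 * pi * s)"
      by (auto simp: K_def A)
    then obtain k :: int where "2 * pi * t = 2 * pi * s + 2 * pi * k" by (auto simp: cis_eq_cis_iff)
    then have "2 * pi * t = 2 * pi * (s + k)" by (simp add: algebra_simps)
    then have ts: "t = s + k" by simp
    \<comment> \<open>The second case is the identification of the endpoints: it forces s = 1 and t
      = 0, and 0 is not in \<open>A\<close> because \<open>0 \<le> a\<close>.\<close>
    then have "k = 0 \<or> k = - 1" using s t by linarith
    then show "t \<notin> A" using ts s t ab by (auto simp: A)
  next
    assume "t \<notin> A"
    then show "cis (2 * pi * t) \<in> K" using t by (auto simp: K_def A)
  qed
  define \<phi> where "\<phi> m z = min 1 (real m * infdist z K)" for m z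
  show ?thesis
  proof (rule that[of \<phi>])
    show "continuous_on UNIV (\<phi> m)" for m
      unfolding \<phi>_def by (intro continuous_intros)
    show "0 \<le> \<phi> m z \<and> \<phi> m z \<le> 1" for m z
      by (auto simp: \<phi>_def infdist_nonneg)
    fix t :: real assume t: "0 \<le> t" "t < 1"
    let ?d = "infdist (cis (2 * pi * t)) K"
    show "(\<lambda>m. \<phi> m (cis (2 * pi * t))) \<longlonglongrightarrow> indicator A t"
    proof (cases "t \<in> A")
      case True
      then have "cis (2 * pi * t) \<notin> K" using inK t by simp
      then have d: "0 < ?d"
        using in_closed_iff_infdist_zero[OF K K0] infdist_nonneg[of "cis (2 * pi * t)" K] by force
      have "eventually (\<lambda>m. \<phi> m (cis (2 * pi * t)) = 1) sequentially"
      proof (rule eventually_sequentiallyI[of "nat \<lceil>1 / ?d\<rceil>"])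
        fix m assume "nat \<lceil>1 / ?d\<rceil> \<le> m"
        then have "1 / ?d \<le> real m" by linarith
        then show "\<phi> m (cis (2 * pi * t)) = 1" using d by (simp add: \<phi>_def field_simps)
      qed
      with True show ?thesis by (simp add: tendsto_eventually)
    next
      case False
      then have "?d = 0" using inK t by simp
      with False show ?thesis by (simp add: \<phi>_def)
    qed
  qed
qed

lemma Int_stable_interval_generator: "Int_stable interval_generator"
proof (rule Int_stableI)
  fix A B assume "A \<in> interval_generator" "B \<in> interval_generator"
  then consider "A = {0..<1}" | "B = {0..<1}"
    | a b c d where "A = {a<..<b}" "B = {c<..<d}" "0 \<le> a" "b \<le> 1" "0 \<le> c" "d \<le> 1"
    by (auto simp: interval_generator_def)
  moreover have "{0..<1} \<inter> C = C" "C \<inter> {0..<1} = C" if "C \<in> interval_generator" for C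
    using that by (auto simp: interval_generator_def)
  ultimately show "A \<inter> B \<in> interval_generator"
  proof cases
    case 3
    then have "A \<inter> B = {max a c<..<min b d}" by auto
    with 3 show ?thesis by (auto intro: interval_generatorI)
  qed (use \<open>A \<in> _\<close> \<open>B \<in> _\<close> \<open>\<And>C. C \<in> _ \<Longrightarrow> {0..<1} \<inter> C = C\<close> \<open>\<And>C. C \<in> _ \<Longrightarrow> C \<inter> {0..<1} = C\<close> in simp_all)
qed

lemma sigma_sets_interval_generator:
  "sets unit_interval = sigma_sets {0..<1} interval_generator"
proof
  have "sets unit_interval = (\<inter>) {0..<1} ` sigma_sets UNIV (range greaterThan)"
    by (simp add: sets_restrict_space borel_Ioi)
  also have "\<dots> = sigma_sets {0..<1} ((\<inter>) {0..<1} ` range greaterThan)"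
  proof (rule sigma_sets_Int)
    have "{0..<1::real} \<in> sets borel" by simp
    then show "{0..<1::real} \<in> sigma_sets UNIV (range greaterThan)"
      by (simp add: borel_Ioi)
  qed simp
  also have "\<dots> \<subseteq> sigma_sets {0..<1} interval_generator"
  proof (rule sigma_sets_mono, rule subsetI)
    fix A assume "A \<in> (\<inter>) {0..<1} ` range (greaterThan :: real \<Rightarrow> _)"
    then obtain a where a: "A = {0..<1} \<inter> {a<..}" by auto
    have "A \<in> interval_generator"
    proof (cases "a < 0")
      case True
      then have "A = {0..<1}" by (auto simp: a)
      then show ?thesis by (simp add: interval_generator_def)
    next
      case False
      then have "A = {a<..<1}" by (auto simp: a)
      with False show ?thesis by (auto intro: interval_generatorI)
    qed
    then show "A \<in> sigma_sets {0..<1} interval_generator" by blast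
  qed
  finally show "sets unit_interval \<subseteq> sigma_sets {0..<1} interval_generator" .
next
  have "A \<in> sets unit_interval" if "A \<in> interval_generator" for A
    using that by (subst sets_restrict_space_iff) (auto simp: interval_generator_def)
  then have "sigma_sets (space unit_interval) interval_generator \<subseteq> sets unit_interval"
    by (intro sets.sigma_sets_subset subsetI)
  then show "sigma_sets {0..<1} interval_generator \<subseteq> sets unit_interval"
    by (simp add: space_restrict_space)
qed


subsection \<open>Density of trigonometric polynomials\<close>

lemma Lp_norm_pow_2: "Lp_norm_pow n 2 f = (\<integral>\<^sup>+x. ennreal ((norm (f x))\<^sup>2) \<partial>torus n)"
  by (simp add: Lp_norm_pow_def)

lemma Lp_norm_pow_cong: "(\<And>x. x \<in> space (torus n) \<Longrightarrow> f x = g x) \<Longrightarrow> Lp_norm_pow n p f = Lp_norm_pow n p g"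
  unfolding Lp_norm_pow_def by (intro nn_integral_cong) simp

lemma Lp_norm_pow_2_triangle:
  assumes [measurable]: "f \<in> borel_measurable (torus n)" "g \<in> borel_measurable (torus n)"
    and le: "\<And>x. x \<in> space (torus n) \<Longrightarrow> norm (h x) \<le> norm (f x) + norm (g x)"
  shows "Lp_norm_pow n 2 h \<le> 4 * (Lp_norm_pow n 2 f + Lp_norm_pow n 2 g)"
proof -
  have "Lp_norm_pow n 2 h \<le> (\<integral>\<^sup>+x. 4 * (ennreal ((norm (f x))\<^sup>2) + ennreal ((norm (g x))\<^sup>2)) \<partial>torus n)"
    unfolding Lp_norm_pow_2
  proof (rule nn_integral_mono)
    fix x assume x: "x \<in> space (torus n)"
    have "(norm (h x))\<^sup>2 \<le> (norm (f x) + norm (g x))\<^sup>2"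
      using le[OF x] by (intro power_mono) auto
    also have "\<dots> \<le> 4 * ((norm (f x))\<^sup>2 + (norm (g x))\<^sup>2)"
    proof -
      have "4 * (u\<^sup>2 + v\<^sup>2) - (u + v)\<^sup>2 = (u - v)\<^sup>2 + 2 * (u\<^sup>2 + v\<^sup>2)" for u v :: real
        by (simp add: power2_eq_square algebra_simps)
      moreover have "0 \<le> (u - v)\<^sup>2 + 2 * (u\<^sup>2 + v\<^sup>2)" for u v :: real by simp
      ultimately show ?thesis by (metis diff_ge_0_iff_ge)
    qed
    finally show "ennreal ((norm (h x))\<^sup>2) \<le> 4 * (ennreal ((norm (f x))\<^sup>2) + ennreal ((norm (g x))\<^sup>2))"
      by (simp add: ennreal_plus[symmetric] ennreal_mult'[symmetric] ennreal_leI del: ennreal_plus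
          flip: ennreal_numeral)
  qed
  also have "\<dots> = 4 * (Lp_norm_pow n 2 f + Lp_norm_pow n 2 g)"
    unfolding Lp_norm_pow_2 by (simp add: nn_integral_cmult nn_integral_add)
  finally show ?thesis .
qed

definition L2_trig_limit :: "nat \<Rightarrow> ((nat \<Rightarrow> real) \<Rightarrow> complex) \<Rightarrow> bool" where
  "L2_trig_limit n h \<longleftrightarrow> h \<in> borel_measurable (torus n) \<and>
     (\<forall>e>0. \<exists>P. trig_poly n P \<and> Lp_norm_pow n 2 (\<lambda>x. h x - P x) < ennreal e)"

lemma L2_trig_limitD: "L2_trig_limit n h \<Longrightarrow> h \<in> borel_measurable (torus n)"
  by (simp add: L2_trig_limit_def)

lemma L2_trig_limit_cong:
  assumes "\<And>x. x \<in> space (torus n) \<Longrightarrow> h x = k x"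
  shows "L2_trig_limit n h \<longleftrightarrow> L2_trig_limit n k"
proof -
  have "Lp_norm_pow n 2 (\<lambda>x. h x - P x) = Lp_norm_pow n 2 (\<lambda>x. k x - P x)" for P
    by (rule Lp_norm_pow_cong) (simp add: assms)
  moreover have "h \<in> borel_measurable (torus n) \<longleftrightarrow> k \<in> borel_measurable (torus n)"
    by (rule measurable_cong) (simp add: assms)
  ultimately show ?thesis by (simp add: L2_trig_limit_def)
qed

lemma trig_poly_measurable: "trig_poly n P \<Longrightarrow> P \<in> borel_measurable (torus n)"
  using bdd_meas_trig_poly unfolding torus_bdd_meas_def by blast

lemma L2_trig_limit_uniform:
  assumes "uniform_trig_limit n h" "h \<in> borel_measurable (torus n)"
  shows "L2_trig_limit n h"
  unfolding L2_trig_limit_def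
proof (intro conjI allI impI assms(2))
  fix e :: real assume e: "0 < e"
  define d where "d = sqrt (e / 2)"
  have d: "0 < d" "d\<^sup>2 = e / 2" using e by (auto simp: d_def)
  obtain P where P: "trig_poly n P" "\<forall>x\<in>space (torus n). norm (h x - P x) < d"
    using assms(1) d(1) unfolding uniform_trig_limit_def by blast
  have "Lp_norm_pow n 2 (\<lambda>x. h x - P x) \<le> (\<integral>\<^sup>+x. ennreal (e / 2) \<partial>torus n)"
    unfolding Lp_norm_pow_2
  proof (rule nn_integral_mono)
    fix x assume "x \<in> space (torus n)"
    then have "(norm (h x - P x))\<^sup>2 \<le> d\<^sup>2" using P by (intro power_mono) (auto intro: less_imp_le)
    then show "ennreal ((norm (h x - P x))\<^sup>2) \<le> ennreal (e / 2)" using d by (simp add: ennreal_leI)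
  qed
  also have "\<dots> = ennreal (e / 2)" by (simp add: prob_space.emeasure_space_1[OF prob_space_torus])
  also have "\<dots> < ennreal e" using e by (simp add: ennreal_less_iff)
  finally show "\<exists>P. trig_poly n P \<and> Lp_norm_pow n 2 (\<lambda>x. h x - P x) < ennreal e" using P by blast
qed

lemma ennreal_four_mult_add_less:
  "x < ennreal (e / 8) \<Longrightarrow> y < ennreal (e / 8) \<Longrightarrow> 0 < e \<Longrightarrow> 4 * (x + y) < ennreal e"
proof -
  assume *: "x < ennreal (e / 8)" "y < ennreal (e / 8)" "0 < e"
  then obtain a b where ab: "x = ennreal a" "y = ennreal b" "0 \<le> a" "0 \<le> b"
    by (metis ennreal_cases ennreal_less_top less_top order_less_trans)
  with * have "a < e / 8" "b < e / 8" by (auto simp: ennreal_less_iff)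
  then have "4 * (a + b) < e" by simp
  then have "ennreal (4 * (a + b)) < ennreal e" using ab by (subst ennreal_less_iff) auto
  moreover have "4 * (x + y) = ennreal (4 * (a + b))"
    using ab by (simp add: ennreal_mult' ennreal_plus del: distrib_left_numeral)
  ultimately show ?thesis by (simp only:)
qed

lemma L2_trig_limit_add:
  assumes h: "L2_trig_limit n h" and k: "L2_trig_limit n k"
  shows "L2_trig_limit n (\<lambda>x. h x + k x)"
  unfolding L2_trig_limit_def
proof (intro conjI allI impI)
  note [measurable] = L2_trig_limitD[OF h] L2_trig_limitD[OF k]
  show "(\<lambda>x. h x + k x) \<in> borel_measurable (torus n)" by measurable
  fix e :: real assume e: "0 < e"
  then have e8: "0 < e / 8" by simp
  obtain P where P: "trig_poly n P" "Lp_norm_pow n 2 (\<lambda>x. h x - P x) < ennreal (e / 8)"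
    using h e8 unfolding L2_trig_limit_def by blast
  obtain Q where Q: "trig_poly n Q" "Lp_norm_pow n 2 (\<lambda>x. k x - Q x) < ennreal (e / 8)"
    using k e8 unfolding L2_trig_limit_def by blast
  note [measurable] = trig_poly_measurable[OF P(1)] trig_poly_measurable[OF Q(1)]
  have "Lp_norm_pow n 2 (\<lambda>x. h x + k x - (P x + Q x))
      \<le> 4 * (Lp_norm_pow n 2 (\<lambda>x. h x - P x) + Lp_norm_pow n 2 (\<lambda>x. k x - Q x))"
    by (rule Lp_norm_pow_2_triangle, measurable, rule norm_diff_triangle_ineq)
  also have "\<dots> < ennreal e" by (rule ennreal_four_mult_add_less) (use P Q e in auto)
  finally show "\<exists>P. trig_poly n P \<and> Lp_norm_pow n 2 (\<lambda>x. h x + k x - P x) < ennreal e"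
    using trig_poly.add[OF P(1) Q(1)] by blast
qed

lemma L2_trig_limit_scale:
  assumes h: "L2_trig_limit n h"
  shows "L2_trig_limit n (\<lambda>x. c * h x)"
  unfolding L2_trig_limit_def
proof (intro conjI allI impI)
  note [measurable] = L2_trig_limitD[OF h]
  show "(\<lambda>x. c * h x) \<in> borel_measurable (torus n)" by measurable
  fix e :: real assume e: "0 < e"
  define d where "d = e / ((norm c)\<^sup>2 + 1)"
  have c: "0 < (norm c)\<^sup>2 + 1" by (metis add_nonneg_pos zero_le_power2 zero_less_one)
  have d: "0 < d" "(norm c)\<^sup>2 * d < e"
    using e c by (auto simp: d_def field_simps)
  obtain P where P: "trig_poly n P" "Lp_norm_pow n 2 (\<lambda>x. h x - P x) < ennreal d"
    using h d unfolding L2_trig_limit_def by blast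
  note [measurable] = trig_poly_measurable[OF P(1)]
  have "Lp_norm_pow n 2 (\<lambda>x. c * h x - c * P x) = ennreal ((norm c)\<^sup>2) * Lp_norm_pow n 2 (\<lambda>x. h x - P x)"
    unfolding Lp_norm_pow_2 right_diff_distrib[symmetric] norm_mult power_mult_distrib
    by (simp add: ennreal_mult' nn_integral_cmult)
  also have "\<dots> \<le> ennreal ((norm c)\<^sup>2) * ennreal d" using P by (intro mult_left_mono) auto
  also have "\<dots> < ennreal e" using d e by (simp add: ennreal_mult'[symmetric] ennreal_less_iff)
  finally show "\<exists>P. trig_poly n P \<and> Lp_norm_pow n 2 (\<lambda>x. c * h x - P x) < ennreal e"
    using trig_poly.scale[OF P(1)] by blast
qed

lemma L2_trig_limit_const: "L2_trig_limit n (\<lambda>_. c)"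
  by (rule L2_trig_limit_uniform) (simp_all add: uniform_trig_limit_trig_poly trig_poly_const)

lemma L2_trig_limit_sum:
  "(\<And>j. j \<in> J \<Longrightarrow> L2_trig_limit n (h j)) \<Longrightarrow> L2_trig_limit n (\<lambda>x. \<Sum>j\<in>J. h j x)"
  by (induction J rule: infinite_finite_induct) (simp_all add: L2_trig_limit_add L2_trig_limit_const)

text \<open>Dominated convergence turns pointwise limits under a square-integrable majorant into L2
  limits. It carries the density proof at each of its limits: from continuous functions to boxes,
  from finite to countable disjoint unions, and from simple functions to all of L2.\<close>

lemma L2_trig_limit_dominated:
  assumes k: "\<And>i. L2_trig_limit n (k i)" and [measurable]: "G \<in> borel_measurable (torus n)"
    and G: "(\<integral>\<^sup>+x. ennreal ((G x)\<^sup>2) \<partial>torus n) < \<infinity>"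
    and le: "\<And>i x. x \<in> space (torus n) \<Longrightarrow> norm (k i x) \<le> G x"
    and lim: "\<And>x. x \<in> space (torus n) \<Longrightarrow> (\<lambda>i. k i x) \<longlonglongrightarrow> h x"
  shows "L2_trig_limit n h"
  unfolding L2_trig_limit_def
proof (intro conjI allI impI)
  note [measurable] = L2_trig_limitD[OF k]
  show [measurable]: "h \<in> borel_measurable (torus n)"
    by (rule borel_measurable_LIMSEQ_metric[OF L2_trig_limitD[OF k] lim])
  fix e :: real assume e: "0 < e"
  have hG: "norm (h x) \<le> G x" if "x \<in> space (torus n)" for x
    by (rule LIMSEQ_le_const2[OF tendsto_norm[OF lim[OF that]]]) (use le that in auto)
  have "(\<lambda>i. \<integral>\<^sup>+x. ennreal ((norm (h x - k i x))\<^sup>2) \<partial>torus n) \<longlonglongrightarrow> (\<integral>\<^sup>+x. 0 \<partial>torus n)"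
  proof (rule nn_integral_dominated_convergence[where w = "\<lambda>x. 4 * ennreal ((G x)\<^sup>2)"])
    show "AE x in torus n. ennreal ((norm (h x - k i x))\<^sup>2) \<le> 4 * ennreal ((G x)\<^sup>2)" for i
    proof (rule AE_I2)
      fix x assume x: "x \<in> space (torus n)"
      have "norm (h x - k i x) \<le> 2 * G x"
        using hG[OF x] le[OF x, of i] norm_triangle_ineq4[of "h x" "k i x"] by linarith
      then have "(norm (h x - k i x))\<^sup>2 \<le> (2 * G x)\<^sup>2" by (intro power_mono) auto
      also have "\<dots> = 4 * (G x)\<^sup>2" by (simp add: power_mult_distrib)
      finally have "ennreal ((norm (h x - k i x))\<^sup>2) \<le> ennreal (4 * (G x)\<^sup>2)" by (rule ennreal_leI)
      then show "ennreal ((norm (h x - k i x))\<^sup>2) \<le> 4 * ennreal ((G x)\<^sup>2)" by (simp add: ennreal_mult')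
    qed
    show "(\<integral>\<^sup>+x. 4 * ennreal ((G x)\<^sup>2) \<partial>torus n) < \<infinity>"
      using G by (simp add: nn_integral_cmult ennreal_mult_less_top)
    show "AE x in torus n. (\<lambda>i. ennreal ((norm (h x - k i x))\<^sup>2)) \<longlonglongrightarrow> 0"
    proof (rule AE_I2)
      fix x assume "x \<in> space (torus n)"
      then have "(\<lambda>i. (norm (h x - k i x))\<^sup>2) \<longlonglongrightarrow> (norm (h x - h x))\<^sup>2"
        by (intro tendsto_intros lim)
      then show "(\<lambda>i. ennreal ((norm (h x - k i x))\<^sup>2)) \<longlonglongrightarrow> 0"
        using tendsto_ennrealI by fastforce
    qed
  qed measurable
  then have "(\<lambda>i. Lp_norm_pow n 2 (\<lambda>x. h x - k i x)) \<longlonglongrightarrow> 0" by (simp add: Lp_norm_pow_2)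
  then have "eventually (\<lambda>i. Lp_norm_pow n 2 (\<lambda>x. h x - k i x) < ennreal (e / 8)) sequentially"
    using e by (intro order_tendstoD(2)) auto
  then obtain i where i: "Lp_norm_pow n 2 (\<lambda>x. h x - k i x) < ennreal (e / 8)"
    by (meson eventually_happens trivial_limit_sequentially)
  obtain P where P: "trig_poly n P" "Lp_norm_pow n 2 (\<lambda>x. k i x - P x) < ennreal (e / 8)"
    using k[of i] e unfolding L2_trig_limit_def by (metis divide_pos_pos zero_less_numeral)
  note [measurable] = trig_poly_measurable[OF P(1)]
  have "Lp_norm_pow n 2 (\<lambda>x. h x - P x)
      \<le> 4 * (Lp_norm_pow n 2 (\<lambda>x. h x - k i x) + Lp_norm_pow n 2 (\<lambda>x. k i x - P x))"
  proof (rule Lp_norm_pow_2_triangle)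
    show "norm (h x - P x) \<le> norm (h x - k i x) + norm (k i x - P x)" for x
      using norm_triangle_ineq[of "h x - k i x" "k i x - P x"] by simp
  qed measurable
  also have "\<dots> < ennreal e" by (rule ennreal_four_mult_add_less) (use P i e in auto)
  finally show "\<exists>P. trig_poly n P \<and> Lp_norm_pow n 2 (\<lambda>x. h x - P x) < ennreal e" using P by blast
qed

lemma space_torus: "space (torus n) = Pi\<^sub>E {1..n} (\<lambda>_. {0..<1})"
  by (simp add: torus_def space_PiM space_restrict_space)

definition box_generator :: "nat \<Rightarrow> (nat \<Rightarrow> real) set set" where
  "box_generator n = {Pi\<^sub>E {1..n} A | A. \<forall>j\<in>{1..n}. A j \<in> interval_generator}"

lemma interval_generator_subset: "A \<in> interval_generator \<Longrightarrow> A \<subseteq> {0..<1}"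
  by (auto simp: interval_generator_def)

lemma sets_torus: "sets (torus n) = sigma_sets (space (torus n)) (box_generator n)"
proof -
  have gen: "interval_generator \<subseteq> Pow {0..<1}" using interval_generator_subset by blast
  \<comment> \<open>The shape of generator produced by \<open>sets_PiM_sigma\<close>, with the index
    set partitioned into the single block \<open>{1..n}\<close>.\<close>
  let ?P = "{{f \<in> Pi\<^sub>E {1..n} (\<lambda>_. {0..<1}). \<forall>i\<in>j. f i \<in> A i} | A j. j \<in> {{1..n}} \<and> A \<in> Pi j (\<lambda>_. interval_generator)}"
  have P: "?P = box_generator n"
  proof -
    have box: "{f \<in> Pi\<^sub>E {1..n} (\<lambda>_. {0..<1}). \<forall>i\<in>{1..n}. f i \<in> A i} = Pi\<^sub>E {1..n} A"
      if "\<forall>j\<in>{1..n}. A j \<in> interval_generator" for A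
    proof -
      have "\<forall>j\<in>{1..n}. A j \<subseteq> {0..<1}" using that interval_generator_subset by blast
      then show ?thesis by (intro set_eqI) (unfold mem_Collect_eq PiE_iff, blast)
    qed
    show ?thesis
    proof (intro set_eqI iffI)
      fix B assume "B \<in> ?P"
      then obtain A j where B: "B = {f \<in> Pi\<^sub>E {1..n} (\<lambda>_. {0..<1}). \<forall>i\<in>j. f i \<in> A i}"
        "j \<in> {{1..n}}" "A \<in> Pi j (\<lambda>_. interval_generator)"
        by (elim CollectE exE conjE)
      from B(2) have j: "j = {1..n}" by (rule singletonD)
      have A: "\<forall>j\<in>{1..n}. A j \<in> interval_generator" using B(3) unfolding j by (intro ballI) (rule Pi_mem)
      have "B = Pi\<^sub>E {1..n} A" unfolding B(1) j by (rule box[OF A])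
      with A show "B \<in> box_generator n" unfolding box_generator_def by (intro CollectI exI[of _ A] conjI)
    next
      fix B assume "B \<in> box_generator n"
      then obtain A where A: "B = Pi\<^sub>E {1..n} A" "\<forall>j\<in>{1..n}. A j \<in> interval_generator"
        unfolding box_generator_def by (elim CollectE exE conjE)
      show "B \<in> ?P"
      proof (intro CollectI exI[of _ A] exI[of _ "{1..n}"] conjI)
        show "B = {f \<in> Pi\<^sub>E {1..n} (\<lambda>_. {0..<1}). \<forall>i\<in>{1..n}. f i \<in> A i}"
          unfolding A(1) by (rule box[OF A(2), symmetric])
        show "A \<in> Pi {1..n} (\<lambda>_. interval_generator)" using A(2) by (intro Pi_I) (rule bspec)
      qed (rule singletonI)
    qed
  qed
  have "sets (torus n) = sets (Pi\<^sub>M {1..n} (\<lambda>_. sigma {0..<1} interval_generator))"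
    unfolding torus_def
    by (rule sets_PiM_cong) (simp_all add: sigma_sets_interval_generator sets_measure_of[OF gen])
  also have "\<dots> = sets (sigma (Pi\<^sub>E {1..n} (\<lambda>_. {0..<1})) ?P)"
  proof (rule sets_PiM_sigma)
    \<comment> \<open>The full interval covers the space by itself; this is a second reason for
      having it among the generators.\<close>
    show "\<exists>S\<subseteq>interval_generator. countable S \<and> {0..<1} = \<Union>S"
      by (rule exI[of _ "{{0..<1}}"]) (auto simp: interval_generator_def)
  qed (use gen in auto)
  also have "\<dots> = sigma_sets (space (torus n)) (box_generator n)"
  proof -
    have "box_generator n \<subseteq> Pow (Pi\<^sub>E {1..n} (\<lambda>_. {0..<1}))"
    proof
      fix B assume "B \<in> box_generator n"
      then obtain A where A: "B = Pi\<^sub>E {1..n} A" "\<forall>j\<in>{1..n}. A j \<in> interval_generator"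
        by (auto simp: box_generator_def)
      then have "\<forall>j\<in>{1..n}. A j \<subseteq> {0..<1}" using interval_generator_subset by blast
      then show "B \<in> Pow (Pi\<^sub>E {1..n} (\<lambda>_. {0..<1}))" unfolding A(1) by (auto simp: PiE_iff)
    qed
    then show ?thesis by (simp only: P sets_measure_of space_torus)
  qed
  finally show ?thesis .
qed

lemma Int_stable_box_generator: "Int_stable (box_generator n)"
proof (rule Int_stableI)
  fix A B assume "A \<in> box_generator n" "B \<in> box_generator n"
  then obtain F G where FG: "A = Pi\<^sub>E {1..n} F" "\<forall>j\<in>{1..n}. F j \<in> interval_generator"
    "B = Pi\<^sub>E {1..n} G" "\<forall>j\<in>{1..n}. G j \<in> interval_generator"
    by (auto simp: box_generator_def)
  have "A \<inter> B = Pi\<^sub>E {1..n} (\<lambda>j. F j \<inter> G j)" unfolding FG by (rule PiE_Int)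
  moreover have "\<forall>j\<in>{1..n}. F j \<inter> G j \<in> interval_generator"
    using FG Int_stable_interval_generator by (auto simp: Int_stable_def)
  ultimately show "A \<inter> B \<in> box_generator n" unfolding box_generator_def by blast
qed

lemma prod_indicator:
  assumes "finite J"
  shows "(\<Prod>j\<in>J. indicator (A j) (x j) :: 'c :: comm_semiring_1) = (if \<forall>j\<in>J. x j \<in> A j then 1 else 0)"
  using assms by (induction J) (auto simp: indicator_def)

text \<open>The indicator of a box is a product of one-dimensional indicators. Each of these is a
  pointwise limit of functions on the circle with values in [0, 1], and the products of the
  approximants are uniform limits of trigonometric polynomials bounded by 1.\<close>

lemma L2_trig_limit_box:
  assumes "B \<in> box_generator n"
  shows "L2_trig_limit n (indicator B)"
proof -
  obtain A where A: "B = Pi\<^sub>E {1..n} A" "\<forall>j\<in>{1..n}. A j \<in> interval_generator"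
    using assms by (auto simp: box_generator_def)
  have "\<forall>j\<in>{1..n}. \<exists>\<phi> :: nat \<Rightarrow> complex \<Rightarrow> real. (\<forall>m. continuous_on UNIV (\<phi> m)) \<and> (\<forall>m z. 0 \<le> \<phi> m z \<and> \<phi> m z \<le> 1) \<and>
    (\<forall>t. 0 \<le> t \<longrightarrow> t < 1 \<longrightarrow> (\<lambda>m. \<phi> m (cis (2 * pi * t))) \<longlonglongrightarrow> indicator (A j) t)"
    using A(2) by (metis interval_generator_circle_limit)
  then obtain \<phi> :: "nat \<Rightarrow> nat \<Rightarrow> complex \<Rightarrow> real" where cont: "\<And>j m. j \<in> {1..n} \<Longrightarrow> continuous_on UNIV (\<phi> j m)"
    and bound: "\<And>j m z. j \<in> {1..n} \<Longrightarrow> 0 \<le> \<phi> j m z \<and> \<phi> j m z \<le> 1"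
    and lim: "\<And>j t. j \<in> {1..n} \<Longrightarrow> 0 \<le> t \<Longrightarrow> t < 1 \<Longrightarrow> (\<lambda>m. \<phi> j m (cis (2 * pi * t))) \<longlonglongrightarrow> indicator (A j) t"
    by metis
  define k where "k m x = (\<Prod>j\<in>{1..n}. complex_of_real (\<phi> j m (cis (2 * pi * x j))))" for m and x :: "nat \<Rightarrow> real"
  show ?thesis
  proof (rule L2_trig_limit_dominated[where k = k and G = "\<lambda>_. 1"])
    show "L2_trig_limit n (k m)" for m
      unfolding k_def
    proof (rule L2_trig_limit_uniform)
      show "uniform_trig_limit n (\<lambda>x. \<Prod>j\<in>{1..n}. complex_of_real (\<phi> j m (cis (2 * pi * x j))))"
        by (intro uniform_trig_limit_prod uniform_trig_limit_circle cont)
      show "(\<lambda>x. \<Prod>j\<in>{1..n}. complex_of_real (\<phi> j m (cis (2 * pi * x j)))) \<in> borel_measurable (torus n)"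
      proof (rule borel_measurable_prod)
        fix j assume j: "j \<in> {1..n}"
        have [measurable]: "\<phi> j m \<in> borel_measurable borel" by (intro borel_measurable_continuous_onI cont j)
        have [measurable]: "cis \<in> borel_measurable borel"
          by (intro borel_measurable_continuous_onI continuous_intros)
        note [measurable] = measurable_torus_component[OF j]
        show "(\<lambda>x. complex_of_real (\<phi> j m (cis (2 * pi * x j)))) \<in> borel_measurable (torus n)" by measurable
      qed
    qed
    show "(\<integral>\<^sup>+x. ennreal (1\<^sup>2) \<partial>torus n) < \<infinity>"
      by (simp add: prob_space.emeasure_space_1[OF prob_space_torus])
    show "norm (k m x) \<le> 1" for m x
      unfolding k_def prod_norm[symmetric] using bound by (intro prod_le_1) auto
    fix x assume x: "x \<in> space (torus n)"
    have "(\<lambda>m. \<Prod>j\<in>{1..n}. complex_of_real (\<phi> j m (cis (2 * pi * x j)))) \<longlonglongrightarrow> (\<Prod>j\<in>{1..n}. complex_of_real (indicator (A j) (x j)))"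
      using space_torusD[OF x] by (intro tendsto_prod tendsto_of_real lim) auto
    also have "(\<Prod>j\<in>{1..n}. complex_of_real (indicator (A j) (x j))) = indicator B x"
    proof -
      have "x \<in> B \<longleftrightarrow> (\<forall>j\<in>{1..n}. x j \<in> A j)"
        using x unfolding A(1) space_torus by (auto simp: PiE_iff)
      then show ?thesis by (simp add: of_real_indicator prod_indicator indicator_def)
    qed
    finally show "(\<lambda>m. k m x) \<longlonglongrightarrow> indicator B x" by (simp add: k_def)
  qed simp
qed

text \<open>A pi-lambda argument: boxes form an intersection-stable generator, complements use
  linearity, and a disjoint union is the limit of finite sums of indicators, all bounded by
  1.\<close>

lemma L2_trig_limit_indicator:
  assumes "A \<in> sets (torus n)"
  shows "L2_trig_limit n (indicator A)"
proof -
  have sub: "box_generator n \<subseteq> Pow (space (torus n))"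
    using sets.sets_into_space[of _ "torus n"] unfolding sets_torus by blast
  have "A \<in> sigma_sets (space (torus n)) (box_generator n)" using assms by (simp add: sets_torus)
  from Int_stable_box_generator sub this show ?thesis
  proof (induction rule: sigma_sets_induct_disjoint)
    case (basic B)
    then show ?case by (rule L2_trig_limit_box)
  next
    case empty
    show ?case using L2_trig_limit_const[of n 0] by (simp add: indicator_def[abs_def])
  next
    case (compl B)
    have "L2_trig_limit n (\<lambda>x. 1 + (- 1) * indicator B x)"
      by (intro L2_trig_limit_add L2_trig_limit_scale L2_trig_limit_const compl)
    also have "?this \<longleftrightarrow> ?case" by (rule L2_trig_limit_cong) (auto simp: indicator_def)
    finally show ?case .
  next
    case (union B)
    show ?case
    proof (rule L2_trig_limit_dominated[where k = "\<lambda>m. indicator (\<Union>i<m. B i)" and G = "\<lambda>_. 1"])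
      show "L2_trig_limit n (indicator (\<Union>i<m. B i))" for m
      proof -
        have "L2_trig_limit n (\<lambda>x. \<Sum>i<m. indicator (B i) x)" by (intro L2_trig_limit_sum union)
        moreover have "(\<Sum>i<m. indicator (B i) x) = (indicator (\<Union>i<m. B i) x :: complex)" for x
          by (rule indicator_UN_disjoint[symmetric]) (use union(1) in \<open>auto simp: disjoint_family_on_def\<close>)
        ultimately show ?thesis by (simp add: fun_eq_iff[symmetric])
      qed
      show "(\<integral>\<^sup>+x. ennreal (1\<^sup>2) \<partial>torus n) < \<infinity>"
        by (simp add: prob_space.emeasure_space_1[OF prob_space_torus])
      show "norm (indicator (\<Union>i<m. B i) x :: complex) \<le> 1" for m x by (simp add: indicator_def)
    qed (simp_all add: LIMSEQ_indicator_UN)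
  qed
qed

lemma L2_trig_limit_all:
  assumes [measurable]: "h \<in> borel_measurable (torus n)" and fin: "Lp_norm_pow n 2 h < \<infinity>"
  shows "L2_trig_limit n h"
proof -
  obtain s where s: "\<forall>i. simple_function (torus n) (s i)" "\<forall>x\<in>space (torus n). (\<lambda>i. s i x) \<longlonglongrightarrow> h x"
    "\<forall>i. \<forall>x\<in>space (torus n). dist (s i x) 0 \<le> 2 * dist (h x) 0"
    using borel_measurable_implies_sequence_metric[OF assms(1), of 0] by blast
  show ?thesis
  proof (rule L2_trig_limit_dominated[where k = s and G = "\<lambda>x. 2 * norm (h x)"])
    show "L2_trig_limit n (s i)" for i
    proof -
      let ?A = "\<lambda>y. s i -` {y} \<inter> space (torus n)"
      have "L2_trig_limit n (\<lambda>x. \<Sum>y\<in>s i ` space (torus n). y * indicator (?A y) x)"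
        by (intro L2_trig_limit_sum L2_trig_limit_scale L2_trig_limit_indicator simple_functionD(2) s(1)[rule_format])
      also have "?this \<longleftrightarrow> L2_trig_limit n (s i)"
      proof (rule L2_trig_limit_cong)
        fix x assume "x \<in> space (torus n)"
        from simple_function_indicator_representation_banach[OF s(1)[rule_format] this, of i]
        have "s i x = (\<Sum>y\<in>s i ` space (torus n). indicator (?A y) x *\<^sub>R y)" .
        also have "\<dots> = (\<Sum>y\<in>s i ` space (torus n). y * indicator (?A y) x)"
          by (intro sum.cong refl) (simp add: indicator_def)
        finally show "(\<Sum>y\<in>s i ` space (torus n). y * indicator (?A y) x) = s i x" by (rule sym)
      qed
      finally show ?thesis .
    qed
    have "(\<integral>\<^sup>+x. ennreal ((2 * norm (h x))\<^sup>2) \<partial>torus n) = 4 * Lp_norm_pow n 2 h"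
      unfolding Lp_norm_pow_2 by (simp add: power_mult_distrib ennreal_mult' nn_integral_cmult)
    then show "(\<integral>\<^sup>+x. ennreal ((2 * norm (h x))\<^sup>2) \<partial>torus n) < \<infinity>"
      using fin by (simp add: ennreal_mult_less_top)
    show "(\<lambda>x. 2 * norm (h x)) \<in> borel_measurable (torus n)" by measurable
    show "norm (s i x) \<le> 2 * norm (h x)" if "x \<in> space (torus n)" for i x
      using s(3)[rule_format, OF that, of i] by (simp add: dist_norm)
  qed (rule s(2)[rule_format])
qed


subsection \<open>Fourier sums as conditional averages\<close>

lemmas torus_in_Lp_def = finite_product_prob_space.in_Lp_def[OF torus_locale, folded torus_def]
lemmas torus_in_LpD = finite_product_prob_space.in_LpD[OF torus_locale, folded torus_def]
lemmas torus_in_Lp_triangle = finite_product_prob_space.in_Lp_triangle[OF torus_locale, folded torus_def]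
lemmas torus_in_Lp_integrable = finite_product_prob_space.in_Lp_integrable[OF torus_locale, folded torus_def]
lemmas torus_in_Lp_bdd_meas = finite_product_prob_space.in_Lp_bdd_meas[OF torus_locale]
lemmas torus_in_Lp_avg = finite_product_prob_space.in_Lp_cond_avg[OF torus_locale]
lemmas torus_avg_def = finite_product_prob_space.cond_avg_def[OF torus_locale, folded torus_def]
lemmas torus_mix_def = finite_product_prob_space.mix_def[OF torus_locale]
lemmas torus_avg_mix = finite_product_prob_space.cond_avg_mix[OF torus_locale]
lemmas torus_integral_mult_avg = finite_product_prob_space.integral_mult_cond_avg[OF torus_locale, folded torus_def]

lemma Lp_norm_pow_eq_pmoment: "torus_in_Lp n p f \<Longrightarrow> Lp_norm_pow n p f = ennreal (torus_pmoment n p f)"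
  unfolding Lp_norm_pow_def
  by (rule finite_product_prob_space.nn_integral_norm_powr[OF torus_locale, folded torus_def])

lemma Lp_iff_torus_in_Lp: "f \<in> Lp n p \<longleftrightarrow> torus_in_Lp n p f"
proof
  assume "f \<in> Lp n p"
  then have [measurable]: "f \<in> borel_measurable (torus n)" and fin: "Lp_norm_pow n p f < \<infinity>"
    by (auto simp: Lp_def)
  have "integrable (torus n) (\<lambda>x. norm (f x) powr p)"
  proof (rule integrableI_bounded)
    show "(\<integral>\<^sup>+x. ennreal (norm (norm (f x) powr p)) \<partial>torus n) < \<infinity>"
      using fin by (simp add: Lp_norm_pow_def)
  qed measurable
  then show "torus_in_Lp n p f" by (simp only: torus_in_Lp_def \<open>f \<in> borel_measurable (torus n)\<close>)
next
  assume "torus_in_Lp n p f"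
  then show "f \<in> Lp n p" by (simp add: Lp_def torus_in_LpD Lp_norm_pow_eq_pmoment)
qed

lemma torus_in_Lp_2:
  assumes f: "torus_in_Lp n p f" and p: "2 \<le> p"
  shows "torus_in_Lp n 2 f"
  unfolding torus_in_Lp_def
proof (intro conjI torus_in_LpD(1)[OF f])
  note [measurable] = torus_in_LpD(1)[OF f]
  show "integrable (torus n) (\<lambda>x. norm (f x) powr 2)"
  proof (rule Bochner_Integration.integrable_bound)
    show "integrable (torus n) (\<lambda>x. 1 + norm (f x) powr p)"
      using torus_in_LpD(2)[OF f] prob_space.finite_measure[OF prob_space_torus, of n]
      by (simp add: finite_measure.integrable_const)
    have "norm (f x) powr 2 \<le> 1 + norm (f x) powr p" for x
    proof (cases "norm (f x) \<le> 1")
      case True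
      then have "norm (f x) powr 2 \<le> 1 powr 2" by (intro powr_mono2) auto
      then show ?thesis by (simp add: add_increasing2)
    next
      case False
      then have "norm (f x) powr 2 \<le> norm (f x) powr p" using p by (intro powr_mono) auto
      then show ?thesis by simp
    qed
    then show "AE x in torus n. norm (norm (f x) powr 2) \<le> norm (1 + norm (f x) powr p)"
      by (intro AE_I2) simp
  qed measurable
qed

section \<open>Orthogonality of characters and best approximation\<close>

lemma integral_cis_unit_interval:
  "(\<integral>t. cis (2 * pi * (real_of_int k * t)) \<partial>unit_interval) = (if k = 0 then 1 else 0)"
proof (cases "k = 0")
  case True
  then show ?thesis by (simp add: measure_restrict_space space_restrict_space)
next
  case False
  define c where "c = \<i> * complex_of_real (2 * pi * k)"
  have c: "c \<noteq> 0" using False by (simp add: c_def)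
  have cis: "cis (2 * pi * (real_of_int k * t)) = exp (c * complex_of_real t)" for t
    by (simp add: c_def cis_conv_exp mult_ac)
  have "(\<integral>t. exp (c * complex_of_real t) \<partial>unit_interval)
      = (\<integral>t. indicator {0..<1} t *\<^sub>R exp (c * complex_of_real t) \<partial>lborel)"
    by (rule integral_restrict_space) simp
  also have "\<dots> = (\<integral>t. indicator {0..1} t *\<^sub>R exp (c * complex_of_real t) \<partial>lborel)"
  proof (rule integral_cong_AE)
    have "AE t in lborel. t \<noteq> (1::real)" by (rule AE_lborel_singleton)
    then show "AE t in lborel. indicator {0..<1::real} t *\<^sub>R exp (c * complex_of_real t)
        = indicator {0..1} t *\<^sub>R exp (c * complex_of_real t)"
      by eventually_elim (auto simp: indicator_def)
  qed measurable
  also have "\<dots> = exp (c * complex_of_real 1) / c - exp (c * complex_of_real 0) / c"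
  proof (rule integral_FTC_atLeastAtMost)
    show "((\<lambda>t. exp (c * complex_of_real t) / c) has_vector_derivative exp (c * complex_of_real t)) (at t within {0..1})" for t
      by (rule has_vector_derivative_real_field) (use c in \<open>auto intro!: derivative_eq_intros\<close>)
  qed (auto intro!: continuous_intros)
  also have "exp (c * complex_of_real 1) = 1"
    using cis[of 1] cis_multiple_2pi[of k] by (simp add: mult.commute mult.left_commute)
  finally show ?thesis using False by (simp add: cis)
qed

lemma cis_sum: "finite J \<Longrightarrow> cis (\<Sum>j\<in>J. f j) = (\<Prod>j\<in>J. cis (f j))"
  by (induction J rule: finite_induct) (simp_all add: cis_mult[symmetric])

lemma integral_character:
  assumes "g \<in> int_lattice {1..n}"
  shows "(\<integral>x. character n g x \<partial>torus n) = (if g = (\<lambda>_. 0) then 1 else 0)"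
proof -
  interpret finite_product_prob_space "\<lambda>_. unit_interval" "{1..n}" by (rule torus_locale)
  have "character n g x = (\<Prod>j\<in>{1..n}. cis (2 * pi * (real_of_int (g j) * x j)))" for x
    by (simp add: character_eq_cis cis_sum[symmetric] sum_distrib_left mult_ac)
  then have "(\<integral>x. character n g x \<partial>torus n)
      = (\<integral>x. (\<Prod>j\<in>{1..n}. cis (2 * pi * (real_of_int (g j) * x j))) \<partial>Pi\<^sub>M {1..n} (\<lambda>_. unit_interval))"
    by (simp add: torus_def)
  also have "\<dots> = (\<Prod>j\<in>{1..n}. \<integral>t. cis (2 * pi * (real_of_int (g j) * t)) \<partial>unit_interval)"
  proof (rule product_integral_prod)
    fix j
    have [measurable]: "cis \<in> borel_measurable borel"
      by (intro borel_measurable_continuous_onI continuous_intros)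
    have "(\<lambda>t. cis (2 * pi * (real_of_int (g j) * t))) \<in> borel_measurable unit_interval"
      by (rule measurable_restrict_space1) simp
    then show "integrable unit_interval (\<lambda>t. cis (2 * pi * (real_of_int (g j) * t)))"
      by (intro M.integrable_const_bound[where B = 1]) simp_all
  qed simp
  also have "\<dots> = (\<Prod>j\<in>{1..n}. if g j = 0 then 1 else 0)"
    by (simp only: integral_cis_unit_interval)
  also have "\<dots> = (if \<forall>j\<in>{1..n}. g j = 0 then 1 else 0)"
  proof (cases "\<forall>j\<in>{1..n}. g j = 0")
    case False
    then have "(\<Prod>j\<in>{1..n}. if g j = 0 then 1 else 0 :: complex) = 0" by (intro prod_zero) auto
    with False show ?thesis by simp
  qed simp
  also have "(\<forall>j\<in>{1..n}. g j = 0) \<longleftrightarrow> g = (\<lambda>_. 0)"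
    using assms by (auto simp: int_lattice_def fun_eq_iff)
  finally show ?thesis .
qed

lemma borel_measurable_cnj [measurable]:
  "f \<in> borel_measurable M \<Longrightarrow> (\<lambda>x. cnj (f x)) \<in> borel_measurable M"
  by (rule measurable_compose[where N = borel])
    (auto intro!: borel_measurable_continuous_onI continuous_intros)

lemma integrable_mult_character:
  fixes h :: "(nat \<Rightarrow> real) \<Rightarrow> complex"
  assumes [measurable]: "integrable (torus n) h"
  shows "integrable (torus n) (\<lambda>x. h x * character n g x)"
    and "integrable (torus n) (\<lambda>x. h x * cnj (character n g x))"
  by (rule Bochner_Integration.integrable_bound[OF assms], measurable, simp add: norm_mult)+

lemma integrable_character: "integrable (torus n) (character n g)"
  by (intro prob_space.finite_measure[OF prob_space_torus] finite_measure.integrable_const_bound[where B = 1])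
    simp_all

lemma fourier_coeff_diff_sum:
  assumes h: "integrable (torus n) h" and F: "finite F" "F \<subseteq> int_lattice {1..n}" and g: "g \<in> F"
  shows "fourier_coeff n (\<lambda>x. h x - (\<Sum>k\<in>F. fourier_coeff n h k * character n k x)) g = 0"
proof -
  let ?c = "fourier_coeff n h"
  have orth: "(\<integral>x. character n k x * cnj (character n g x) \<partial>torus n) = (if k = g then 1 else 0)" if "k \<in> F" for k
  proof -
    have "k \<in> int_lattice {1..n}" "g \<in> int_lattice {1..n}" using that g F by blast+
    then have "(\<lambda>j. k j - g j) \<in> int_lattice {1..n}" by (simp add: int_lattice_def)
    moreover have "(\<lambda>j. k j - g j) = (\<lambda>_. 0) \<longleftrightarrow> k = g" by (auto simp: fun_eq_iff)
    ultimately show ?thesis by (simp add: character_mult_cnj integral_character)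
  qed
  have "fourier_coeff n (\<lambda>x. h x - (\<Sum>k\<in>F. ?c k * character n k x)) g
      = (\<integral>x. h x * cnj (character n g x) - (\<Sum>k\<in>F. ?c k * (character n k x * cnj (character n g x))) \<partial>torus n)"
    by (simp add: fourier_coeff_def left_diff_distrib sum_distrib_right mult.assoc)
  also have "\<dots> = ?c g - (\<Sum>k\<in>F. ?c k * (\<integral>x. character n k x * cnj (character n g x) \<partial>torus n))"
  proof (subst Bochner_Integration.integral_diff)
    show "integrable (torus n) (\<lambda>x. h x * cnj (character n g x))" by (rule integrable_mult_character[OF h])
    have i: "integrable (torus n) (\<lambda>x. ?c k * (character n k x * cnj (character n g x)))" for k
      by (intro integrable_mult_right integrable_mult_character integrable_character)
    then show "integrable (torus n) (\<lambda>x. \<Sum>k\<in>F. ?c k * (character n k x * cnj (character n g x)))" by simp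
    show "(\<integral>x. h x * cnj (character n g x) \<partial>torus n) - (\<integral>x. (\<Sum>k\<in>F. ?c k * (character n k x * cnj (character n g x))) \<partial>torus n)
      = ?c g - (\<Sum>k\<in>F. ?c k * (\<integral>x. character n k x * cnj (character n g x) \<partial>torus n))"
      using i by (subst Bochner_Integration.integral_sum) (auto simp: fourier_coeff_def)
  qed
  also have "(\<Sum>k\<in>F. ?c k * (\<integral>x. character n k x * cnj (character n g x) \<partial>torus n)) = (\<Sum>k\<in>F. if k = g then ?c g else 0)"
    by (rule sum.cong) (auto simp: orth)
  finally show ?thesis using F g by simp
qed

text \<open>The residual \<open>r\<close> has vanishing coefficients on \<open>F\<close>, and the
  error of the competitor is \<open>r + s\<close> with \<open>s\<close> a polynomial with
  frequencies in \<open>F\<close>. Orthogonality of \<open>r\<close> and \<open>s\<close> gives |r +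
  s|^2 \<ge> |r|^2 after integration.\<close>

lemma fourier_partial_sum_best_approx:
  assumes h: "torus_in_Lp n 2 h" and F: "finite F" "F \<subseteq> int_lattice {1..n}" and G: "G \<subseteq> F"
  shows "Lp_norm_pow n 2 (\<lambda>x. h x - (\<Sum>g\<in>F. fourier_coeff n h g * character n g x))
    \<le> Lp_norm_pow n 2 (\<lambda>x. h x - (\<Sum>g\<in>G. c g * character n g x))"
proof -
  note [measurable] = torus_in_LpD(1)[OF h]
  note hi = torus_in_Lp_integrable[OF one_le_numeral h]
  define c' where "c' g = (if g \<in> G then c g else 0)" for g
  define r where "r x = h x - (\<Sum>g\<in>F. fourier_coeff n h g * character n g x)" for x
  define d where "d g = fourier_coeff n h g - c' g" for g
  define s where "s x = (\<Sum>g\<in>F. d g * character n g x)" for x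
  have Gsum: "(\<Sum>g\<in>G. c g * character n g x) = (\<Sum>g\<in>F. c' g * character n g x)" for x
    using F G by (intro sum.mono_neutral_cong_left) (auto simp: c'_def)
  have rs: "h x - (\<Sum>g\<in>G. c g * character n g x) = r x + s x" for x
    unfolding Gsum r_def s_def d_def by (simp add: left_diff_distrib sum_subtractf)
  have trig: "torus_in_Lp n 2 (\<lambda>x. \<Sum>g\<in>F. d g * character n g x)" for d
  proof -
    have "torus_bdd_meas n (\<lambda>x. \<Sum>g\<in>F. d g * character n g x)"
    proof (rule torus_bdd_measI)
      show "norm (\<Sum>g\<in>F. d g * character n g x) \<le> (\<Sum>g\<in>F. norm (d g))" for x
        by (rule order_trans[OF norm_sum]) (simp add: norm_mult)
    qed measurable
    then show ?thesis by (rule torus_in_Lp_bdd_meas) simp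
  qed
  have r: "torus_in_Lp n 2 r"
    by (rule torus_in_Lp_triangle[OF one_le_numeral h trig])
      (unfold r_def, measurable, rule AE_I2, rule norm_triangle_ineq4)
  have rsL: "torus_in_Lp n 2 (\<lambda>x. r x + s x)"
    by (rule torus_in_Lp_triangle[OF one_le_numeral r trig])
      (unfold r_def s_def, measurable, rule AE_I2, rule norm_triangle_ineq)
  note ri = torus_in_Lp_integrable[OF one_le_numeral r]
  have i: "integrable (torus n) (\<lambda>x. cnj (d g) * (r x * cnj (character n g x)))" for g
    by (intro integrable_mult_right integrable_mult_character ri)
  have expand: "(\<lambda>x. r x * cnj (s x)) = (\<lambda>x. \<Sum>g\<in>F. cnj (d g) * (r x * cnj (character n g x)))"
    by (auto simp: s_def sum_distrib_left mult_ac fun_eq_iff)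
  have rsi: "integrable (torus n) (\<lambda>x. r x * cnj (s x))"
    unfolding expand by (rule Bochner_Integration.integrable_sum) (rule i)
  have "(\<integral>x. r x * cnj (s x) \<partial>torus n) = (\<Sum>g\<in>F. \<integral>x. cnj (d g) * (r x * cnj (character n g x)) \<partial>torus n)"
    unfolding expand by (rule Bochner_Integration.integral_sum) (rule i)
  also have "\<dots> = (\<Sum>g\<in>F. cnj (d g) * fourier_coeff n r g)"
    by (simp add: fourier_coeff_def)
  also have "\<dots> = 0"
    unfolding r_def using fourier_coeff_diff_sum[OF hi F] by simp
  finally have rs0: "(\<integral>x. r x * cnj (s x) \<partial>torus n) = 0" .
  have i1: "integrable (torus n) (\<lambda>x. (norm (r x))\<^sup>2)" "integrable (torus n) (\<lambda>x. (norm (r x + s x))\<^sup>2)"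
    using torus_in_LpD(2)[OF r] torus_in_LpD(2)[OF rsL] by simp_all
  have Rei: "integrable (torus n) (\<lambda>x. Re (r x * cnj (s x)))" by (rule integrable_Re[OF rsi])
  have Re0: "(\<integral>x. Re (r x * cnj (s x)) \<partial>torus n) = 0" using rsi rs0 by (subst integral_Re) simp_all
  have "(\<integral>x. (norm (r x))\<^sup>2 \<partial>torus n) \<le> (\<integral>x. (norm (r x + s x))\<^sup>2 - 2 * Re (r x * cnj (s x)) \<partial>torus n)"
  proof (rule integral_mono[OF i1(1)])
    show "integrable (torus n) (\<lambda>x. (norm (r x + s x))\<^sup>2 - 2 * Re (r x * cnj (s x)))"
      by (intro Bochner_Integration.integrable_diff integrable_mult_right i1 Rei)
    fix x
    have "(norm (r x + s x))\<^sup>2 = (norm (r x))\<^sup>2 + 2 * Re (r x * cnj (s x)) + (norm (s x))\<^sup>2"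
      unfolding cmod_power2 by (simp add: power2_eq_square algebra_simps)
    then show "(norm (r x))\<^sup>2 \<le> (norm (r x + s x))\<^sup>2 - 2 * Re (r x * cnj (s x))" by simp
  qed
  also have "\<dots> = (\<integral>x. (norm (r x + s x))\<^sup>2 \<partial>torus n) - 2 * (\<integral>x. Re (r x * cnj (s x)) \<partial>torus n)"
    by (subst Bochner_Integration.integral_diff) (intro i1 integrable_mult_right Rei, intro integrable_mult_right Rei, simp only: integral_mult_right_zero)
  finally have le: "(\<integral>x. (norm (r x))\<^sup>2 \<partial>torus n) \<le> (\<integral>x. (norm (r x + s x))\<^sup>2 \<partial>torus n)"
    unfolding Re0 by simp
  show ?thesis
    unfolding rs Lp_norm_pow_2 r_def[symmetric]
    using i1 le by (simp add: nn_integral_eq_integral ennreal_leI)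
qed

section \<open>Recognising a Fourier sum by its coefficients\<close>

lemma ennreal_pos_obtain:
  fixes a :: ennreal
  assumes "0 < a"
  obtains e :: real where "0 < e" "ennreal e \<le> a"
proof (cases a)
  case (real r)
  then show ?thesis using assms that by (metis ennreal_0 less_irrefl order_less_le order_refl)
next
  case top
  then show ?thesis using that[of 1] by simp
qed

text \<open>Density provides a polynomial \<open>P\<close> close to \<open>h\<close>, with
  frequencies in a finite set \<open>F\<close>. A partial sum over any finite \<open>Y\<close>
  between \<open>F \<inter> A\<close> and \<open>A\<close> is at least as close as \<open>P\<close>,
  by best approximation. That this holds for all such \<open>Y\<close> at once is exactly
  unconditional convergence.\<close>

lemma is_fourier_sumI:
  assumes h: "torus_in_Lp n 2 h" and A: "A \<subseteq> int_lattice {1..n}"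
    and on: "\<And>g. g \<in> A \<Longrightarrow> fourier_coeff n h g = fourier_coeff n f g"
    and off: "\<And>g. g \<in> int_lattice {1..n} - A \<Longrightarrow> fourier_coeff n h g = 0"
  shows "is_fourier_sum n f A h"
  unfolding is_fourier_sum_def
proof (intro conjI torus_in_LpD(1)[OF h] order_tendstoI)
  fix a :: ennreal assume "0 < a"
  then obtain e where e: "0 < e" "ennreal e \<le> a" by (rule ennreal_pos_obtain)
  have "L2_trig_limit n h"
    using torus_in_LpD(1)[OF h] Lp_norm_pow_eq_pmoment[OF h] by (intro L2_trig_limit_all) simp_all
  then obtain P where P: "trig_poly n P" "Lp_norm_pow n 2 (\<lambda>x. h x - P x) < ennreal e"
    using e(1) unfolding L2_trig_limit_def by blast
  obtain F c where F: "finite F" "F \<subseteq> int_lattice {1..n}" "\<And>x. P x = (\<Sum>g\<in>F. c g * character n g x)"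
    using trig_poly_expansion[OF P(1)] by blast
  have "Lp_norm_pow n 2 (\<lambda>x. h x - (\<Sum>g\<in>Y. fourier_coeff n f g * character n g x)) < a"
    if Y: "finite Y" "F \<inter> A \<subseteq> Y" "Y \<subseteq> A" for Y
  proof -
    \<comment> \<open>\<open>F\<close> may contain frequencies outside \<open>A\<close>, but there
      the coefficients of \<open>h\<close> vanish, so enlarging \<open>Y\<close> by \<open>F\<close>
      does not change the partial sum.\<close>
    have "(\<Sum>g\<in>Y. fourier_coeff n f g * character n g x) = (\<Sum>g\<in>F \<union> Y. fourier_coeff n h g * character n g x)" for x
    proof (rule sum.mono_neutral_cong_left)
      show "\<forall>g\<in>F \<union> Y - Y. fourier_coeff n h g * character n g x = 0"
      proof
        fix g assume "g \<in> F \<union> Y - Y"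
        then have "g \<in> int_lattice {1..n} - A" using F Y by blast
        then show "fourier_coeff n h g * character n g x = 0" using off by simp
      qed
    qed (use Y F on in auto)
    then have "Lp_norm_pow n 2 (\<lambda>x. h x - (\<Sum>g\<in>Y. fourier_coeff n f g * character n g x))
        \<le> Lp_norm_pow n 2 (\<lambda>x. h x - P x)"
      unfolding F(3) using fourier_partial_sum_best_approx[OF h, of "F \<union> Y" F c] Y F A by auto
    also have "\<dots> < a" using P(2) e(2) by (rule order.strict_trans2)
    finally show ?thesis .
  qed
  then show "eventually (\<lambda>Y. Lp_norm_pow n 2 (\<lambda>x. h x - (\<Sum>g\<in>Y. fourier_coeff n f g * character n g x)) < a)
      (finite_subsets_at_top A)"
    unfolding eventually_finite_subsets_at_top using F by (intro exI[of _ "F \<inter> A"]) auto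
qed simp

lemma is_fourier_sum_unique:
  assumes h: "is_fourier_sum n f A h" and k: "is_fourier_sum n f A k"
  shows "AE x in torus n. h x = k x"
proof -
  note [measurable] = h[unfolded is_fourier_sum_def, THEN conjunct1] k[unfolded is_fourier_sum_def, THEN conjunct1]
  let ?S = "\<lambda>F x. \<Sum>g\<in>F. fourier_coeff n f g * character n g x"
  have "((\<lambda>F. 4 * (Lp_norm_pow n 2 (\<lambda>x. h x - ?S F x) + Lp_norm_pow n 2 (\<lambda>x. k x - ?S F x))) \<longlongrightarrow> 4 * (0 + 0))
      (finite_subsets_at_top A)"
    using h k unfolding is_fourier_sum_def by (intro ennreal_tendsto_cmult tendsto_add) auto
  moreover have "Lp_norm_pow n 2 (\<lambda>x. h x - k x)
      \<le> 4 * (Lp_norm_pow n 2 (\<lambda>x. h x - ?S F x) + Lp_norm_pow n 2 (\<lambda>x. k x - ?S F x))" for F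
  proof (rule Lp_norm_pow_2_triangle)
    fix x show "norm (h x - k x) \<le> norm (h x - ?S F x) + norm (k x - ?S F x)"
      using norm_triangle_ineq4[of "h x - ?S F x" "k x - ?S F x"] by simp
  qed measurable
  ultimately have "Lp_norm_pow n 2 (\<lambda>x. h x - k x) \<le> 4 * (0 + 0)"
    by (intro tendsto_lowerbound[OF _ always_eventually]) auto
  then have "(\<integral>\<^sup>+x. ennreal ((norm (h x - k x))\<^sup>2) \<partial>torus n) = 0" by (simp add: Lp_norm_pow_2)
  then show ?thesis by (subst (asm) nn_integral_0_iff_AE) (auto elim!: eventually_mono)
qed

text \<open>\<open>fourier_sum\<close> is picked by \<open>SOME\<close>; by almost-everywhere
  uniqueness any explicit witness has the same norm, so the chosen function never has to be
  known.\<close>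

lemma Lp_norm_pow_fourier_sum:
  assumes "is_fourier_sum n f A h"
  shows "Lp_norm_pow n p (fourier_sum n f A) = Lp_norm_pow n p h"
proof -
  have "is_fourier_sum n f A (fourier_sum n f A)"
    unfolding fourier_sum_def by (rule someI[where P = "is_fourier_sum n f A"]) (rule assms)
  from is_fourier_sum_unique[OF this assms] show ?thesis
    unfolding Lp_norm_pow_def by (intro nn_integral_cong_AE) (auto elim!: eventually_mono)
qed

lemma torus_mix_apply: "j \<in> {1..n} \<Longrightarrow> torus_mix n S x y j = (if j \<in> S then x j else y j)"
  unfolding torus_mix_def by (rule restrict_apply')

lemma character_mix:
  assumes "S \<subseteq> {1..n}"
  shows "g \<in> int_lattice S \<Longrightarrow> character n g (torus_mix n S x y) = character n g x"
    and "(\<And>j. j \<in> S \<Longrightarrow> g j = 0) \<Longrightarrow> character n g (torus_mix n S x y) = character n g y"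
proof -
  assume g: "g \<in> int_lattice S"
  have "(\<Sum>j=1..n. torus_mix n S x y j * real_of_int (g j)) = (\<Sum>j=1..n. x j * real_of_int (g j))"
    by (rule sum.cong[OF refl]) (use g in \<open>simp add: torus_mix_apply int_lattice_def del: One_nat_def\<close>)
  then show "character n g (torus_mix n S x y) = character n g x" by (simp only: character_eq_cis)
next
  assume g: "\<And>j. j \<in> S \<Longrightarrow> g j = 0"
  have "(\<Sum>j=1..n. torus_mix n S x y j * real_of_int (g j)) = (\<Sum>j=1..n. y j * real_of_int (g j))"
    by (rule sum.cong[OF refl]) (use g in \<open>simp add: torus_mix_apply del: One_nat_def\<close>)
  then show "character n g (torus_mix n S x y) = character n g y" by (simp only: character_eq_cis)
qed

lemma fourier_coeff_torus_avg:
  assumes h: "torus_in_Lp n 2 h" and S: "S \<subseteq> {1..n}" and g: "g \<in> int_lattice {1..n}"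
  shows "fourier_coeff n (torus_avg n S h) g = (if g \<in> int_lattice S then fourier_coeff n h g else 0)"
proof (cases "g \<in> int_lattice S")
  case True
  have hi: "integrable (torus n) h" by (rule torus_in_Lp_integrable[OF one_le_numeral h])
  have "(\<integral>x. cnj (character n g x) * h x \<partial>torus n) = (\<integral>x. cnj (character n g x) * torus_avg n S h x \<partial>torus n)"
  proof (rule torus_integral_mult_avg)
    show "integrable (torus n) (\<lambda>x. cnj (character n g x) * h x)"
      using integrable_mult_character(2)[OF hi] by (simp add: mult.commute)
  qed (simp only: character_mix(1)[OF S True])
  with True show ?thesis by (simp add: fourier_coeff_def mult.commute)
next
  case False
  define g1 where "g1 j = (if j \<in> S then g j else 0)" for j
  define g2 where "g2 j = (if j \<in> S then 0 else g j)" for j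
  have split: "character n g x = character n g1 x * character n g2 x" for x
    unfolding character_add[symmetric] by (rule arg_cong[where f = "\<lambda>g. character n g x"]) (auto simp: g1_def g2_def)
  have g1: "g1 \<in> int_lattice S" by (auto simp: g1_def int_lattice_def)
  have g2: "g2 \<in> int_lattice {1..n}" using g by (auto simp: g2_def int_lattice_def)
  have g20: "g2 \<noteq> (\<lambda>_. 0)" using False by (auto simp: g2_def int_lattice_def fun_eq_iff split: if_splits)
  have ai: "integrable (torus n) (torus_avg n S h)"
    by (rule torus_in_Lp_integrable[OF one_le_numeral torus_in_Lp_avg[OF h one_le_numeral]])
  have avg0: "torus_avg n S (\<lambda>x. cnj (character n g2 x)) x = 0" for x
  proof -
    have "character n g2 (torus_mix n S x y) = character n g2 y" for y
      by (rule character_mix(2)[OF S]) (simp add: g2_def)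
    then have "torus_avg n S (\<lambda>x. cnj (character n g2 x)) x = (\<integral>y. cnj (character n g2 y) \<partial>torus n)"
      unfolding torus_avg_def by (simp only:)
    also have "\<dots> = cnj (\<integral>y. character n g2 y \<partial>torus n)" by simp
    finally show ?thesis using integral_character[OF g2] g20 by simp
  qed
  have "fourier_coeff n (torus_avg n S h) g
      = (\<integral>x. (torus_avg n S h x * cnj (character n g1 x)) * cnj (character n g2 x) \<partial>torus n)"
    by (simp add: fourier_coeff_def split mult.assoc)
  also have "\<dots> = (\<integral>x. (torus_avg n S h x * cnj (character n g1 x)) * torus_avg n S (\<lambda>x. cnj (character n g2 x)) x \<partial>torus n)"
    by (rule torus_integral_mult_avg)
      (intro integrable_mult_character ai, simp only: character_mix(1)[OF S g1] torus_avg_mix[OF order_refl])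
  also have "\<dots> = 0" unfolding avg0 by simp
  finally show ?thesis using False by simp
qed

lemma is_fourier_sum_torus_avg:
  assumes f: "torus_in_Lp n 2 f" and S: "S \<subseteq> {1..n}"
  shows "is_fourier_sum n f (int_lattice S) (torus_avg n S f)"
proof (rule is_fourier_sumI)
  show "torus_in_Lp n 2 (torus_avg n S f)" by (rule torus_in_Lp_avg[OF f one_le_numeral])
  show sub: "int_lattice S \<subseteq> int_lattice {1..n}" using S by (auto simp: int_lattice_def)
  show "fourier_coeff n (torus_avg n S f) g = fourier_coeff n f g" if "g \<in> int_lattice S" for g
    using fourier_coeff_torus_avg[OF f S, of g] that sub by auto
  show "fourier_coeff n (torus_avg n S f) g = 0" if "g \<in> int_lattice {1..n} - int_lattice S" for g
    using fourier_coeff_torus_avg[OF f S, of g] that by auto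
qed

lemma is_fourier_sum_partial_part:
  assumes f: "torus_in_Lp n 2 f" and j: "j \<in> {1..n}"
  shows "is_fourier_sum n f {g \<in> int_lattice {1..n}. g j \<noteq> 0} (\<lambda>x. f x - torus_avg n ({1..n} - {j}) f x)"
proof -
  let ?T = "{1..n} - {j}"
  let ?h = "\<lambda>x. f x - torus_avg n ?T f x"
  have T: "?T \<subseteq> {1..n}" by blast
  have a: "torus_in_Lp n 2 (torus_avg n ?T f)" by (rule torus_in_Lp_avg[OF f one_le_numeral])
  note [measurable] = torus_in_LpD(1)[OF f] torus_in_LpD(1)[OF a]
  have coeff: "fourier_coeff n ?h g = fourier_coeff n f g - fourier_coeff n (torus_avg n ?T f) g" for g
    unfolding fourier_coeff_def left_diff_distrib
    by (intro Bochner_Integration.integral_diff integrable_mult_character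
        torus_in_Lp_integrable[OF one_le_numeral f] torus_in_Lp_integrable[OF one_le_numeral a])
  \<comment> \<open>The frequencies removed by subtracting the average are exactly those with
    \<open>g j = 0\<close>, so the remaining coefficients are those of the projection.\<close>
  have mem: "g \<in> int_lattice ?T \<longleftrightarrow> g j = 0" if "g \<in> int_lattice {1..n}" for g
    using that by (auto simp: int_lattice_def)
  show ?thesis
  proof (rule is_fourier_sumI)
    show "torus_in_Lp n 2 ?h"
      by (rule torus_in_Lp_triangle[OF one_le_numeral f a]) (measurable, rule AE_I2, rule norm_triangle_ineq4)
    show "fourier_coeff n ?h g = fourier_coeff n f g" if "g \<in> {g \<in> int_lattice {1..n}. g j \<noteq> 0}" for g
      using that mem[of g] fourier_coeff_torus_avg[OF f T, of g] coeff[of g] by simp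
    show "fourier_coeff n ?h g = 0" if "g \<in> int_lattice {1..n} - {g \<in> int_lattice {1..n}. g j \<noteq> 0}" for g
      using that mem[of g] fourier_coeff_torus_avg[OF f T, of g] coeff[of g] by simp
  qed blast
qed

theorem mainTheorem6:
  fixes p :: real
  assumes "2 \<le> p"
  shows "\<exists>C::real. C > 0 \<and>
    (\<forall>n::nat. n \<ge> 1 \<longrightarrow> (\<forall>k\<in>{1..n}. \<forall>f\<in>Lp n p. fourier_coeff n f (\<lambda>_. 0) = 0 \<longrightarrow>
      ennreal (1 / real (n choose k)) *
        (\<Sum>S\<in>{S. S \<subseteq> {1..n} \<and> card S = k}. Lp_norm_pow n p (fourier_sum n f (int_lattice S)))
      \<le> ennreal C *
        (ennreal (real k / real n) * (\<Sum>j=1..n. Lp_norm_pow n p (partial_part n j f))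
         + ennreal ((real k / real n) powr (p / 2)) * Lp_norm_pow n p f)))"
proof -
  obtain C :: real where C1: "1 \<le> C" and C: "\<And>a b :: complex. norm (a + b) powr p
      \<le> norm a powr p + p * (norm a powr (p - 2) * Re (cnj a * b)) + C * (norm a powr (p - 2) * (norm b)\<^sup>2 + norm b powr p)"
    using norm_add_powr_expansion[OF assms] by blast
  \<comment> \<open>\<open>C\<close> comes from the scalar expansion and depends on \<open>p\<close>
    alone, so \<open>K\<close> is fixed before \<open>n\<close>, \<open>k\<close> and
    \<open>f\<close>.\<close>
  define K where "K = 2 powr p * 2 powr p * (4 * C * (4 * C) powr ((p - 2) / 2) + 2 * C + 2 powr (p / 2))"
  have "0 < 4 * C * (4 * C) powr ((p - 2) / 2) + 2 * C + 2 powr (p / 2)"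
    using C1 by (intro add_nonneg_pos add_nonneg_nonneg mult_nonneg_nonneg) auto
  then have K: "0 < K" unfolding K_def by simp
  have "ennreal (1 / real (n choose k)) *
        (\<Sum>S\<in>{S. S \<subseteq> {1..n} \<and> card S = k}. Lp_norm_pow n p (fourier_sum n f (int_lattice S)))
      \<le> ennreal K *
        (ennreal (real k / real n) * (\<Sum>j=1..n. Lp_norm_pow n p (partial_part n j f))
         + ennreal ((real k / real n) powr (p / 2)) * Lp_norm_pow n p f)"
    if k: "k \<in> {1..n}" and f: "f \<in> Lp n p" and mean: "fourier_coeff n f (\<lambda>_. 0) = 0" for n k f
  proof -
    interpret finite_product_prob_space "\<lambda>_. unit_interval" "{1..n}" by (rule torus_locale)
    let ?L = "{S. S \<subseteq> {1..n} \<and> card S = k}"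
    let ?D = "\<lambda>j x. f x - torus_avg n ({1..n} - {j}) f x"
    have p1: "1 \<le> p" using assms by simp
    have fp: "torus_in_Lp n p f" using f by (simp only: Lp_iff_torus_in_Lp)
    have f2: "torus_in_Lp n 2 f" by (rule torus_in_Lp_2[OF fp assms])
    have avg: "Lp_norm_pow n p (fourier_sum n f (int_lattice S)) = ennreal (torus_pmoment n p (torus_avg n S f))"
      if "S \<in> ?L" for S
    proof -
      have "is_fourier_sum n f (int_lattice S) (torus_avg n S f)"
        using that by (intro is_fourier_sum_torus_avg f2) blast
      then show ?thesis
        by (simp only: Lp_norm_pow_fourier_sum Lp_norm_pow_eq_pmoment[OF torus_in_Lp_avg[OF fp p1]])
    qed
    have part: "Lp_norm_pow n p (partial_part n j f) = ennreal (torus_pmoment n p (?D j))" if "j \<in> {1..n}" for j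
    proof -
      note [measurable] = torus_in_LpD(1)[OF fp] torus_in_LpD(1)[OF torus_in_Lp_avg[OF fp p1, of "{1..n} - {j}"]]
      have "torus_in_Lp n p (?D j)"
        by (rule torus_in_Lp_triangle[OF p1 fp torus_in_Lp_avg[OF fp p1, of "{1..n} - {j}"]])
          (measurable, rule AE_I2, rule norm_triangle_ineq4)
      then show ?thesis
        unfolding partial_part_def Lp_norm_pow_fourier_sum[OF is_fourier_sum_partial_part[OF f2 that]]
        by (rule Lp_norm_pow_eq_pmoment)
    qed
    \<comment> \<open>The coefficient at frequency 0 is the mean, since that character is constantly
      1.\<close>
    have mean0: "(\<integral>x. f x \<partial>Pi\<^sub>M {1..n} (\<lambda>_. unit_interval)) = 0"
      using mean by (simp add: fourier_coeff_def torus_def)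
    have bound: "layer_avg p f k \<le> K * (real k / real n * (\<Sum>j\<in>{1..n}. torus_pmoment n p (?D j))
        + (real k / real n) powr (p / 2) * torus_pmoment n p f)"
      using layer_avg_bound[OF assms C1 C fp mean0, of k] k unfolding K_def card_atLeastAtMost by simp
    have "ennreal (1 / real (n choose k)) * (\<Sum>S\<in>?L. Lp_norm_pow n p (fourier_sum n f (int_lattice S)))
        = ennreal (1 / real (n choose k)) * ennreal (\<Sum>S\<in>?L. torus_pmoment n p (torus_avg n S f))"
      by (simp only: avg sum_ennreal[OF pmoment_nonneg] cong: sum.cong)
    also have "\<dots> = ennreal (layer_avg p f k)"
      unfolding layer_avg_def by (simp add: ennreal_mult'[symmetric] sum_nonneg)
    also have "\<dots> \<le> ennreal (K * (real k / real n * (\<Sum>j\<in>{1..n}. torus_pmoment n p (?D j))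
        + (real k / real n) powr (p / 2) * torus_pmoment n p f))"
      by (rule ennreal_leI[OF bound])
    also have "\<dots> = ennreal K * (ennreal (real k / real n) * ennreal (\<Sum>j\<in>{1..n}. torus_pmoment n p (?D j))
        + ennreal ((real k / real n) powr (p / 2)) * ennreal (torus_pmoment n p f))"
      using K by (simp only: ennreal_mult ennreal_plus less_imp_le mult_nonneg_nonneg add_nonneg_nonneg sum_nonneg
          pmoment_nonneg divide_nonneg_nonneg of_nat_0_le_iff powr_ge_zero)
    also have "ennreal (\<Sum>j\<in>{1..n}. torus_pmoment n p (?D j)) = (\<Sum>j=1..n. Lp_norm_pow n p (partial_part n j f))"
      by (simp only: part sum_ennreal[OF pmoment_nonneg] cong: sum.cong)
    also have "ennreal (torus_pmoment n p f) = Lp_norm_pow n p f"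
      by (rule Lp_norm_pow_eq_pmoment[OF fp, symmetric])
    finally show ?thesis .
  qed
  with K show ?thesis by (intro exI[of _ K]) blast
qed

end
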